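(* Let $J\subset\Pi$ be a subset. Then $C$ is a free $C^J$-module with basis $\{\Delta_w(\mu_J)+I_W\mid w\in W_J\}$. Moreover, the following are two pairs of adjoint graded functors (left adjoint written first): $$\Bigl(\operatorname{ind}_{C^J}^C(-),\ \operatorname{res}_{C^J}^C(-)\Bigr),\qquad \Bigl(\operatorname{res}_{C^J}^C(-),\ \operatorname{ind}_{C^J}^C(-)\langle-2\ell(w_J)\rangle\Bigr).$$
   Context: $W$ is the Weyl group of a finite dimensional complex semisimple Lie algebra $\mathfrak g$ with Cartan subalgebra $\mathfrak h$, root system $\Phi$, simple roots $\Pi$, positive roots $\Phi^+$ and length function $\ell$. $R:=S(\mathfrak h^* )$ is graded with $\mathfrak h^*$ in degree $2$; $I_W$ is the homogeneous ideal generated by the $W$-invariants of positive degree and $C:=R/I_W$ is the coinvariant algebra. For $J\subset\Pi$, $W_J$ is the parabolic subgroup generated by the $s_\alpha$, $\alpha\in J$, with longest element $w_J$; $C^J:=C^{W_J}$; $\Phi_J$ is the sub-root system generated by $J$, $\Phi_J^+:=\Phi^+\cap\Phi_J$, and $\mu_J:=\prod_{\alpha\in\Phi_J^+}\alpha\in R$. For $\alpha\in\Pi$ the Demazure operator on $R$ is $\Delta_{s_\alpha}(f):=(f-s_\alpha f)/\alpha$; for a reduced expression $w=s_{j_1}\cdots s_{j_k}$, $\Delta_w:=\Delta_{s_{j_1}}\cdots\Delta_{s_{j_k}}$ (independent of the reduced expression). For a graded algebra $A$, $A\text{-gmod}$ is the category of finite dimensional $\mathbb Z$-graded left $A$-modules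 with degree $0$ homomorphisms (denoted $\hom_A$). Shift: $M\langle k\rangle_d:=M_{d-k}$. $\operatorname{ind}_{C^J}^C:=C\otimes_{C^J}-: C^J\text{-gmod}\to C\text{-gmod}$, and $\operatorname{res}^C_{C^J}$ is restriction. Adjointness of graded functors means natural isomorphisms between the corresponding spaces $\hom$ of degree $0$ homomorphisms. *)

theory Defs
  imports Complex_Main "HOL-Library.Function_Algebras"
    "HOL-Algebra.QuotRing" "HOL-Algebra.Module" "HOL-Algebra.Free_Abelian_Groups"
begin

section \<open>Root systems and Weyl groups\<close>

text \<open>
  The Cartan subalgebra is a finite dimensional complex vector space given by a type \<open>'h\<close> and
  a scalar multiplication \<open>sc\<close>; elements of its dual are functions \<open>'h \<Rightarrow> complex\<close>.
\<close>

definition dual :: "(complex \<Rightarrow> 'h::ab_group_add \<Rightarrow> 'h) \<Rightarrow> ('h \<Rightarrow> complex) set" where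
  "dual sc = {f. Vector_Spaces.linear sc (*) f}"

definition fscale :: "complex \<Rightarrow> ('h \<Rightarrow> complex) \<Rightarrow> 'h \<Rightarrow> complex" where
  "fscale c f = (\<lambda>h. c * f h)"

text \<open>
  \<open>cr \<alpha>\<close> is the coroot of the root \<open>\<alpha>\<close>, an element of the Cartan subalgebra.  \<open>refl\<close> is the
  reflection on the Cartan subalgebra, \<open>refl_dual\<close> the reflection on its dual; they are related by
  \<open>refl_dual cr \<alpha> f = f \<circ> refl sc cr \<alpha>\<close> for linear \<open>f\<close>.
\<close>

definition refl :: "(complex \<Rightarrow> 'h::ab_group_add \<Rightarrow> 'h) \<Rightarrow> (('h \<Rightarrow> complex) \<Rightarrow> 'h)
    \<Rightarrow> ('h \<Rightarrow> complex) \<Rightarrow> 'h \<Rightarrow> 'h" where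
  "refl sc cr \<alpha> h = h - sc (\<alpha> h) (cr \<alpha>)"

definition refl_dual :: "(('h \<Rightarrow> complex) \<Rightarrow> 'h)
    \<Rightarrow> ('h \<Rightarrow> complex) \<Rightarrow> ('h \<Rightarrow> complex) \<Rightarrow> 'h \<Rightarrow> complex" where
  "refl_dual cr \<alpha> f = (\<lambda>h. f h - f (cr \<alpha>) * \<alpha> h)"

text \<open>
  The data \<open>(\<Phi>, cr)\<close> of the roots and coroots of a finite dimensional complex semisimple Lie
  algebra with respect to a Cartan subalgebra: a reduced (crystallographic) root system in the
  dual of the Cartan subalgebra, in the sense of Bourbaki.
\<close>

locale root_system = vector_space sc
  for sc :: "complex \<Rightarrow> 'h::ab_group_add \<Rightarrow> 'h" +
  fixes \<Phi> :: "('h \<Rightarrow> complex) set" and cr :: "('h \<Rightarrow> complex) \<Rightarrow> 'h"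
  assumes finite_dim: "\<exists>B. finite B \<and> span B = UNIV"
    and finite_roots: "finite \<Phi>"
    and span_roots: "module.span fscale \<Phi> = dual sc"
    and root_coroot: "\<alpha> \<in> \<Phi> \<Longrightarrow> \<alpha> (cr \<alpha>) = 2"
    and refl_root: "\<alpha> \<in> \<Phi> \<Longrightarrow> \<beta> \<in> \<Phi> \<Longrightarrow> refl_dual cr \<alpha> \<beta> \<in> \<Phi>"
    and integral: "\<alpha> \<in> \<Phi> \<Longrightarrow> \<beta> \<in> \<Phi> \<Longrightarrow> \<beta> (cr \<alpha>) \<in> \<int>"
    and reduced: "\<alpha> \<in> \<Phi> \<Longrightarrow> fscale c \<alpha> \<in> \<Phi> \<Longrightarrow> c = 1 \<or> c = -1"

definition pos_roots :: "('h \<Rightarrow> complex) set \<Rightarrow> ('h \<Rightarrow> complex) set \<Rightarrow> ('h \<Rightarrow> complex) set" where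
  "pos_roots \<Phi> simples =
     {\<alpha> \<in> \<Phi>. \<exists>n :: ('h \<Rightarrow> complex) \<Rightarrow> nat. \<alpha> = (\<Sum>\<beta>\<in>simples. fscale (of_nat (n \<beta>)) \<beta>)}"

definition simple_roots :: "('h \<Rightarrow> complex) set \<Rightarrow> ('h \<Rightarrow> complex) set \<Rightarrow> bool" where
  "simple_roots \<Phi> simples \<longleftrightarrow>
     simples \<subseteq> \<Phi> \<and> \<not> module.dependent fscale simples \<and>
     (\<forall>\<alpha>\<in>\<Phi>. \<alpha> \<in> pos_roots \<Phi> simples \<or> - \<alpha> \<in> pos_roots \<Phi> simples)"

text \<open>The product of the reflections in a list of roots, as a map on the Cartan subalgebra.\<close>

definition refl_word :: "(complex \<Rightarrow> 'h::ab_group_add \<Rightarrow> 'h) \<Rightarrow> (('h \<Rightarrow> complex) \<Rightarrow> 'h)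
    \<Rightarrow> ('h \<Rightarrow> complex) list \<Rightarrow> 'h \<Rightarrow> 'h" where
  "refl_word sc cr as = foldr (\<lambda>\<alpha> w. refl sc cr \<alpha> \<circ> w) as id"

text \<open>
  The group generated by the reflections in the roots in \<open>A\<close>.  Reflections are involutions, so
  products suffice.  The Weyl group is \<open>refl_group sc cr \<Phi>\<close>.
\<close>

definition refl_group :: "(complex \<Rightarrow> 'h::ab_group_add \<Rightarrow> 'h) \<Rightarrow> (('h \<Rightarrow> complex) \<Rightarrow> 'h)
    \<Rightarrow> ('h \<Rightarrow> complex) set \<Rightarrow> ('h \<Rightarrow> 'h) set" where
  "refl_group sc cr A = {refl_word sc cr as | as. set as \<subseteq> A}"

definition weyl_length :: "(complex \<Rightarrow> 'h::ab_group_add \<Rightarrow> 'h) \<Rightarrow> (('h \<Rightarrow> complex) \<Rightarrow> 'h)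
    \<Rightarrow> ('h \<Rightarrow> complex) set \<Rightarrow> ('h \<Rightarrow> 'h) \<Rightarrow> nat" where
  "weyl_length sc cr simples w =
     (LEAST k. \<exists>as. set as \<subseteq> simples \<and> length as = k \<and> refl_word sc cr as = w)"

definition reduced_word :: "(complex \<Rightarrow> 'h::ab_group_add \<Rightarrow> 'h) \<Rightarrow> (('h \<Rightarrow> complex) \<Rightarrow> 'h)
    \<Rightarrow> ('h \<Rightarrow> complex) set \<Rightarrow> ('h \<Rightarrow> 'h) \<Rightarrow> ('h \<Rightarrow> complex) list \<Rightarrow> bool" where
  "reduced_word sc cr simples w as \<longleftrightarrow>
     set as \<subseteq> simples \<and> refl_word sc cr as = w \<and> length as = weyl_length sc cr simples w"

definition longest :: "(complex \<Rightarrow> 'h::ab_group_add \<Rightarrow> 'h) \<Rightarrow> (('h \<Rightarrow> complex) \<Rightarrow> 'h)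
    \<Rightarrow> ('h \<Rightarrow> complex) set \<Rightarrow> ('h \<Rightarrow> complex) set \<Rightarrow> ('h \<Rightarrow> 'h)" where
  "longest sc cr simples J = arg_max (weyl_length sc cr simples) (\<lambda>w. w \<in> refl_group sc cr J)"

text \<open>The root subsystem generated by \<open>J\<close>.\<close>

inductive_set sub_roots :: "(('h \<Rightarrow> complex) \<Rightarrow> 'h) \<Rightarrow> ('h \<Rightarrow> complex) set \<Rightarrow> ('h \<Rightarrow> complex) set"
  for cr J where
  base: "\<alpha> \<in> J \<Longrightarrow> \<alpha> \<in> sub_roots cr J"
| refl: "\<alpha> \<in> sub_roots cr J \<Longrightarrow> \<beta> \<in> sub_roots cr J \<Longrightarrow> refl_dual cr \<alpha> \<beta> \<in> sub_roots cr J"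

definition mu :: "(('h \<Rightarrow> complex) \<Rightarrow> 'h) \<Rightarrow> ('h \<Rightarrow> complex) set
    \<Rightarrow> ('h \<Rightarrow> complex) set \<Rightarrow> ('h \<Rightarrow> complex) set \<Rightarrow> 'h \<Rightarrow> complex" where
  "mu cr \<Phi> simples J = (\<Prod>\<alpha> \<in> pos_roots \<Phi> simples \<inter> sub_roots cr J. \<alpha>)"


section \<open>Graded algebras and graded modules\<close>

text \<open>
  A graded complex algebra is an element of \<open>(complex, 'a) graded\<close>.  A graded module over it is an
  element of \<open>('a, 'm) graded\<close>; its fields \<open>mult\<close> and \<open>one\<close> are irrelevant.
\<close>

record ('a, 'm) graded = "('a, 'm) module" +
  grade :: "int \<Rightarrow> 'm set"

definition const :: "(complex, 'a) graded \<Rightarrow> complex \<Rightarrow> 'a" where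
  "const A c = c \<odot>\<^bsub>A\<^esub> \<one>\<^bsub>A\<^esub>"

definition graded_decomp :: "('a, 'm) graded \<Rightarrow> bool" where
  "graded_decomp M \<longleftrightarrow>
     (\<forall>d. additive_subgroup (grade M d) M) \<and>
     (\<forall>m\<in>carrier M. \<exists>!x. (\<forall>d. x d \<in> grade M d) \<and> finite {d. x d \<noteq> \<zero>\<^bsub>M\<^esub>} \<and>
        m = (\<Oplus>\<^bsub>M\<^esub>d\<in>{d. x d \<noteq> \<zero>\<^bsub>M\<^esub>}. x d))"

definition fin_dim :: "(complex, 'a) graded \<Rightarrow> ('a, 'm) graded \<Rightarrow> bool" where
  "fin_dim A M \<longleftrightarrow> (\<exists>B. finite B \<and> B \<subseteq> carrier M \<and>
     (\<forall>m\<in>carrier M. \<exists>c. m = (\<Oplus>\<^bsub>M\<^esub>b\<in>B. const A (c b) \<odot>\<^bsub>M\<^esub> b)))"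

text \<open>The objects and the morphisms of the category of finite dimensional graded modules.\<close>

definition gmod :: "(complex, 'a) graded \<Rightarrow> ('a, 'm) graded set" where
  "gmod A = {M. Module.module A M \<and> fin_dim A M \<and> graded_decomp M \<and>
     (\<forall>i j. \<forall>a\<in>grade A i. \<forall>m\<in>grade M j. a \<odot>\<^bsub>M\<^esub> m \<in> grade M (i + j))}"

definition ghom :: "(complex, 'a) graded \<Rightarrow> ('a, 'm) graded \<Rightarrow> ('a, 'n) graded \<Rightarrow> ('m \<Rightarrow> 'n) set" where
  "ghom A M N = {f \<in> carrier M \<rightarrow>\<^sub>E carrier N.
     (\<forall>x\<in>carrier M. \<forall>y\<in>carrier M. f (x \<oplus>\<^bsub>M\<^esub> y) = f x \<oplus>\<^bsub>N\<^esub> f y) \<and>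
     (\<forall>a\<in>carrier A. \<forall>x\<in>carrier M. f (a \<odot>\<^bsub>M\<^esub> x) = a \<odot>\<^bsub>N\<^esub> f x) \<and>
     (\<forall>d. f ` grade M d \<subseteq> grade N d)}"

definition shift :: "int \<Rightarrow> ('a, 'm) graded \<Rightarrow> ('a, 'm) graded" where
  "shift k M = M\<lparr>grade := (\<lambda>d. grade M (d - k))\<rparr>"

definition regular :: "(complex, 'a) graded \<Rightarrow> ('a, 'a) graded" where
  "regular A = \<lparr>carrier = carrier A, mult = mult A, one = \<one>\<^bsub>A\<^esub>, ring.zero = \<zero>\<^bsub>A\<^esub>, add = add A,
     smult = mult A, grade = grade A\<rparr>"

text \<open>
  \<open>x\<close> is a basis of the module \<open>M\<close>, as a family indexed by \<open>I\<close>; in particular the \<open>x i\<close> are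
  distinct if \<open>A\<close> is nontrivial.
\<close>

definition free_basis :: "(complex, 'a) graded \<Rightarrow> ('a, 'm) graded \<Rightarrow> 'i set \<Rightarrow> ('i \<Rightarrow> 'm) \<Rightarrow> bool" where
  "free_basis A M I x \<longleftrightarrow> Module.module A M \<and> x ` I \<subseteq> carrier M \<and>
     (\<forall>m\<in>carrier M. \<exists>!c. c \<in> I \<rightarrow>\<^sub>E carrier A \<and> finite {i \<in> I. c i \<noteq> \<zero>\<^bsub>A\<^esub>} \<and>
        m = (\<Oplus>\<^bsub>M\<^esub>i\<in>{i \<in> I. c i \<noteq> \<zero>\<^bsub>A\<^esub>}. c i \<odot>\<^bsub>M\<^esub> x i))"


section \<open>Functors and adjunctions\<close>

text \<open>
  \<open>F\<close> and \<open>Fm\<close> are the actions of a functor from graded \<open>A\<close>-modules to graded \<open>B\<close>-modules on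
  objects and on morphisms; \<open>Fm\<close> also receives source and target.
\<close>

definition gfunctor :: "(complex, 'a) graded \<Rightarrow> (complex, 'b) graded
    \<Rightarrow> (('a, 'm) graded \<Rightarrow> ('b, 'n) graded)
    \<Rightarrow> (('a, 'm) graded \<Rightarrow> ('a, 'm) graded \<Rightarrow> ('m \<Rightarrow> 'm) \<Rightarrow> ('n \<Rightarrow> 'n)) \<Rightarrow> bool" where
  "gfunctor A B F Fm \<longleftrightarrow>
     (\<forall>M\<in>gmod A. F M \<in> gmod B) \<and>
     (\<forall>M\<in>gmod A. \<forall>M'\<in>gmod A. \<forall>f\<in>ghom A M M'. Fm M M' f \<in> ghom B (F M) (F M')) \<and>
     (\<forall>M\<in>gmod A. Fm M M (restrict id (carrier M)) = restrict id (carrier (F M))) \<and>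
     (\<forall>M\<in>gmod A. \<forall>M'\<in>gmod A. \<forall>M''\<in>gmod A. \<forall>f\<in>ghom A M M'. \<forall>g\<in>ghom A M' M''.
        Fm M M'' (compose (carrier M) g f) = compose (carrier (F M)) (Fm M' M'' g) (Fm M M' f))"

text \<open>
  \<open>F\<close> is left adjoint to \<open>G\<close>: there are complex linear isomorphisms
  \<open>\<theta> M N : hom\<^sub>B (F M, N) \<rightarrow> hom\<^sub>A (M, G N)\<close>, natural in both \<open>M\<close> and \<open>N\<close>.  The modules on which
  \<open>F\<close> and \<open>G\<close> are evaluated have elements in arbitrary types \<open>'m\<close> and \<open>'n\<close>, which may differ from
  the types \<open>'t\<close> and \<open>'s\<close> of the elements of the values.
\<close>

definition gadjoint :: "(complex, 'a) graded \<Rightarrow> (complex, 'b) graded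
    \<Rightarrow> (('a, 'm) graded \<Rightarrow> ('b, 't) graded)
    \<Rightarrow> (('a, 'm) graded \<Rightarrow> ('a, 'm) graded \<Rightarrow> ('m \<Rightarrow> 'm) \<Rightarrow> ('t \<Rightarrow> 't))
    \<Rightarrow> (('b, 'n) graded \<Rightarrow> ('a, 's) graded)
    \<Rightarrow> (('b, 'n) graded \<Rightarrow> ('b, 'n) graded \<Rightarrow> ('n \<Rightarrow> 'n) \<Rightarrow> ('s \<Rightarrow> 's)) \<Rightarrow> bool" where
  "gadjoint A B F Fm G Gm \<longleftrightarrow> gfunctor A B F Fm \<and> gfunctor B A G Gm \<and>
     (\<exists>\<theta> :: ('a, 'm) graded \<Rightarrow> ('b, 'n) graded \<Rightarrow> ('t \<Rightarrow> 'n) \<Rightarrow> ('m \<Rightarrow> 's).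
        (\<forall>M\<in>gmod A. \<forall>N\<in>gmod B.
           bij_betw (\<theta> M N) (ghom B (F M) N) (ghom A M (G N)) \<and>
           (\<forall>\<phi>\<in>ghom B (F M) N. \<forall>\<psi>\<in>ghom B (F M) N.
              \<theta> M N (\<lambda>x\<in>carrier (F M). \<phi> x \<oplus>\<^bsub>N\<^esub> \<psi> x) =
                (\<lambda>x\<in>carrier M. \<theta> M N \<phi> x \<oplus>\<^bsub>G N\<^esub> \<theta> M N \<psi> x)) \<and>
           (\<forall>c. \<forall>\<phi>\<in>ghom B (F M) N.
              \<theta> M N (\<lambda>x\<in>carrier (F M). const B c \<odot>\<^bsub>N\<^esub> \<phi> x) =
                (\<lambda>x\<in>carrier M. const A c \<odot>\<^bsub>G N\<^esub> \<theta> M N \<phi> x))) \<and>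
        (\<forall>M\<in>gmod A. \<forall>M'\<in>gmod A. \<forall>N\<in>gmod B. \<forall>N'\<in>gmod B.
           \<forall>f\<in>ghom A M' M. \<forall>g\<in>ghom B N N'. \<forall>\<phi>\<in>ghom B (F M) N.
              \<theta> M' N' (compose (carrier (F M')) g (compose (carrier (F M')) \<phi> (Fm M' M f))) =
                compose (carrier M') (Gm N N' g) (compose (carrier M') (\<theta> M N \<phi>) f)))"


section \<open>Restriction and induction\<close>

text \<open>In this section \<open>B\<close> is a graded subalgebra of \<open>A\<close>.\<close>

definition res :: "(complex, 'a) graded \<Rightarrow> ('a, 'm) graded \<Rightarrow> ('a, 'm) graded" where
  "res B M = M\<lparr>smult := restrict (smult M) (carrier B)\<rparr>"

definition res_mor :: "('a, 'm) graded \<Rightarrow> ('a, 'm) graded \<Rightarrow> ('m \<Rightarrow> 'm) \<Rightarrow> ('m \<Rightarrow> 'm)" where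
  "res_mor M M' f = f"

text \<open>
  The tensor product of \<open>A\<close> and \<open>M\<close> over \<open>B\<close> is the quotient of the free abelian group on
  \<open>carrier A \<times> carrier M\<close> by the subgroup \<open>tensor_rel A B M\<close>.
\<close>

abbreviation tensor_free :: "(complex, 'a) graded \<Rightarrow> ('a, 'm) graded \<Rightarrow> ('a \<times> 'm \<Rightarrow>\<^sub>0 int) monoid" where
  "tensor_free A M \<equiv> free_Abelian_group (carrier A \<times> carrier M)"

definition tensor_rel :: "(complex, 'a) graded \<Rightarrow> (complex, 'a) graded \<Rightarrow> ('a, 'm) graded
    \<Rightarrow> ('a \<times> 'm \<Rightarrow>\<^sub>0 int) set" where
  "tensor_rel A B M = generate (tensor_free A M)
     ({frag_of (a \<oplus>\<^bsub>A\<^esub> a', m) - frag_of (a, m) - frag_of (a', m) | a a' m.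
         a \<in> carrier A \<and> a' \<in> carrier A \<and> m \<in> carrier M} \<union>
      {frag_of (a, m \<oplus>\<^bsub>M\<^esub> m') - frag_of (a, m) - frag_of (a, m') | a m m'.
         a \<in> carrier A \<and> m \<in> carrier M \<and> m' \<in> carrier M} \<union>
      {frag_of (a \<otimes>\<^bsub>A\<^esub> b, m) - frag_of (a, b \<odot>\<^bsub>M\<^esub> m) | a b m.
         a \<in> carrier A \<and> b \<in> carrier B \<and> m \<in> carrier M})"

definition tensor_coset :: "(complex, 'a) graded \<Rightarrow> (complex, 'a) graded \<Rightarrow> ('a, 'm) graded
    \<Rightarrow> ('a \<times> 'm \<Rightarrow>\<^sub>0 int) \<Rightarrow> ('a \<times> 'm \<Rightarrow>\<^sub>0 int) set" where
  "tensor_coset A B M x = tensor_rel A B M #>\<^bsub>tensor_free A M\<^esub> x"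

text \<open>
  Scalars act by \<open>a' \<cdot> (a \<otimes> m) = a' a \<otimes> m\<close>, and \<open>id \<otimes> f\<close> sends \<open>a \<otimes> m\<close> to \<open>a \<otimes> f m\<close>.
  Both maps are given on representatives; the unions below are over equal cosets.
\<close>

definition ind :: "(complex, 'a) graded \<Rightarrow> (complex, 'a) graded \<Rightarrow> ('a, 'm) graded
    \<Rightarrow> ('a, ('a \<times> 'm \<Rightarrow>\<^sub>0 int) set) graded" where
  "ind A B M =
     (let T = tensor_free A M Mod tensor_rel A B M in
      \<lparr>carrier = carrier T, mult = undefined, one = undefined, ring.zero = \<one>\<^bsub>T\<^esub>, add = mult T,
       smult = (\<lambda>a' X. \<Union>x\<in>X. tensor_coset A B M
                  (frag_extend (\<lambda>(a, m). frag_of (a' \<otimes>\<^bsub>A\<^esub> a, m)) x)),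
       grade = (\<lambda>d. generate T {tensor_coset A B M (frag_of (a, m)) | a m.
                  \<exists>i j. i + j = d \<and> a \<in> grade A i \<and> m \<in> grade M j})\<rparr>)"

definition ind_mor :: "(complex, 'a) graded \<Rightarrow> (complex, 'a) graded
    \<Rightarrow> ('a, 'm) graded \<Rightarrow> ('a, 'm) graded \<Rightarrow> ('m \<Rightarrow> 'm)
    \<Rightarrow> ('a \<times> 'm \<Rightarrow>\<^sub>0 int) set \<Rightarrow> ('a \<times> 'm \<Rightarrow>\<^sub>0 int) set" where
  "ind_mor A B M M' f = (\<lambda>X\<in>carrier (ind A B M).
     \<Union>x\<in>X. tensor_coset A B M' (frag_extend (\<lambda>(a, m). frag_of (a, f m)) x))"


section \<open>The coinvariant algebra\<close>

text \<open>
  The symmetric algebra of the dual of a finite dimensional complex vector space is realised as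
  the algebra of polynomial functions on that space; linear functions have degree 2.
\<close>

inductive_set poly_funs :: "(complex \<Rightarrow> 'h::ab_group_add \<Rightarrow> 'h) \<Rightarrow> ('h \<Rightarrow> complex) set"
  for sc where
  const: "(\<lambda>_. c) \<in> poly_funs sc"
| linear: "f \<in> dual sc \<Longrightarrow> f \<in> poly_funs sc"
| add: "f \<in> poly_funs sc \<Longrightarrow> g \<in> poly_funs sc \<Longrightarrow> f + g \<in> poly_funs sc"
| mult: "f \<in> poly_funs sc \<Longrightarrow> g \<in> poly_funs sc \<Longrightarrow> f * g \<in> poly_funs sc"

definition sym_alg :: "(complex \<Rightarrow> 'h::ab_group_add \<Rightarrow> 'h) \<Rightarrow> (complex, 'h \<Rightarrow> complex) graded" where
  "sym_alg sc = \<lparr>carrier = poly_funs sc, mult = (*), one = 1, ring.zero = 0, add = (+),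
     smult = fscale,
     grade = (\<lambda>d. if d \<ge> 0 \<and> even d
       then {f \<in> poly_funs sc. \<forall>c h. f (sc c h) = c ^ nat (d div 2) * f h} else {0})\<rparr>"

definition act :: "('h \<Rightarrow> 'h) \<Rightarrow> ('h \<Rightarrow> complex) \<Rightarrow> 'h \<Rightarrow> complex" where
  "act w f = f \<circ> inv_into UNIV w"

definition coinv_ideal :: "(complex \<Rightarrow> 'h::ab_group_add \<Rightarrow> 'h) \<Rightarrow> (('h \<Rightarrow> complex) \<Rightarrow> 'h)
    \<Rightarrow> ('h \<Rightarrow> complex) set \<Rightarrow> ('h \<Rightarrow> complex) set" where
  "coinv_ideal sc cr \<Phi> = genideal (sym_alg sc)
     (\<Union>d\<in>{0<..}. {f \<in> grade (sym_alg sc) d. \<forall>w\<in>refl_group sc cr \<Phi>. act w f = f})"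

definition quot_alg :: "(complex, 'a) graded \<Rightarrow> 'a set \<Rightarrow> (complex, 'a set) graded" where
  "quot_alg A I = \<lparr>carrier = carrier (A Quot I), mult = mult (A Quot I), one = \<one>\<^bsub>A Quot I\<^esub>,
     ring.zero = \<zero>\<^bsub>A Quot I\<^esub>, add = add (A Quot I),
     smult = (\<lambda>c X. (I +>\<^bsub>A\<^esub> const A c) \<otimes>\<^bsub>A Quot I\<^esub> X),
     grade = (\<lambda>d. (\<lambda>a. I +>\<^bsub>A\<^esub> a) ` grade A d)\<rparr>"

definition coinv_alg :: "(complex \<Rightarrow> 'h::ab_group_add \<Rightarrow> 'h) \<Rightarrow> (('h \<Rightarrow> complex) \<Rightarrow> 'h)
    \<Rightarrow> ('h \<Rightarrow> complex) set \<Rightarrow> (complex, ('h \<Rightarrow> complex) set) graded" where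
  "coinv_alg sc cr \<Phi> = quot_alg (sym_alg sc) (coinv_ideal sc cr \<Phi>)"

definition coinv_proj :: "(complex \<Rightarrow> 'h::ab_group_add \<Rightarrow> 'h) \<Rightarrow> (('h \<Rightarrow> complex) \<Rightarrow> 'h)
    \<Rightarrow> ('h \<Rightarrow> complex) set \<Rightarrow> ('h \<Rightarrow> complex) \<Rightarrow> ('h \<Rightarrow> complex) set" where
  "coinv_proj sc cr \<Phi> f = coinv_ideal sc cr \<Phi> +>\<^bsub>sym_alg sc\<^esub> f"

text \<open>
  The subalgebra of \<open>W\<^sub>J\<close>-invariants.  The ideal is stable under the Weyl group, so \<open>w\<close> acts on the
  quotient by \<open>X \<mapsto> act w ` X\<close>.
\<close>

definition coinv_inv :: "(complex \<Rightarrow> 'h::ab_group_add \<Rightarrow> 'h) \<Rightarrow> (('h \<Rightarrow> complex) \<Rightarrow> 'h)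
    \<Rightarrow> ('h \<Rightarrow> complex) set \<Rightarrow> ('h \<Rightarrow> complex) set \<Rightarrow> (complex, ('h \<Rightarrow> complex) set) graded" where
  "coinv_inv sc cr \<Phi> J =
     (let C = coinv_alg sc cr \<Phi>;
          Inv = {X. \<forall>w\<in>refl_group sc cr J. act w ` X = X}
      in C\<lparr>carrier := carrier C \<inter> Inv, grade := (\<lambda>d. grade C d \<inter> Inv)\<rparr>)"

text \<open>
  \<open>(f - s\<^sub>\<alpha> f) / \<alpha>\<close>, where the quotient is taken in the ring of polynomial functions.
\<close>

definition demazure :: "(complex \<Rightarrow> 'h::ab_group_add \<Rightarrow> 'h) \<Rightarrow> (('h \<Rightarrow> complex) \<Rightarrow> 'h)
    \<Rightarrow> ('h \<Rightarrow> complex) \<Rightarrow> ('h \<Rightarrow> complex) \<Rightarrow> 'h \<Rightarrow> complex" where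
  "demazure sc cr \<alpha> f = (THE g. g \<in> poly_funs sc \<and> \<alpha> * g = f - act (refl sc cr \<alpha>) f)"

text \<open>The result does not depend on the choice of the reduced word.\<close>

definition demazure_elt :: "(complex \<Rightarrow> 'h::ab_group_add \<Rightarrow> 'h) \<Rightarrow> (('h \<Rightarrow> complex) \<Rightarrow> 'h)
    \<Rightarrow> ('h \<Rightarrow> complex) set \<Rightarrow> ('h \<Rightarrow> 'h) \<Rightarrow> ('h \<Rightarrow> complex) \<Rightarrow> 'h \<Rightarrow> complex" where
  "demazure_elt sc cr simples w =
     foldr (\<lambda>\<alpha> D. demazure sc cr \<alpha> \<circ> D) (SOME as. reduced_word sc cr simples w as) id"

end

theory Submission
  imports Defs "HOL-Computational_Algebra.Polynomial"
begin

text \<open>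
  Write \<open>R\<close> for the polynomial functions and \<open>R\<^sup>J\<close> for the \<open>W\<^sub>J\<close>-invariants.  The top Demazure operator
  \<open>D = \<Delta>\<^sub>w\<^sub>J : R \<rightarrow> R\<^sup>J\<close> is \<open>R\<^sup>J\<close>-linear, lowers the polynomial degree by \<open>\<ell>(w\<^sub>J)\<close>, and satisfies
  \<open>D (\<Delta>\<^sub>u f \<cdot> g) = D (f \<cdot> \<Delta>\<^sub>u\<^sub>-\<^sub>1 g)\<close>.  Since \<open>\<Delta>\<^sub>u \<Delta>\<^sub>v\<close> is \<open>\<Delta>\<^sub>u\<^sub>v\<close> or \<open>0\<close> according as the lengths add up or
  not, the matrix of \<open>D (\<Delta>\<^sub>u \<mu>\<^sub>J \<cdot> \<Delta>\<^sub>v \<mu>\<^sub>J)\<close> is triangular for the length, with the constant \<open>D \<mu>\<^sub>J\<close> on the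
  antidiagonal \<open>u v = w\<^sub>J\<close>.  This constant is not zero: \<open>D (\<rho>\<^sup>\<ell>)\<close> is positive by Chevalley's formula, and
  the antisymmetrization of \<open>\<rho>\<^sup>\<ell>\<close> is a multiple of \<open>\<mu>\<^sub>J\<close>.  Hence the \<open>\<Delta>\<^sub>w \<mu>\<^sub>J\<close> have a dual family
  \<open>x\<^sub>w\<close> for the form \<open>D (f g)\<close> and \<open>R\<close> is free over \<open>R\<^sup>J\<close>; as \<open>I\<^sub>W\<close> is generated by elements of \<open>R\<^sup>J\<close>,
  all of this descends to \<open>C\<close> over \<open>C\<^sup>J\<close>.

  So \<open>C\<close> is a graded Frobenius extension of \<open>C\<^sup>J\<close> with trace \<open>D\<close> and dual bases \<open>x\<^sub>w\<close>, \<open>y\<^sub>w\<close>.  The second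
  adjunction sends \<open>\<phi> : res M \<rightarrow> N\<close> to \<open>m \<mapsto> \<Sum>\<^sub>w y\<^sub>w \<otimes> \<phi> (x\<^sub>w m)\<close>, with inverse
  \<open>\<psi> \<mapsto> (D \<otimes> 1) \<circ> \<psi>\<close>.
\<close>

section \<open>Coroots and reflections\<close>

text \<open>No braid relation is used. That a word gives an operator depending only on its product,
  and zero if it is not reduced, is proved in one induction together with Chevalley's formula for
  the operator of a product with a linear form; each statement feeds the other.

  The axioms live over the complex numbers and give the coroots as a mere function. Hence
  equivariance of coroots has to be derived from their uniqueness, and every positivity argument
  goes through natural coordinates or through an invariant form that takes positive integral values
  on roots.

  The triangular matrix is not inverted as a whole: its entries are polynomials, and a dual family
  grown length by length stays homogeneous of known degree, which the graded adjunction needs.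

  For the descent, the trace preserves the ideal because it is linear over generators, and averaging
  over W_J shows that invariant classes have invariant representatives. The 2 in the shift arises
  because linear functions have degree 2, whereas the polynomial part counts ordinary
  degree.\<close>

lemma vector_space_fscale: "vector_space (fscale :: complex \<Rightarrow> ('h \<Rightarrow> complex) \<Rightarrow> _)"
  by unfold_locales (auto simp: fscale_def fun_eq_iff algebra_simps)

interpretation fs: vector_space "fscale :: complex \<Rightarrow> ('h \<Rightarrow> complex) \<Rightarrow> _"
  by (rule vector_space_fscale)

lemma fscale_mult: "fscale c f = (\<lambda>_. c) * f"
  by (auto simp: fscale_def fun_eq_iff)

lemma fscale_apply [simp]: "fscale c f h = c * f h"
  by (simp add: fscale_def)

lemma sum_fun_apply: "(\<Sum>i\<in>A. f i) h = (\<Sum>i\<in>A. (f i h :: complex))"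
  by (induction A rule: infinite_finite_induct) auto

lemma act_comp:
  assumes "bij v" "bij w"
  shows "act (v \<circ> w) f = act v (act w f)"
  using assms by (simp add: act_def o_inv_distrib comp_assoc)

lemma act_id [simp]: "act id f = f"
  by (simp add: act_def)

lemma act_add: "act w (f + g) = act w f + act w g"
  by (auto simp: act_def fun_eq_iff)

lemma act_diff: "act w (f - g) = act w f - act w g"
  by (auto simp: act_def fun_eq_iff)

lemma act_uminus: "act w (- f) = - act w f"
  by (auto simp: act_def fun_eq_iff)

lemma act_mult: "act w (f * g) = act w f * act w g"
  by (auto simp: act_def fun_eq_iff)

lemma act_const: "act w (\<lambda>_. c) = (\<lambda>_. c)"
  by (auto simp: act_def fun_eq_iff)

lemma act_fscale: "act w (fscale c f) = fscale c (act w f)"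
  by (auto simp: act_def fun_eq_iff)

lemma act_zero: "act w 0 = 0"
  by (auto simp: act_def fun_eq_iff)

lemma act_sum: "act w (\<Sum>i\<in>A. f i) = (\<Sum>i\<in>A. act w (f i))"
proof (induction A rule: infinite_finite_induct)
  case (insert x F)
  show ?case
    using insert(3) by (simp only: act_add sum.insert[OF insert(1,2)])
qed (simp_all add: act_const)

lemma dual_add: "f \<in> dual sc \<Longrightarrow> f (h + k) = f h + f k"
  and dual_scale: "f \<in> dual sc \<Longrightarrow> f (sc c h) = c * f h"
  by (auto simp: dual_def linear_iff_module_hom module_hom_def module_hom_axioms_def
       Vector_Spaces.linear_def)

lemma dual_minus: "f \<in> dual sc \<Longrightarrow> f (- h) = - f h"
  by (metis add.inverse_inverse add_eq_0_iff dual_add add.right_neutral add_left_cancel)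

lemma dual_diff: "f \<in> dual sc \<Longrightarrow> f (h - k) = f h - f k"
  by (metis diff_conv_add_uminus dual_add dual_minus)

context root_system
begin

abbreviation "s \<equiv> refl sc cr"
abbreviation "wd \<equiv> refl_word sc cr"
abbreviation "R \<equiv> poly_funs sc"

lemma dualI: "(\<And>h k. f (h + k) = f h + f k) \<Longrightarrow> (\<And>c h. f (sc c h) = c * f h) \<Longrightarrow> f \<in> dual sc"
  unfolding dual_def mem_Collect_eq
  by unfold_locales (auto simp: algebra_simps)

lemma root_dual: "\<alpha> \<in> \<Phi> \<Longrightarrow> \<alpha> \<in> dual sc"
  using span_roots fs.span_base by blast

lemma root_nonzero: "\<alpha> \<in> \<Phi> \<Longrightarrow> \<alpha> \<noteq> 0"
  using root_coroot by fastforce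

text \<open>A nonzero difference is an independent vector, so some linear functional takes the value
  1 on it.\<close>

lemma dual_separates:
  assumes "\<And>f. f \<in> dual sc \<Longrightarrow> f h = f k"
  shows "h = k"
proof (rule ccontr)
  assume "h \<noteq> k"
  interpret vector_space_pair sc "(*) :: complex \<Rightarrow> _"
    by unfold_locales (auto simp: algebra_simps)
  have "independent {h - k}" using \<open>h \<noteq> k\<close> by simp
  from linear_independent_extend[OF this, of "\<lambda>_. 1"]
  obtain g where g: "Vector_Spaces.linear sc (*) g" "g (h - k) = 1" by auto
  then have "g \<in> dual sc" by (simp add: dual_def)
  with g assms[of g] show False by (simp add: dual_diff)
qed

text \<open>The roots span the dual, so equality of coroots can be tested on roots alone.\<close>

lemma roots_separate:
  assumes "\<And>\<beta>. \<beta> \<in> \<Phi> \<Longrightarrow> \<beta> h = \<beta> k"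
  shows "h = k"
proof (rule dual_separates)
  fix f assume "f \<in> dual sc"
  then have "f \<in> fs.span \<Phi>" using span_roots by simp
  then show "f h = f k"
    by (induction rule: fs.span_induct_alt) (auto simp: assms)
qed

text \<open>If two reflections with root \<open>\<alpha>\<close> preserve \<open>\<Phi>\<close>, their product is unipotent and permutes a finite
  spanning set, hence is the identity.\<close>

lemma coroot_unique:
  assumes "\<alpha> \<in> \<Phi>" and "\<alpha> k = 2" and stable: "\<And>\<delta>. \<delta> \<in> \<Phi> \<Longrightarrow> (\<lambda>h. \<delta> h - \<delta> k * \<alpha> h) \<in> \<Phi>"
  shows "cr \<alpha> = k"
proof (rule roots_separate)
  fix \<delta> assume "\<delta> \<in> \<Phi>"
  define g where "g = \<delta> (cr \<alpha>) - \<delta> k"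
  \<comment> \<open>The reflection with coroot \<open>cr \<alpha>\<close> followed by the one with
    \<open>k\<close> adds a multiple of \<alpha>.\<close>
  have step: "(\<lambda>h. \<eta> h + (\<eta> (cr \<alpha>) - \<eta> k) * \<alpha> h) \<in> \<Phi>" if "\<eta> \<in> \<Phi>" for \<eta>
    using stable[OF refl_root[OF \<open>\<alpha> \<in> \<Phi>\<close> that]] assms(2)
    by (simp add: refl_dual_def algebra_simps)
  \<comment> \<open>Every round adds the same multiple \<open>g\<close>, because \<alpha> takes the
    value 2 on both \<open>cr \<alpha>\<close> and \<open>k\<close>.\<close>
  have mem: "(\<lambda>h. \<delta> h + of_nat n * g * \<alpha> h) \<in> \<Phi>" for n
  proof (induction n)
    case (Suc n)
    have "(\<lambda>h. \<delta> h + of_nat n * g * \<alpha> h + ((\<delta> (cr \<alpha>) + of_nat n * g * \<alpha> (cr \<alpha>)) - (\<delta> k + of_nat n * g * \<alpha> k)) * \<alpha> h) \<in> \<Phi>"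
      using step[OF Suc] by simp
    moreover have "(\<delta> (cr \<alpha>) + of_nat n * g * \<alpha> (cr \<alpha>)) - (\<delta> k + of_nat n * g * \<alpha> k) = g"
      using root_coroot[OF \<open>\<alpha> \<in> \<Phi>\<close>] assms(2) by (simp add: g_def)
    ultimately have "(\<lambda>h. \<delta> h + of_nat n * g * \<alpha> h + g * \<alpha> h) \<in> \<Phi>" by simp
    then show ?case by (simp add: algebra_simps)
  qed (simp add: \<open>\<delta> \<in> \<Phi>\<close>)
  have "g = 0"
  proof (rule ccontr)
    assume "g \<noteq> 0"
    have "inj (\<lambda>n. (\<lambda>h. \<delta> h + of_nat n * g * \<alpha> h))"
    proof (rule injI)
      fix m n :: nat
      assume "(\<lambda>h. \<delta> h + of_nat m * g * \<alpha> h) = (\<lambda>h. \<delta> h + of_nat n * g * \<alpha> h)"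
      from fun_cong[OF this, of k] \<open>g \<noteq> 0\<close> assms(2) show "m = n" by simp
    qed
    then have "infinite (range (\<lambda>n. (\<lambda>h. \<delta> h + of_nat n * g * \<alpha> h)))"
      using finite_imageD by blast
    moreover have "range (\<lambda>n. (\<lambda>h. \<delta> h + of_nat n * g * \<alpha> h)) \<subseteq> \<Phi>" using mem by auto
    ultimately show False using finite_roots finite_subset by blast
  qed
  then show "\<delta> (cr \<alpha>) = \<delta> k" by (simp add: g_def)
qed

lemma refl_linear: "\<alpha> \<in> \<Phi> \<Longrightarrow> s \<alpha> (h + k) = s \<alpha> h + s \<alpha> k"
  "\<alpha> \<in> \<Phi> \<Longrightarrow> s \<alpha> (sc c h) = sc c (s \<alpha> h)"
  using dual_add[OF root_dual[of \<alpha>]] dual_scale[OF root_dual[of \<alpha>]]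
  by (simp_all add: refl_def scale_left_distrib scale_right_diff_distrib)

lemma refl_invol: "\<alpha> \<in> \<Phi> \<Longrightarrow> s \<alpha> (s \<alpha> h) = h"
  using dual_diff[OF root_dual[of \<alpha>], of h "sc (\<alpha> h) (cr \<alpha>)"] dual_scale[OF root_dual[of \<alpha>], of "\<alpha> h" "cr \<alpha>"]
  by (simp add: refl_def root_coroot)

lemma refl_comp [simp]: "\<alpha> \<in> \<Phi> \<Longrightarrow> s \<alpha> \<circ> s \<alpha> = id"
  by (auto simp: fun_eq_iff refl_invol)

lemma bij_refl: "\<alpha> \<in> \<Phi> \<Longrightarrow> bij (s \<alpha>)"
  by (rule o_bij[of "s \<alpha>"]) auto

lemma inv_refl: "\<alpha> \<in> \<Phi> \<Longrightarrow> inv_into UNIV (s \<alpha>) = s \<alpha>"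
  by (rule inv_equality) (simp_all add: refl_invol)

lemma act_refl: "\<alpha> \<in> \<Phi> \<Longrightarrow> act (s \<alpha>) f = f \<circ> s \<alpha>"
  by (simp add: act_def inv_refl)

lemma act_refl_invol [simp]: "\<alpha> \<in> \<Phi> \<Longrightarrow> act (s \<alpha>) (act (s \<alpha>) f) = f"
  by (simp add: act_refl comp_assoc)

lemma dual_refl: "f \<in> dual sc \<Longrightarrow> \<alpha> \<in> \<Phi> \<Longrightarrow> act (s \<alpha>) f = refl_dual cr \<alpha> f"
  by (auto simp: act_refl refl_dual_def refl_def dual_diff dual_scale fun_eq_iff)

lemma act_refl_dual: "f \<in> dual sc \<Longrightarrow> \<alpha> \<in> \<Phi> \<Longrightarrow> act (s \<alpha>) f \<in> dual sc"
  by (rule dualI) (auto simp: act_refl refl_linear dual_add dual_scale)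

lemma act_refl_root: "\<beta> \<in> \<Phi> \<Longrightarrow> \<alpha> \<in> \<Phi> \<Longrightarrow> act (s \<alpha>) \<beta> \<in> \<Phi>"
  by (simp add: dual_refl root_dual refl_root)

lemma act_refl_self: "\<alpha> \<in> \<Phi> \<Longrightarrow> act (s \<alpha>) \<alpha> = - \<alpha>"
  by (auto simp: dual_refl root_dual refl_dual_def root_coroot fun_eq_iff)

text \<open>Equivariance of \<open>cr\<close> is not an axiom. Conjugating the reflection in
  \<alpha> by the one in \<beta> again preserves \<Phi>, so \<open>coroot_unique\<close> identifies
  its coroot.\<close>

lemma coroot_refl:
  assumes "\<alpha> \<in> \<Phi>" "\<beta> \<in> \<Phi>"
  shows "cr (act (s \<beta>) \<alpha>) = s \<beta> (cr \<alpha>)"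
proof (rule coroot_unique)
  show "act (s \<beta>) \<alpha> \<in> \<Phi>" using assms by (simp add: act_refl_root)
  show "act (s \<beta>) \<alpha> (s \<beta> (cr \<alpha>)) = 2" using assms by (simp add: act_refl refl_invol root_coroot)
  fix \<delta> assume "\<delta> \<in> \<Phi>"
  have "act (s \<beta>) (refl_dual cr \<alpha> (act (s \<beta>) \<delta>)) \<in> \<Phi>"
    using assms \<open>\<delta> \<in> \<Phi>\<close> by (simp add: act_refl_root refl_root)
  moreover have "act (s \<beta>) (refl_dual cr \<alpha> (act (s \<beta>) \<delta>)) = (\<lambda>h. \<delta> h - \<delta> (s \<beta> (cr \<alpha>)) * act (s \<beta>) \<alpha> h)"
    using assms by (auto simp: act_refl refl_dual_def refl_invol)
  ultimately show "(\<lambda>h. \<delta> h - \<delta> (s \<beta> (cr \<alpha>)) * act (s \<beta>) \<alpha> h) \<in> \<Phi>" by simp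
qed

section \<open>Words in reflections and their action on roots and coroots\<close>

lemma wd_Nil [simp]: "wd [] = id" and wd_Cons: "wd (a # as) = s a \<circ> wd as"
  by (simp_all add: refl_word_def)

lemma wd_append: "wd (as @ bs) = wd as \<circ> wd bs"
  by (induction as) (auto simp: wd_Cons comp_assoc)

lemma bij_wd: "set as \<subseteq> \<Phi> \<Longrightarrow> bij (wd as)"
  by (induction as) (auto simp: wd_Cons bij_comp bij_refl)

lemma wd_rev: "set as \<subseteq> \<Phi> \<Longrightarrow> wd as \<circ> wd (rev as) = id"
proof (induction as)
  case (Cons a as)
  have "wd (a # as) \<circ> wd (rev (a # as)) = s a \<circ> (wd as \<circ> wd (rev as)) \<circ> s a"
    by (simp add: wd_Cons wd_append comp_assoc)
  also have "\<dots> = s a \<circ> s a" using Cons by (simp only: set_simps insert_subset comp_id simp_thms)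
  finally show ?case using Cons(2) by simp
qed simp

lemma inv_wd: "set as \<subseteq> \<Phi> \<Longrightarrow> inv_into UNIV (wd as) = wd (rev as)"
  using wd_rev[of as] wd_rev[of "rev as"] by (intro inv_unique_comp) auto

lemma act_wd_Cons: "set (a # as) \<subseteq> \<Phi> \<Longrightarrow> act (wd (a # as)) f = act (s a) (act (wd as) f)"
  by (simp add: wd_Cons act_comp bij_refl bij_wd)

lemma act_wd_root: "set as \<subseteq> \<Phi> \<Longrightarrow> \<beta> \<in> \<Phi> \<Longrightarrow> act (wd as) \<beta> \<in> \<Phi>"
  by (induction as) (auto simp: act_wd_Cons act_refl_root)

lemma wd_linear: "set as \<subseteq> \<Phi> \<Longrightarrow> wd as (h + k) = wd as h + wd as k"
  "set as \<subseteq> \<Phi> \<Longrightarrow> wd as (sc c h) = sc c (wd as h)"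
  by (induction as) (auto simp: wd_Cons refl_linear)

lemma coroot_wd: "set as \<subseteq> \<Phi> \<Longrightarrow> \<alpha> \<in> \<Phi> \<Longrightarrow> cr (act (wd as) \<alpha>) = wd as (cr \<alpha>)"
proof (induction as)
  case (Cons a as)
  then show ?case
    using coroot_refl[of "act (wd as) \<alpha>" a] by (simp add: act_wd_Cons act_wd_root) (simp add: wd_Cons)
qed simp

lemma act_wd_apply: "set as \<subseteq> \<Phi> \<Longrightarrow> act (wd as) f (wd as h) = f h"
  by (simp add: act_def bij_wd bij_is_inj inv_f_f)

text \<open>Equivariance of coroots makes a conjugate of a reflection the reflection in the
  transformed root. The form without inverses suits rewriting inside compositions.\<close>

lemma refl_conj:
  assumes "set as \<subseteq> \<Phi>" "\<alpha> \<in> \<Phi>"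
  shows "s (act (wd as) \<alpha>) \<circ> wd as = wd as \<circ> s \<alpha>"
proof
  fix h
  have 1: "wd as (- k) = - wd as k" for k
    using wd_linear(2)[OF assms(1), of "-1" k] by simp
  have "wd as (h - k) = wd as h - wd as k" for k
    using wd_linear(1)[OF assms(1), of h "- k"] 1 by simp
  then show "(s (act (wd as) \<alpha>) \<circ> wd as) h = (wd as \<circ> s \<alpha>) h"
    using assms by (simp add: refl_def act_wd_apply coroot_wd wd_linear)
qed

end

section \<open>Lengths and inversions\<close>

text \<open>Keeps products of group elements, and sums and products of functions below, from being
  rewritten pointwise.\<close>

declare comp_apply [simp del] id_apply [simp del]

context root_system
begin

abbreviation "G \<equiv> refl_group sc cr"

lemma G_wd: "set as \<subseteq> A \<Longrightarrow> wd as \<in> G A"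
  by (auto simp: refl_group_def)

lemma G_obtain:
  assumes "w \<in> G A"
  obtains as where "set as \<subseteq> A" "w = wd as"
  using assms by (auto simp: refl_group_def)

lemma G_mono: "A \<subseteq> B \<Longrightarrow> G A \<subseteq> G B"
  by (auto simp: refl_group_def)

lemma G_id [simp]: "id \<in> G A"
  using G_wd[of "[]"] by simp

lemma G_refl: "\<alpha> \<in> A \<Longrightarrow> s \<alpha> \<in> G A"
  using G_wd[of "[\<alpha>]"] by (simp add: wd_Cons)

lemma G_comp: "v \<in> G A \<Longrightarrow> w \<in> G A \<Longrightarrow> v \<circ> w \<in> G A"
  by (elim G_obtain) (auto simp flip: wd_append intro!: G_wd)

context
  fixes w assumes w: "w \<in> G \<Phi>"
begin

lemma bij_G: "bij w"
  using w by (auto elim!: G_obtain simp: bij_wd)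

lemma inv_G_G: "A \<subseteq> \<Phi> \<Longrightarrow> w \<in> G A \<Longrightarrow> inv_into UNIV w \<in> G A"
proof -
  assume "A \<subseteq> \<Phi>" "w \<in> G A"
  then obtain as where "set as \<subseteq> A" "w = wd as" by (auto elim: G_obtain)
  with \<open>A \<subseteq> \<Phi>\<close> G_wd[of "rev as" A] inv_wd[of as] show ?thesis by auto
qed

lemma act_G_root: "\<beta> \<in> \<Phi> \<Longrightarrow> act w \<beta> \<in> \<Phi>"
  using w by (auto elim!: G_obtain simp: act_wd_root)

lemma refl_conj_G: "\<beta> \<in> \<Phi> \<Longrightarrow> s (act w \<beta>) \<circ> w = w \<circ> s \<beta>"
  using w by (elim G_obtain) (simp add: refl_conj)

lemma inv_G_comp: "inv_into UNIV w \<circ> w = id" "w \<circ> inv_into UNIV w = id"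
  using inj_iff[of w] surj_iff[of w] bij_is_inj[OF bij_G] bij_is_surj[OF bij_G] by simp_all

lemma act_inv_G: "act (inv_into UNIV w) (act w f) = f" "act w (act (inv_into UNIV w) f) = f"
  using bij_G inv_G_comp by (simp_all add: bij_imp_bij_inv flip: act_comp)

lemma inj_act_G: "inj (act w)"
  using act_inv_G(1) by (metis injI)

end

lemma act_G_comp: "v \<in> G \<Phi> \<Longrightarrow> w \<in> G \<Phi> \<Longrightarrow> act (v \<circ> w) f = act v (act w f)"
  by (simp add: act_comp bij_G)

end

section \<open>Positive roots and their coordinates in the simple roots\<close>

locale root_basis = root_system sc \<Phi> cr
  for sc :: "complex \<Rightarrow> 'h::ab_group_add \<Rightarrow> 'h" and \<Phi> cr +
  fixes simples
  assumes simple_roots: "simple_roots \<Phi> simples"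
begin

abbreviation "P \<equiv> pos_roots \<Phi> simples"
abbreviation "co \<equiv> fs.representation simples"

lemma simples_roots: "simples \<subseteq> \<Phi>" and simples_indep: "fs.independent simples"
  and root_cases: "\<alpha> \<in> \<Phi> \<Longrightarrow> \<alpha> \<in> P \<or> - \<alpha> \<in> P"
  using simple_roots by (auto simp: simple_roots_def)

lemma simple_root: "\<alpha> \<in> simples \<Longrightarrow> \<alpha> \<in> \<Phi>"
  using simples_roots by blast

lemma finite_simples: "finite simples"
  using simples_roots finite_roots finite_subset by blast

lemma pos_root: "\<gamma> \<in> P \<Longrightarrow> \<gamma> \<in> \<Phi>"
  by (simp add: pos_roots_def)

lemma finite_pos: "finite P"
  using finite_roots by (simp add: pos_roots_def)

lemma co_sum:
  assumes "\<gamma> = (\<Sum>\<beta>\<in>simples. fscale (c \<beta>) \<beta>)" "\<beta> \<in> simples"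
  shows "co \<gamma> \<beta> = c \<beta>"
proof -
  have "co \<gamma> = (\<lambda>v. \<Sum>b\<in>simples. co (fscale (c b) b) v)"
    unfolding assms(1) by (rule fs.representation_sum) (auto simp: simples_indep intro: fs.span_base fs.span_scale)
  also have "\<dots> = (\<lambda>v. \<Sum>b\<in>simples. c b * (if v = b then 1 else 0))"
    by (auto simp: fun_eq_iff fs.representation_scale simples_indep fs.span_base
        fs.representation_basis cong: sum.cong)
  finally show ?thesis using assms(2) finite_simples by (simp add: if_distrib cong: if_cong)
qed

lemma pos_co:
  assumes "\<gamma> \<in> P"
  shows "\<exists>n :: ('h \<Rightarrow> complex) \<Rightarrow> nat. \<gamma> = (\<Sum>\<beta>\<in>simples. fscale (of_nat (n \<beta>)) \<beta>)
    \<and> (\<forall>\<beta>\<in>simples. co \<gamma> \<beta> = of_nat (n \<beta>))"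
proof -
  from assms obtain n :: "('h \<Rightarrow> complex) \<Rightarrow> nat"
    where n: "\<gamma> = (\<Sum>\<beta>\<in>simples. fscale (of_nat (n \<beta>)) \<beta>)"
    unfolding pos_roots_def by blast
  with co_sum[OF n] show ?thesis by blast
qed

lemma pos_span: "\<gamma> \<in> P \<Longrightarrow> \<gamma> \<in> fs.span simples"
  using pos_co[of \<gamma>] fs.span_sum[of simples "\<lambda>\<beta>. fscale _ \<beta>" simples]
  by (metis (no_types, lifting) fs.span_sum fs.span_scale fs.span_base)

lemma root_span: "\<gamma> \<in> \<Phi> \<Longrightarrow> \<gamma> \<in> fs.span simples"
  using root_cases[of \<gamma>] pos_span[of \<gamma>] pos_span[of "- \<gamma>"] fs.span_neg[of "- \<gamma>"]
  by auto

lemma simple_pos: "\<alpha> \<in> simples \<Longrightarrow> \<alpha> \<in> P"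
proof -
  assume a: "\<alpha> \<in> simples"
  have "\<alpha> = (\<Sum>\<beta>\<in>simples. if \<beta> = \<alpha> then \<alpha> else 0)"
    using a finite_simples by (subst sum.delta) auto
  also have "\<dots> = (\<Sum>\<beta>\<in>simples. fscale (of_nat (if \<beta> = \<alpha> then 1 else 0)) \<beta>)"
    by (rule sum.cong) auto
  finally show ?thesis using a simple_root by (force simp: pos_roots_def)
qed

lemma co_minus: "\<gamma> \<in> \<Phi> \<Longrightarrow> co (- \<gamma>) \<beta> = - co \<gamma> \<beta>"
  using simples_indep root_span by (simp add: fs.representation_neg)

lemma root_ext:
  assumes "\<gamma> \<in> fs.span simples" "\<delta> \<in> fs.span simples" "\<And>\<beta>. \<beta> \<in> simples \<Longrightarrow> co \<gamma> \<beta> = co \<delta> \<beta>"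
  shows "\<gamma> = \<delta>"
  using fs.sum_representation_eq[OF simples_indep assms(1) finite_simples order_refl]
    fs.sum_representation_eq[OF simples_indep assms(2) finite_simples order_refl] assms(3)
  by (metis (no_types, lifting) sum.cong)

text \<open>The coordinates of a root all have one sign, so a single positive one decides it. The
  contradiction is a positive sum of naturals that vanishes under \<open>of_nat\<close>.\<close>

lemma pos_if_co_pos:
  assumes "\<gamma> \<in> \<Phi>" "\<beta> \<in> simples" "co \<gamma> \<beta> = of_nat n" "n > 0"
  shows "\<gamma> \<in> P"
proof (rule ccontr)
  assume "\<gamma> \<notin> P"
  then have "- \<gamma> \<in> P" using root_cases assms by blast
  then obtain m where "co (- \<gamma>) \<beta> = of_nat m" using assms pos_co by blast
  then have "- of_nat n = (of_nat m :: complex)" using assms by (simp add: co_minus)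
  then have "of_nat n + of_nat m = (0::complex)" by (metis add.right_inverse)
  then show False using assms(4) by (metis add_is_0 less_numeral_extra(3) of_nat_add of_nat_eq_0_iff)
qed

text \<open>If both a root and its negative were positive, each coordinate and its negative would be
  naturals, so the root would be zero.\<close>

lemma neg_not_pos:
  assumes "\<gamma> \<in> \<Phi>" shows "- \<gamma> \<in> P \<longleftrightarrow> \<gamma> \<notin> P"
proof -
  have False if g: "\<gamma> \<in> P" "- \<gamma> \<in> P"
  proof -
    obtain n where n: "\<And>\<beta>. \<beta> \<in> simples \<Longrightarrow> co \<gamma> \<beta> = of_nat (n \<beta>)" using pos_co g by blast
    obtain m where m: "\<And>\<beta>. \<beta> \<in> simples \<Longrightarrow> co (- \<gamma>) \<beta> = of_nat (m \<beta>)" using pos_co g by blast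
    have "co \<gamma> \<beta> = 0" if "\<beta> \<in> simples" for \<beta>
    proof -
      have "- of_nat (n \<beta>) = (of_nat (m \<beta>) :: complex)" using n[OF that] m[OF that] assms by (simp add: co_minus)
      then have "of_nat (n \<beta> + m \<beta>) = (0::complex)" by (metis add.right_inverse of_nat_add)
      then show ?thesis using n[OF that] by (metis add_is_0 of_nat_eq_0_iff)
    qed
    then have "\<gamma> = 0"
      using root_ext[of \<gamma> 0] root_span[OF assms] by (simp add: fs.span_zero fs.representation_zero)
    with assms root_nonzero show False by blast
  qed
  with root_cases[OF assms] show ?thesis by blast
qed

text \<open>Because \<Phi> is reduced, \<gamma> has a positive coordinate at a simple root other
  than \<alpha>, and the reflection changes only the coordinate at \<alpha>.\<close>

lemma simple_perm:
  assumes "\<alpha> \<in> simples" "\<gamma> \<in> P" "\<gamma> \<noteq> \<alpha>"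
  shows "act (s \<alpha>) \<gamma> \<in> P"
proof -
  obtain n where n: "\<gamma> = (\<Sum>\<beta>\<in>simples. fscale (of_nat (n \<beta>)) \<beta>)"
    "\<And>\<beta>. \<beta> \<in> simples \<Longrightarrow> co \<gamma> \<beta> = of_nat (n \<beta>)" using pos_co assms by blast
  have "\<exists>\<beta>\<in>simples. \<beta> \<noteq> \<alpha> \<and> n \<beta> > 0"
  proof (rule ccontr)
    assume "\<not> ?thesis"
    then have "\<And>\<beta>. \<beta> \<in> simples \<Longrightarrow> \<beta> \<noteq> \<alpha> \<Longrightarrow> n \<beta> = 0" by auto
    then have "(\<Sum>\<beta>\<in>simples. fscale (of_nat (n \<beta>)) \<beta>) = (\<Sum>\<beta>\<in>{\<alpha>}. fscale (of_nat (n \<beta>)) \<beta>)"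
      using assms(1) finite_simples by (intro sum.mono_neutral_right) auto
    then have g: "\<gamma> = fscale (of_nat (n \<alpha>)) \<alpha>" using n by simp
    have "fscale (of_nat (n \<alpha>)) \<alpha> \<in> \<Phi>" using g pos_root[OF assms(2)] by simp
    from reduced[OF simple_root[OF assms(1)] this]
    have "n \<alpha> = 1"
    proof
      assume "of_nat (n \<alpha>) = (- 1 :: complex)"
      then have "of_nat (n \<alpha> + 1) = (0::complex)" by simp
      then show ?thesis by (simp only: of_nat_eq_0_iff)
    qed simp
    with g assms(3) show False by simp
  qed
  then obtain \<beta> where b: "\<beta> \<in> simples" "\<beta> \<noteq> \<alpha>" "n \<beta> > 0" by blast
  have "act (s \<alpha>) \<gamma> = \<gamma> - fscale (\<gamma> (cr \<alpha>)) \<alpha>"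
    using assms by (auto simp: dual_refl root_dual pos_root simple_root refl_dual_def fun_eq_iff)
  then have "co (act (s \<alpha>) \<gamma>) \<beta> = of_nat (n \<beta>)"
    using assms b n(2)[OF b(1)] pos_span[OF assms(2)] simples_indep
    by (simp add: fs.representation_diff fs.representation_scale fs.representation_basis fs.span_base
        fs.span_scale)
  moreover have "act (s \<alpha>) \<gamma> \<in> \<Phi>" using assms by (simp add: act_refl_root pos_root simple_root)
  ultimately show ?thesis using b pos_if_co_pos by blast
qed

text \<open>Inversions are placed on the side on which right multiplication acts: a simple \<alpha>
  lies in \<open>Inv w\<close> exactly when \<open>w \<circ> s \<alpha>\<close> is shorter than
  \<open>w\<close>.\<close>

definition Inv :: "('h \<Rightarrow> 'h) \<Rightarrow> ('h \<Rightarrow> complex) set" where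
  "Inv w = {\<gamma> \<in> P. act w \<gamma> \<notin> P}"

lemma finite_Inv: "finite (Inv w)"
  using finite_pos by (simp add: Inv_def)

lemma Inv_id: "Inv id = {}"
  unfolding Inv_def act_id by blast

lemma GS: "w \<in> G simples \<Longrightarrow> w \<in> G \<Phi>"
  using G_mono simples_roots by blast

lemma refl_GS: "\<alpha> \<in> simples \<Longrightarrow> s \<alpha> \<in> G \<Phi>"
  by (simp add: G_refl simple_root)

text \<open>The simple reflection permutes the positive roots other than \<alpha>
  (\<open>simple_perm\<close>) and makes \<alpha> negative. So it transports the old inversions and
  creates the single new one \<alpha>.\<close>

lemma Inv_comp_refl:
  assumes w: "w \<in> G \<Phi>" and a: "\<alpha> \<in> simples" "\<alpha> \<notin> Inv w"
  shows "Inv (w \<circ> s \<alpha>) = insert \<alpha> (act (s \<alpha>) ` Inv w)" "\<alpha> \<notin> act (s \<alpha>) ` Inv w"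
proof -
  have r: "\<alpha> \<in> \<Phi>" and p: "\<alpha> \<in> P" using a simple_root simple_pos by auto
  have wa: "act w \<alpha> \<in> P" using a p by (auto simp: Inv_def)
  have c: "act (w \<circ> s \<alpha>) f = act w (act (s \<alpha>) f)" for f
    using w refl_GS[OF a(1)] by (simp add: act_G_comp)
  have ww: "act (w \<circ> s \<alpha>) (act (s \<alpha>) f) = act w f" for f
    using r by (simp add: c)
  have am: "act (s \<alpha>) \<alpha> = - \<alpha>" using r by (rule act_refl_self)
  have inv_a: "\<alpha> \<in> Inv (w \<circ> s \<alpha>)"
    using p wa neg_not_pos[of "act w \<alpha>"] act_G_root[OF w r] by (simp add: Inv_def c am act_uminus)
  show "\<alpha> \<notin> act (s \<alpha>) ` Inv w"
  proof
    assume "\<alpha> \<in> act (s \<alpha>) ` Inv w"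
    then obtain \<gamma> where g: "\<gamma> \<in> Inv w" "\<alpha> = act (s \<alpha>) \<gamma>" by blast
    then have "\<gamma> = - \<alpha>" using am r act_refl_invol by metis
    then show False using g neg_not_pos[OF r] p by (auto simp: Inv_def)
  qed
  show "Inv (w \<circ> s \<alpha>) = insert \<alpha> (act (s \<alpha>) ` Inv w)"
  proof (intro equalityI subsetI)
    fix \<gamma> assume g: "\<gamma> \<in> Inv (w \<circ> s \<alpha>)"
    show "\<gamma> \<in> insert \<alpha> (act (s \<alpha>) ` Inv w)"
    proof (cases "\<gamma> = \<alpha>")
      case False
      with g a(1) have "act (s \<alpha>) \<gamma> \<in> P" by (auto simp: Inv_def simple_perm)
      with g have "act (s \<alpha>) \<gamma> \<in> Inv w" by (auto simp: Inv_def c)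
      moreover have "\<gamma> = act (s \<alpha>) (act (s \<alpha>) \<gamma>)" using r by simp
      ultimately show ?thesis by blast
    qed simp
  next
    fix \<gamma> assume "\<gamma> \<in> insert \<alpha> (act (s \<alpha>) ` Inv w)"
    then show "\<gamma> \<in> Inv (w \<circ> s \<alpha>)"
    proof
      assume "\<gamma> \<in> act (s \<alpha>) ` Inv w"
      then obtain \<delta> where d: "\<delta> \<in> Inv w" "\<gamma> = act (s \<alpha>) \<delta>" by blast
      then have "\<delta> \<noteq> \<alpha>" using a by blast
      then have "\<gamma> \<in> P" using d a by (auto simp: Inv_def simple_perm)
      then show ?thesis using d by (auto simp: Inv_def ww)
    qed (use inv_a in simp)
  qed
qed

lemma card_Inv_up:
  assumes "w \<in> G \<Phi>" "\<alpha> \<in> simples" "\<alpha> \<notin> Inv w"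
  shows "card (Inv (w \<circ> s \<alpha>)) = Suc (card (Inv w))"
proof -
  have "inj_on (act (s \<alpha>)) (Inv w)"
    using inj_act_G[OF refl_GS[OF assms(2)]] inj_on_subset by blast
  then have "card (act (s \<alpha>) ` Inv w) = card (Inv w)" by (rule card_image)
  then show ?thesis
    unfolding Inv_comp_refl(1)[OF assms]
    using card_insert_disjoint[OF finite_imageI[OF finite_Inv] Inv_comp_refl(2)[OF assms]] by simp
qed

lemma comp_refl_refl: "\<alpha> \<in> \<Phi> \<Longrightarrow> w \<circ> s \<alpha> \<circ> s \<alpha> = w"
  by (simp only: comp_assoc refl_comp comp_id)

lemma refl_refl_comp: "\<alpha> \<in> \<Phi> \<Longrightarrow> s \<alpha> \<circ> (s \<alpha> \<circ> w) = w"
  by (simp only: comp_assoc[symmetric] refl_comp id_comp)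

lemma Inv_flip:
  assumes "w \<in> G \<Phi>" "\<alpha> \<in> simples" "\<alpha> \<in> Inv w"
  shows "\<alpha> \<notin> Inv (w \<circ> s \<alpha>)"
proof -
  have "- act w \<alpha> \<in> P"
    using assms neg_not_pos[of "act w \<alpha>"] act_G_root simple_root by (auto simp: Inv_def)
  then show ?thesis using assms
    by (simp add: Inv_def act_G_comp refl_GS act_refl_self simple_root act_uminus)
qed

lemma card_Inv_down:
  assumes "w \<in> G \<Phi>" "\<alpha> \<in> simples" "\<alpha> \<in> Inv w"
  shows "card (Inv w) = Suc (card (Inv (w \<circ> s \<alpha>)))"
  using card_Inv_up[OF _ assms(2) Inv_flip[OF assms]] assms
  by (simp add: G_comp refl_GS comp_refl_refl simple_root)

text \<open>Reading the word from the right, \<gamma> turns negative at some letter. Just before, it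
  is a positive root made negative by a simple reflection, hence that letter itself; by
  \<open>refl_conj\<close>, multiplying by the reflection in \<gamma> deletes the letter.\<close>

lemma exchange:
  assumes "set as \<subseteq> simples" "\<gamma> \<in> Inv (wd as)"
  shows "\<exists>bs. set bs \<subseteq> set as \<and> length as = Suc (length bs) \<and> wd as \<circ> s \<gamma> = wd bs"
  using assms
proof (induction as)
  case Nil
  then show ?case unfolding wd_Nil Inv_id by blast
next
  case (Cons a as)
  have g: "\<gamma> \<in> P" "\<gamma> \<in> \<Phi>" using Cons by (auto simp: Inv_def pos_root)
  have sub: "set as \<subseteq> \<Phi>" "a \<in> \<Phi>" "a \<in> simples" using Cons simples_roots by auto
  show ?case
  proof (cases "\<gamma> \<in> Inv (wd as)")
    case True
    with Cons obtain bs where "set bs \<subseteq> set as" "length as = Suc (length bs)" "wd as \<circ> s \<gamma> = wd bs"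
      by (metis sub(3) insert_subset list.simps(15))
    then show ?thesis by (intro exI[of _ "a # bs"]) (auto simp: wd_Cons comp_assoc)
  next
    case False
    then have "act (wd as) \<gamma> \<in> P" using g by (simp add: Inv_def)
    moreover have "act (s a) (act (wd as) \<gamma>) \<notin> P"
      using Cons sub by (simp add: Inv_def act_wd_Cons)
    ultimately have "act (wd as) \<gamma> = a" using simple_perm sub by blast
    then have "s a \<circ> wd as = wd as \<circ> s \<gamma>" using refl_conj[OF sub(1) g(2)] by simp
    then have "wd (a # as) \<circ> s \<gamma> = wd as"
      by (simp only: wd_Cons comp_refl_refl[OF g(2)])
    then show ?thesis by (intro exI[of _ as]) auto
  qed
qed

text \<open>A word is built letter by letter: a letter that is not an inversion is appended, any
  other is handled by \<open>exchange\<close>. Since letters are only deleted, the word stays in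
  \<open>A\<close>, so elements of a parabolic subgroup have reduced words inside it.\<close>

lemma reduced_exists:
  assumes "A \<subseteq> simples" "w \<in> G A"
  obtains as where "set as \<subseteq> A" "wd as = w" "length as = card (Inv w)"
proof -
  from assms obtain bs where "set bs \<subseteq> A" "w = wd bs" by (auto elim: G_obtain)
  then have "\<exists>as. set as \<subseteq> A \<and> wd as = w \<and> length as = card (Inv w)"
  proof (induction bs arbitrary: w rule: rev_induct)
    case Nil
    then show ?case by (intro exI[of _ "[]"]) (simp only: wd_Nil Inv_id, simp)
  next
    case (snoc a bs)
    have a: "a \<in> A" "a \<in> simples" using snoc assms by auto
    from snoc obtain as where as: "set as \<subseteq> A" "wd as = wd bs" "length as = card (Inv (wd bs))"
      by fastforce
    have w: "w = wd as \<circ> s a" using snoc(3) as(2) by (simp only: wd_append wd_Cons wd_Nil comp_id)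
    have g: "wd as \<in> G \<Phi>" using as assms simples_roots by (intro G_wd) auto
    show ?case
    proof (cases "a \<in> Inv (wd as)")
      case True
      with exchange[of as a] as assms obtain cs where
        "set cs \<subseteq> set as" "length as = Suc (length cs)" "wd as \<circ> s a = wd cs" by auto
      then show ?thesis
        using as w card_Inv_down[OF g a(2) True] by (intro exI[of _ cs]) auto
    next
      case False
      then show ?thesis
        using as w a card_Inv_up[OF g a(2) False]
        by (intro exI[of _ "as @ [a]"]) (auto simp: wd_append wd_Cons)
    qed
  qed
  with that show ?thesis by blast
qed

lemma card_Inv_le:
  assumes "set as \<subseteq> simples" shows "card (Inv (wd as)) \<le> length as"
  using assms
proof (induction as rule: rev_induct)
  case (snoc a as)
  then have g: "wd as \<in> G \<Phi>" "a \<in> simples" using simples_roots by (auto intro: G_wd)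
  have e: "wd (as @ [a]) = wd as \<circ> s a" by (simp add: wd_append wd_Cons)
  show ?case
    using card_Inv_up[OF g] card_Inv_down[OF g] snoc unfolding e length_append
    by (cases "a \<in> Inv (wd as)") (simp_all del: comp_apply)
qed (simp only: wd_Nil Inv_id card.empty)

section \<open>Length as the number of inversions\<close>

abbreviation "len \<equiv> weyl_length sc cr simples"

lemma length_eq:
  assumes "w \<in> G simples" shows "len w = card (Inv w)"
  unfolding weyl_length_def
proof (rule Least_equality)
  show "\<exists>as. set as \<subseteq> simples \<and> length as = card (Inv w) \<and> wd as = w"
    using reduced_exists[OF order_refl assms] by metis
  show "card (Inv w) \<le> k" if "\<exists>as. set as \<subseteq> simples \<and> length as = k \<and> wd as = w" for k
    using that card_Inv_le by blast
qed

lemma reduced_word_exists: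
  assumes "A \<subseteq> simples" "w \<in> G A"
  obtains as where "set as \<subseteq> A" "reduced_word sc cr simples w as"
proof -
  have "w \<in> G simples" using G_mono assms by blast
  with reduced_exists[OF assms] length_eq assms(1) that show ?thesis
    by (metis reduced_word_def subset_trans)
qed

lemma length_le: "set as \<subseteq> simples \<Longrightarrow> len (wd as) \<le> length as"
  by (simp add: length_eq card_Inv_le G_wd)

lemma GS_comp_refl: "w \<in> G simples \<Longrightarrow> \<alpha> \<in> simples \<Longrightarrow> w \<circ> s \<alpha> \<in> G simples"
  by (simp add: G_comp G_refl)

lemma length_up: "w \<in> G simples \<Longrightarrow> \<alpha> \<in> simples \<Longrightarrow> \<alpha> \<notin> Inv w \<Longrightarrow> len (w \<circ> s \<alpha>) = Suc (len w)"
  by (simp add: length_eq GS_comp_refl GS card_Inv_up)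

lemma length_down: "w \<in> G simples \<Longrightarrow> \<alpha> \<in> simples \<Longrightarrow> \<alpha> \<in> Inv w \<Longrightarrow> len w = Suc (len (w \<circ> s \<alpha>))"
  by (simp add: length_eq GS_comp_refl GS card_Inv_down)

lemma length_id [simp]: "len id = 0"
  using length_le[of "[]"] by simp

lemma length_0: "w \<in> G simples \<Longrightarrow> len w = 0 \<Longrightarrow> w = id"
  using reduced_word_exists[OF order_refl] by (metis length_0_conv reduced_word_def wd_Nil)

lemma inv_GS: "A \<subseteq> simples \<Longrightarrow> w \<in> G A \<Longrightarrow> inv_into UNIV w \<in> G A"
  using inv_G_G[of w A] G_mono[of A \<Phi>] simples_roots by blast

lemma length_inv_le: assumes "w \<in> G simples" shows "len (inv_into UNIV w) \<le> len w"
proof -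
  obtain as where as: "set as \<subseteq> simples" "wd as = w" "length as = len w"
    using reduced_word_exists[OF order_refl assms] by (metis reduced_word_def)
  then have "inv_into UNIV w = wd (rev as)" using inv_wd[of as] simples_roots by auto
  with as length_le[of "rev as"] show ?thesis by simp
qed

lemma length_inv: assumes "w \<in> G simples" shows "len (inv_into UNIV w) = len w"
proof -
  have "inv_into UNIV (inv_into UNIV w) = w" using assms by (simp add: bij_G GS inv_inv_eq)
  with length_inv_le[OF assms] length_inv_le[OF inv_GS[OF order_refl assms]] show ?thesis by simp
qed

lemma length_comp_le:
  assumes "v \<in> G simples" "w \<in> G simples"
  shows "len (v \<circ> w) \<le> len v + len w"
proof -
  obtain as bs where "set as \<subseteq> simples" "wd as = v" "length as = len v"
     "set bs \<subseteq> simples" "wd bs = w" "length bs = len w"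
    using assms reduced_word_exists[OF order_refl] by (metis reduced_word_def)
  with length_le[of "as @ bs"] show ?thesis by (simp add: wd_append)
qed

text \<open>\<open>exchange\<close> drops a letter of a reduced word. The root \<gamma> may be any
  inversion, simple or not, as in the sum of Chevalley's formula.\<close>

lemma length_refl_lt:
  assumes "w \<in> G simples" "\<gamma> \<in> Inv w"
  shows "w \<circ> s \<gamma> \<in> G simples" "len (w \<circ> s \<gamma>) < len w"
proof -
  obtain as where as: "set as \<subseteq> simples" "wd as = w" "length as = len w"
    using reduced_word_exists[OF order_refl assms(1)] by (metis reduced_word_def)
  with exchange[of as \<gamma>] assms obtain bs where bs: "set bs \<subseteq> set as" "length as = Suc (length bs)"
    "w \<circ> s \<gamma> = wd bs" by auto
  show "w \<circ> s \<gamma> \<in> G simples" using bs as by (auto intro: G_wd)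
  show "len (w \<circ> s \<gamma>) < len w" 
  proof -
    have "len (wd bs) \<le> length bs" using bs(1) as(1) by (intro length_le) simp
    then show ?thesis using bs(2,3) as(3) by simp
  qed
qed

end

section \<open>The longest element of a parabolic subgroup\<close>

lemma sum_Nats: "(\<And>i. i \<in> A \<Longrightarrow> f i \<in> \<nat>) \<Longrightarrow> (\<Sum>i\<in>A. f i) \<in> \<nat>"
  by (induction A rule: infinite_finite_induct) auto

locale parabolic = root_basis sc \<Phi> cr simples
  for sc :: "complex \<Rightarrow> 'h::ab_group_add \<Rightarrow> 'h" and \<Phi> cr simples +
  fixes J
  assumes J: "J \<subseteq> simples"
begin

abbreviation "PJ \<equiv> P \<inter> sub_roots cr J"
abbreviation "w0 \<equiv> longest sc cr simples J"

lemma GJ_GS: "w \<in> G J \<Longrightarrow> w \<in> G simples" and GJ: "w \<in> G J \<Longrightarrow> w \<in> G \<Phi>"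
  using G_mono J simples_roots by blast+

text \<open>Every element has a word in a finite alphabet that is no longer than the number of
  positive roots.\<close>

lemma finite_GJ: "finite (G J)"
proof -
  have "G J \<subseteq> wd ` {as. set as \<subseteq> simples \<and> length as \<le> card P}"
  proof
    fix w assume w: "w \<in> G J"
    obtain as where as: "set as \<subseteq> J" "wd as = w" "length as = card (Inv w)"
      using reduced_exists[OF J w] .
    moreover have "card (Inv w) \<le> card P"
      using finite_pos by (intro card_mono) (auto simp: Inv_def)
    ultimately show "w \<in> wd ` {as. set as \<subseteq> simples \<and> length as \<le> card P}"
      using J by auto
  qed
  then show ?thesis
    using finite_lists_length_le[OF finite_simples] finite_surj by blast
qed

text \<open>The inclusion holds whether or not \<alpha> is an inversion of \<open>w\<close>, which
  suits inductions over words that may fail to be reduced.\<close>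

lemma Inv_comp_refl_subset:
  assumes "w \<in> G \<Phi>" "\<alpha> \<in> simples"
  shows "Inv (w \<circ> s \<alpha>) \<subseteq> insert \<alpha> (act (s \<alpha>) ` Inv w)"
proof
  fix \<gamma> assume g: "\<gamma> \<in> Inv (w \<circ> s \<alpha>)"
  show "\<gamma> \<in> insert \<alpha> (act (s \<alpha>) ` Inv w)"
  proof (cases "\<gamma> = \<alpha>")
    case False
    with g assms have "act (s \<alpha>) \<gamma> \<in> Inv w"
      by (auto simp: Inv_def simple_perm act_G_comp refl_GS)
    moreover have "\<gamma> = act (s \<alpha>) (act (s \<alpha>) \<gamma>)" using assms simple_root by simp
    ultimately show ?thesis by blast
  qed simp
qed

lemma sub_roots_roots: "sub_roots cr J \<subseteq> \<Phi>"
proof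
  fix \<gamma> assume "\<gamma> \<in> sub_roots cr J"
  then show "\<gamma> \<in> \<Phi>"
    by induction (use J simples_roots refl_root in auto)
qed

lemma sub_roots_span: "\<gamma> \<in> sub_roots cr J \<Longrightarrow> \<gamma> \<in> fs.span J"
proof (induction rule: sub_roots.induct)
  case (refl \<alpha> \<beta>)
  have "refl_dual cr \<alpha> \<beta> = \<beta> - fscale (\<beta> (cr \<alpha>)) \<alpha>" by (auto simp: refl_dual_def fun_eq_iff)
  then show ?case by (simp only: fs.span_diff fs.span_scale refl.IH)
qed (rule fs.span_base)

lemma act_sub_roots:
  assumes "w \<in> G J" "\<gamma> \<in> sub_roots cr J" shows "act w \<gamma> \<in> sub_roots cr J"
proof -
  from assms obtain as where as: "set as \<subseteq> J" "w = wd as" by (auto elim: G_obtain)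
  have "act (wd as) \<gamma> \<in> sub_roots cr J" using as(1)
  proof (induction as)
    case (Cons a as)
    moreover have "set (a # as) \<subseteq> \<Phi>" using Cons(2) J simples_roots by blast
    moreover have "act (wd as) \<gamma> \<in> dual sc" "a \<in> sub_roots cr J"
      using Cons sub_roots_roots root_dual by (auto intro: sub_roots.base)
    ultimately show ?case
      using sub_roots.refl[of a cr J "act (wd as) \<gamma>"] by (simp add: act_wd_Cons dual_refl)
  qed (use assms in simp)
  with as show ?thesis by simp
qed

lemma uminus_sub_roots: "\<gamma> \<in> sub_roots cr J \<Longrightarrow> - \<gamma> \<in> sub_roots cr J"
  using sub_roots.refl[of \<gamma> cr J \<gamma>] sub_roots_roots
  by (metis act_refl_self dual_refl root_dual subsetD)

lemma Inv_sub_roots: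
  assumes "w \<in> G J" shows "Inv w \<subseteq> PJ"
proof -
  from assms obtain as where as: "set as \<subseteq> J" "w = wd as" by (auto elim: G_obtain)
  have "Inv (wd as) \<subseteq> sub_roots cr J" using as(1)
  proof (induction as rule: rev_induct)
    case Nil
    show ?case unfolding wd_Nil Inv_id by simp
  next
    case (snoc a as)
    have a: "a \<in> simples" "wd as \<in> G \<Phi>" "a \<in> J"
      using snoc J simples_roots by (auto intro!: G_wd)
    have "act (s a) ` Inv (wd as) \<subseteq> sub_roots cr J"
      using snoc a act_sub_roots[of "s a"] by (auto simp: G_refl)
    then show ?case
      unfolding wd_append wd_Cons wd_Nil comp_id
      using Inv_comp_refl_subset[OF a(2,1)] sub_roots.base[OF a(3)] by blast
  qed
  then show ?thesis using as by (auto simp: Inv_def)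
qed

lemma finite_PJ: "finite PJ"
  using finite_pos by simp

text \<open>A positive root of the subsystem is a natural combination of \<open>J\<close> alone, so
  the negative of its image is a natural combination of positive roots. Were the image positive as
  well, all its coordinates would vanish.\<close>

lemma maximal_Inv:
  assumes w: "w \<in> G \<Phi>" and sub: "J \<subseteq> Inv w"
  shows "PJ \<subseteq> Inv w"
proof
  fix \<gamma> assume g: "\<gamma> \<in> PJ"
  obtain n where n: "\<gamma> = (\<Sum>\<beta>\<in>simples. fscale (of_nat (n \<beta>)) \<beta>)"
    "\<And>\<beta>. \<beta> \<in> simples \<Longrightarrow> co \<gamma> \<beta> = of_nat (n \<beta>)" using g pos_co by blast
  have n0: "n \<beta> = 0" if b: "\<beta> \<in> simples" "\<beta> \<notin> J" for \<beta>
  proof -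
    have "\<gamma> \<in> fs.span J" using g sub_roots_span by blast
    then have "co \<gamma> = fs.representation J \<gamma>"
      using fs.representation_extend[OF simples_indep _ J] by blast
    then have "co \<gamma> \<beta> = 0" using b fs.representation_ne_zero[of J \<gamma> \<beta>] by auto
    with n(2)[OF b(1)] show ?thesis by simp
  qed
  have "\<gamma> \<in> P" using g by simp
  moreover have "act w \<gamma> \<notin> P"
  proof
    assume p: "act w \<gamma> \<in> P"
    have r: "act w \<gamma> \<in> \<Phi>" using w \<open>\<gamma> \<in> P\<close> by (simp add: act_G_root pos_root)
    have fin: "finite J" using J finite_simples finite_subset by blast
    have "\<gamma> = (\<Sum>\<beta>\<in>J. fscale (of_nat (n \<beta>)) \<beta>)"
      unfolding n(1) using J finite_simples n0 by (intro sum.mono_neutral_right) auto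
    then have neg: "- act w \<gamma> = (\<Sum>\<beta>\<in>J. fscale (of_nat (n \<beta>)) (- act w \<beta>))"
      by (simp only: act_sum act_fscale fs.scale_minus_right sum_negf)
    have negP: "- act w \<beta> \<in> P" if "\<beta> \<in> J" for \<beta>
      using that sub w neg_not_pos[of "act w \<beta>"] by (auto simp: Inv_def act_G_root pos_root)
    have "co (act w \<gamma>) \<sigma> = 0" if "\<sigma> \<in> simples" for \<sigma>
    proof -
      have "co (- act w \<gamma>) \<sigma> = (\<Sum>\<beta>\<in>J. of_nat (n \<beta>) * co (- act w \<beta>) \<sigma>)"
        unfolding neg using negP simples_indep
        by (subst fs.representation_sum) (auto simp: fs.representation_scale pos_span simp del: fs.scale_minus_right intro: fs.span_scale)
      also have "\<dots> \<in> \<nat>"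
      proof -
        have "co (- act w \<beta>) \<sigma> \<in> \<nat>" if "\<beta> \<in> J" for \<beta>
          using pos_co[OF negP[OF that]] \<open>\<sigma> \<in> simples\<close> by auto
        then show ?thesis by (intro sum_Nats Nats_mult) auto
      qed
      finally have "co (- act w \<gamma>) \<sigma> \<in> \<nat>" .
      then obtain k where "co (- act w \<gamma>) \<sigma> = of_nat k" by (rule Nats_cases)
      then have "- co (act w \<gamma>) \<sigma> = of_nat k" by (rule trans[OF co_minus[OF r, symmetric]])
      moreover have "\<exists>m. co (act w \<gamma>) \<sigma> = of_nat m" using pos_co[OF p] \<open>\<sigma> \<in> simples\<close> by metis
      then obtain m where m: "co (act w \<gamma>) \<sigma> = of_nat m" ..
      ultimately have "of_nat (m + k) = (0::complex)" by (metis add.right_inverse of_nat_add)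
      then show ?thesis using m by (metis add_is_0 of_nat_eq_0_iff)
    qed
    then have "act w \<gamma> = 0"
      using root_ext[of "act w \<gamma>" 0] root_span[OF r] by (simp add: fs.span_zero fs.representation_zero)
    with r root_nonzero show False by blast
  qed
  ultimately show "\<gamma> \<in> Inv w" by (simp add: Inv_def)
qed

text \<open>\<open>arg_max\<close> attains a maximum only if the lengths are bounded; finiteness of
  \<open>G J\<close> supplies the strict bound of the rule.\<close>

lemma w0_max: "w0 \<in> G J \<and> (\<forall>w. w \<in> G J \<longrightarrow> len w \<le> len w0)"
  unfolding longest_def
proof (rule arg_max_nat_lemma)
  show "id \<in> G J" by simp
  show "\<forall>w. w \<in> G J \<longrightarrow> len w < Suc (Max (len ` G J))"
    using finite_GJ by (simp add: less_Suc_eq_le)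
qed

lemma w0_mem: "w0 \<in> G J" and len_le_w0: "w \<in> G J \<Longrightarrow> len w \<le> len w0"
  using w0_max by auto

text \<open>If some \<alpha> in \<open>J\<close> were not an inversion, right multiplication by its
  reflection would give a longer element of \<open>G J\<close>; so \<open>maximal_Inv\<close>
  applies.\<close>

lemma Inv_w0: "Inv w0 = PJ"
proof
  show "Inv w0 \<subseteq> PJ" using Inv_sub_roots w0_mem by blast
  have "\<alpha> \<in> Inv w0" if a: "\<alpha> \<in> J" for \<alpha>
  proof (rule ccontr)
    assume "\<alpha> \<notin> Inv w0"
    then have "len (w0 \<circ> s \<alpha>) = Suc (len w0)"
      using a J w0_mem by (intro length_up GJ_GS) auto
    moreover have "w0 \<circ> s \<alpha> \<in> G J" using a w0_mem by (simp add: G_comp G_refl)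
    ultimately show False using len_le_w0 by fastforce
  qed
  then show "PJ \<subseteq> Inv w0" using maximal_Inv GJ w0_mem by blast
qed

lemma len_w0: "len w0 = card PJ"
  using Inv_w0 length_eq GJ_GS w0_mem by metis

lemma Inv_of_len_w0:
  assumes "w \<in> G J" "len w = len w0" shows "Inv w = PJ"
  using Inv_sub_roots[OF assms(1)] assms(2) length_eq[OF GJ_GS[OF assms(1)]] len_w0 finite_PJ
  by (metis card_subset_eq)

lemma inv_GJ: "w \<in> G J \<Longrightarrow> inv_into UNIV w \<in> G J"
  using inv_GS J by blast

text \<open>Both \<open>w\<close> and the inverse of \<open>w0\<close> have full length, so each
  makes all of \<open>PJ\<close> negative. Their product keeps \<open>PJ\<close> positive, has no
  inversions, and is the identity.\<close>

lemma longest_unique: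
  assumes w: "w \<in> G J" "len w = len w0" shows "w = w0"
proof -
  let ?i = "inv_into UNIV w0"
  have i: "?i \<in> G J" "len ?i = len w0"
    using w0_mem by (auto simp: inv_GJ length_inv GJ_GS)
  have u: "w \<circ> ?i \<in> G J" using w i by (simp add: G_comp)
  have "act (w \<circ> ?i) \<gamma> \<in> P" if g: "\<gamma> \<in> PJ" for \<gamma>
  proof -
    have "act ?i \<gamma> \<notin> P" using Inv_of_len_w0[OF i] g by (auto simp: Inv_def)
    moreover have "act ?i \<gamma> \<in> sub_roots cr J" using g i act_sub_roots by blast
    ultimately have "- act ?i \<gamma> \<in> PJ"
      using neg_not_pos[of "act ?i \<gamma>"] uminus_sub_roots sub_roots_roots by blast
    then have "act w (- act ?i \<gamma>) \<notin> P" using Inv_of_len_w0[OF w] by (auto simp: Inv_def)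
    then have "- act (w \<circ> ?i) \<gamma> \<notin> P" using w i by (simp add: act_uminus act_G_comp GJ)
    moreover have "act (w \<circ> ?i) \<gamma> \<in> \<Phi>" using u g by (simp add: act_G_root GJ pos_root)
    ultimately show ?thesis using neg_not_pos by blast
  qed
  then have "Inv (w \<circ> ?i) = {}" using Inv_sub_roots[OF u] by (auto simp: Inv_def)
  then have "w \<circ> ?i = id" using length_0[OF GJ_GS[OF u]] length_eq[OF GJ_GS[OF u]] by simp
  then have "w \<circ> (?i \<circ> w0) = w0" by (simp flip: comp_assoc)
  then show ?thesis using w0_mem by (simp add: inv_G_comp GJ)
qed

lemma inv_w0: "inv_into UNIV w0 = w0"
  using w0_mem by (intro longest_unique) (auto simp: inv_GJ length_inv GJ_GS)

text \<open>An element below maximal length misses some \<alpha> of \<open>J\<close> as an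
  inversion, by \<open>maximal_Inv\<close>, and can be lengthened on the right until it reaches
  \<open>w0\<close>.\<close>

lemma complement_right:
  assumes "w \<in> G J"
  shows "\<exists>v\<in>G J. w \<circ> v = w0 \<and> len w + len v = len w0"
  using assms
proof (induction "len w0 - len w" arbitrary: w)
  case 0
  then have "w = w0" using longest_unique[of w] len_le_w0[of w] by simp
  then show ?case by (intro bexI[of _ id]) auto
next
  case (Suc d)
  have "\<exists>\<alpha>\<in>J. \<alpha> \<notin> Inv w"
  proof (rule ccontr)
    assume "\<not> ?thesis"
    then have "PJ \<subseteq> Inv w" using maximal_Inv[OF GJ[OF Suc(3)]] by blast
    then have "card PJ \<le> card (Inv w)" using finite_Inv card_mono by blast
    then show False using Suc(2) len_w0 length_eq[OF GJ_GS[OF Suc(3)]] by simp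
  qed
  then obtain \<alpha> where a: "\<alpha> \<in> J" "\<alpha> \<notin> Inv w" by blast
  have l: "len (w \<circ> s \<alpha>) = Suc (len w)" using a J Suc(3) by (intro length_up GJ_GS) auto
  have m: "w \<circ> s \<alpha> \<in> G J" using a Suc by (simp add: G_comp G_refl)
  have "d = len w0 - len (w \<circ> s \<alpha>)" using Suc(2) l by arith
  from Suc(1)[OF this m] obtain v where
    v: "v \<in> G J" "w \<circ> s \<alpha> \<circ> v = w0" "len (w \<circ> s \<alpha>) + len v = len w0" by blast
  have sv: "s \<alpha> \<circ> v \<in> G J" using v a by (simp add: G_comp G_refl)
  have e: "w \<circ> (s \<alpha> \<circ> v) = w0" using v by (simp add: comp_assoc)
  \<comment> \<open>Subadditivity bounds the length of \<open>s \<alpha> \<circ> v\<close> from both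
    sides, and the two bounds meet.\<close>
  have "len (s \<alpha> \<circ> v) \<le> Suc (len v)"
    using length_comp_le[of "s \<alpha>" v] length_le[of "[\<alpha>]"] a J v
    by (fastforce simp: wd_Cons G_refl GJ_GS)
  moreover have "len w0 \<le> len w + len (s \<alpha> \<circ> v)"
    using length_comp_le[OF GJ_GS GJ_GS, OF Suc(3) sv] e by simp
  ultimately show ?case using e sv v(3) l by (intro bexI[of _ "s \<alpha> \<circ> v"]) auto
qed

text \<open>Take a right complement of the inverse of \<open>w\<close> and invert; \<open>w0\<close>
  is its own inverse.\<close>

lemma complement_left:
  assumes "w \<in> G J"
  shows "\<exists>v\<in>G J. v \<circ> w = w0 \<and> len v + len w = len w0"
proof -
  obtain v where v: "v \<in> G J" "inv_into UNIV w \<circ> v = w0" "len (inv_into UNIV w) + len v = len w0"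
    using complement_right[OF inv_GJ[OF assms]] by blast
  have "inv_into UNIV (inv_into UNIV w \<circ> v) = inv_into UNIV v \<circ> w"
    using assms v(1) by (simp add: o_inv_distrib bij_imp_bij_inv bij_G GJ inv_inv_eq)
  then have "inv_into UNIV v \<circ> w = w0" using v inv_w0 by simp
  then show ?thesis
    using v assms by (intro bexI[of _ "inv_into UNIV v"]) (auto simp: inv_GJ length_inv GJ_GS)
qed

end

section \<open>Demazure operators\<close>

context root_system
begin

lemma comp_linear_poly:
  assumes "f \<in> R" and L: "\<And>h k. L (h + k) = L h + L k" "\<And>c h. L (sc c h) = sc c (L h)"
  shows "f \<circ> L \<in> R"
  using assms(1)
proof induction
  case (linear f)
  then have "f \<circ> L \<in> dual sc" by (intro dualI) (simp_all add: L dual_add dual_scale comp_apply)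
  then show ?case by (rule poly_funs.linear)
next
  case (add f g)
  have "(f + g) \<circ> L = (f \<circ> L) + (g \<circ> L)" by (auto simp: fun_eq_iff comp_apply)
  with add show ?case by (simp only: poly_funs.add)
next
  case (mult f g)
  have "(f * g) \<circ> L = (f \<circ> L) * (g \<circ> L)" by (auto simp: fun_eq_iff comp_apply)
  with mult show ?case by (simp only: poly_funs.mult)
qed (simp add: o_def poly_funs.const)

lemma poly_zero [simp]: "0 \<in> R" and poly_one [simp]: "1 \<in> R"
  using poly_funs.const[of 0 sc] poly_funs.const[of 1 sc] by (auto simp: zero_fun_def one_fun_def)

lemma poly_fscale: "f \<in> R \<Longrightarrow> fscale c f \<in> R"
  unfolding fscale_mult by (intro poly_funs.mult poly_funs.const)

lemma poly_uminus: "f \<in> R \<Longrightarrow> - f \<in> R"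
  using poly_fscale[of f "-1"] by (simp add: fscale_def fun_Compl_def)

lemma poly_diff: "f \<in> R \<Longrightarrow> g \<in> R \<Longrightarrow> f - g \<in> R"
  using poly_funs.add[of f sc "- g"] poly_uminus by simp

lemma poly_sum: "(\<And>i. i \<in> A \<Longrightarrow> f i \<in> R) \<Longrightarrow> (\<Sum>i\<in>A. f i) \<in> R"
  by (induction A rule: infinite_finite_induct) (simp_all add: poly_funs.add)

lemma poly_prod: "(\<And>i. i \<in> A \<Longrightarrow> f i \<in> R) \<Longrightarrow> (\<Prod>i\<in>A. f i) \<in> R"
  by (induction A rule: infinite_finite_induct) (simp_all add: poly_funs.mult)

lemma poly_power: "f \<in> R \<Longrightarrow> f ^ n \<in> R"
  by (induction n) (simp_all add: poly_funs.mult)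

lemma act_poly: "w \<in> G \<Phi> \<Longrightarrow> f \<in> R \<Longrightarrow> act w f \<in> R"
proof -
  assume w: "w \<in> G \<Phi>" and f: "f \<in> R"
  from inv_G_G[OF w order_refl w] obtain as where as: "set as \<subseteq> \<Phi>" "inv_into UNIV w = wd as"
    by (rule G_obtain)
  show ?thesis unfolding act_def as(2) using f wd_linear[OF as(1)] by (rule comp_linear_poly)
qed

lemma poly_on_line:
  assumes "f \<in> R" shows "\<exists>p. \<forall>t. f (h + sc t k) = poly p t"
  using assms
proof induction
  case (const c)
  show ?case by (rule exI[of _ "[:c:]"]) simp
next
  case (linear f)
  then show ?case by (intro exI[of _ "[:f h, f k:]"]) (simp add: dual_add dual_scale)
next
  case (add f g)
  then show ?case by (metis plus_fun_apply poly_add)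
next
  case (mult f g)
  then show ?case by (metis times_fun_apply poly_mult)
qed

text \<open>On a line both factors are univariate polynomials, so the first may be cancelled as soon
  as it is nonzero at one point of that line. Stating this for one line lets it serve inside a
  hyperplane too, in \<open>vanish_on_kernel_cancel\<close>.\<close>

lemma poly_line_cancel:
  assumes "f \<in> R" "g \<in> R" "\<And>t. f (h + sc t k) * g (h + sc t k) = 0" "f (h + sc t0 k) \<noteq> 0"
  shows "g (h + sc t k) = 0"
proof -
  obtain p q where p: "\<And>t. f (h + sc t k) = poly p t" and q: "\<And>t. g (h + sc t k) = poly q t"
    using poly_on_line assms(1,2) by metis
  have "poly (p * q) t = 0" for t using assms(3) p q by simp
  then have "p * q = 0" using poly_all_0_iff_0 by blast
  moreover have "p \<noteq> 0" using assms(4) p by auto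
  ultimately show ?thesis using q by simp
qed

lemma poly_domain:
  assumes "f \<in> R" "g \<in> R" "f * g = 0" "f \<noteq> 0"
  shows "g = 0"
proof
  fix h
  from assms(4) obtain k where "f k \<noteq> 0" by (auto simp: fun_eq_iff)
  then show "g h = 0 h"
    using poly_line_cancel[OF assms(1,2), of h "k - h" 1 0] assms(3)
    by (auto simp: fun_eq_iff)
qed

lemma poly_cancel:
  assumes "f \<in> R" "g \<in> R" "f' \<in> R" "f * g = f * f'" "f \<noteq> 0"
  shows "g = f'"
  using poly_domain[of f "g - f'"] assms by (simp add: poly_diff algebra_simps)

text \<open>The parameter \<open>c\<close> covers two substitutions: \<open>c = 1\<close> is the
  reflection and yields Demazure operators; \<open>c = 1/2\<close> is the projection onto the kernel
  of \<alpha> along the coroot and yields divisibility by \<alpha>.\<close>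

lemma divided_difference:
  assumes "\<alpha> \<in> \<Phi>" "f \<in> R"
  shows "\<exists>g\<in>R. f - (f \<circ> (\<lambda>h. h - sc (c * \<alpha> h) (cr \<alpha>))) = \<alpha> * g"
    (is "\<exists>g\<in>R. f - (f \<circ> ?T) = _")
  using assms(2)
proof induction
  case (const d)
  show ?case by (intro bexI[of _ 0]) (auto simp: fun_eq_iff o_def)
next
  case (linear f)
  then have "f - (f \<circ> ?T) = \<alpha> * (\<lambda>_. c * f (cr \<alpha>))"
    by (simp add: fun_eq_iff o_def dual_diff dual_scale)
  then show ?case using poly_funs.const by blast
next
  case (add f g)
  then obtain f' g' where *: "f' \<in> R" "g' \<in> R" "f - (f \<circ> ?T) = \<alpha> * f'" "g - (g \<circ> ?T) = \<alpha> * g'" by blast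
  have "(f + g) - ((f + g) \<circ> ?T) = (f - (f \<circ> ?T)) + (g - (g \<circ> ?T))" by (auto simp: fun_eq_iff o_def)
  also have "\<dots> = \<alpha> * (f' + g')" unfolding *(3,4) by (simp only: distrib_left)
  finally show ?case using * poly_funs.add by blast
next
  case (mult f g)
  then obtain f' g' where *: "f' \<in> R" "g' \<in> R" "f - (f \<circ> ?T) = \<alpha> * f'" "g - (g \<circ> ?T) = \<alpha> * g'" by blast
  have "f \<circ> ?T \<in> R" using \<open>f \<in> R\<close> dual_add[OF root_dual[OF assms(1)]] dual_scale[OF root_dual[OF assms(1)]]
    by (intro comp_linear_poly) (auto simp: scale_left_distrib scale_right_diff_distrib algebra_simps)
  moreover have "(f * g) - ((f * g) \<circ> ?T) = (f - (f \<circ> ?T)) * g + (f \<circ> ?T) * (g - (g \<circ> ?T))"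
    by (auto simp: fun_eq_iff o_def algebra_simps)
  then have "(f * g) - ((f * g) \<circ> ?T) = \<alpha> * (f' * g + (f \<circ> ?T) * g')"
    unfolding * by (simp add: algebra_simps)
  ultimately show ?case using * \<open>g \<in> R\<close> poly_funs.add poly_funs.mult by blast
qed

section \<open>A single Demazure operator\<close>

abbreviation "dem \<equiv> demazure sc cr"

lemma root_poly: "\<alpha> \<in> \<Phi> \<Longrightarrow> \<alpha> \<in> R"
  by (simp add: root_dual poly_funs.linear)

context
  fixes \<alpha> assumes \<alpha>: "\<alpha> \<in> \<Phi>"
begin

text \<open>This gives meaning to the definite description in \<open>demazure\<close>: a quotient
  exists by \<open>divided_difference\<close> and is unique because \<alpha> can be
  cancelled.\<close>

lemma dem_ex1:
  assumes "f \<in> R" shows "\<exists>!g. g \<in> R \<and> \<alpha> * g = f - act (s \<alpha>) f"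
proof -
  have "act (s \<alpha>) f = f \<circ> (\<lambda>h. h - sc (1 * \<alpha> h) (cr \<alpha>))"
    unfolding act_refl[OF \<alpha>] by (simp add: fun_eq_iff o_def refl_def)
  then obtain g where g: "g \<in> R" "f - act (s \<alpha>) f = \<alpha> * g"
    using divided_difference[OF \<alpha> assms, of 1] by auto
  show ?thesis
  proof (rule ex1I[of _ g])
    fix g' assume "g' \<in> R \<and> \<alpha> * g' = f - act (s \<alpha>) f"
    then show "g' = g"
      using poly_cancel[OF root_poly[OF \<alpha>] _ g(1) _ root_nonzero[OF \<alpha>]] g(2) by simp
  qed (simp add: g)
qed

lemma dem_poly: "f \<in> R \<Longrightarrow> dem \<alpha> f \<in> R"
  and dem_eq: "f \<in> R \<Longrightarrow> \<alpha> * dem \<alpha> f = f - act (s \<alpha>) f"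
  using theI'[OF dem_ex1] unfolding demazure_def by blast+

lemma dem_unique: "f \<in> R \<Longrightarrow> g \<in> R \<Longrightarrow> \<alpha> * g = f - act (s \<alpha>) f \<Longrightarrow> dem \<alpha> f = g"
  using dem_ex1 dem_poly dem_eq by blast

lemma dem_add: "f \<in> R \<Longrightarrow> g \<in> R \<Longrightarrow> dem \<alpha> (f + g) = dem \<alpha> f + dem \<alpha> g"
  by (rule dem_unique) (auto simp: distrib_left dem_eq act_add intro: poly_funs.add dem_poly)

lemma act_refl_poly: "f \<in> R \<Longrightarrow> act (s \<alpha>) f \<in> R"
  using act_poly \<alpha> G_refl by blast

lemma dem_mult: "f \<in> R \<Longrightarrow> g \<in> R \<Longrightarrow> dem \<alpha> (f * g) = dem \<alpha> f * g + act (s \<alpha>) f * dem \<alpha> g"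
proof (rule dem_unique)
  assume *: "f \<in> R" "g \<in> R"
  have "\<alpha> * (dem \<alpha> f * g + act (s \<alpha>) f * dem \<alpha> g) = (\<alpha> * dem \<alpha> f) * g + act (s \<alpha>) f * (\<alpha> * dem \<alpha> g)"
    by (simp add: algebra_simps)
  also have "\<dots> = f * g - act (s \<alpha>) (f * g)"
    unfolding dem_eq[OF *(1)] dem_eq[OF *(2)] act_mult by (simp add: algebra_simps)
  finally show "\<alpha> * (dem \<alpha> f * g + act (s \<alpha>) f * dem \<alpha> g) = f * g - act (s \<alpha>) (f * g)" .
qed (blast intro: poly_funs.add poly_funs.mult dem_poly act_refl_poly)+

lemma dem_linear: "f \<in> dual sc \<Longrightarrow> dem \<alpha> f = (\<lambda>_. f (cr \<alpha>))"
  using \<alpha> by (intro dem_unique) (auto simp: poly_funs.linear poly_funs.const dual_refl refl_dual_def fun_eq_iff)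

lemma dem_of_invariant: "f \<in> R \<Longrightarrow> act (s \<alpha>) f = f \<Longrightarrow> dem \<alpha> f = 0"
  by (rule dem_unique) auto

lemma dem_zero_iff: "f \<in> R \<Longrightarrow> dem \<alpha> f = 0 \<longleftrightarrow> act (s \<alpha>) f = f"
  using dem_of_invariant dem_eq[of f] by auto

lemma dem_const: "dem \<alpha> (\<lambda>_. c) = 0"
  by (rule dem_of_invariant) (auto simp: poly_funs.const act_const)

lemma dem_0: "dem \<alpha> 0 = 0"
  by (rule dem_of_invariant) (auto simp: act_zero)

lemma dem_invariant_mult: "f \<in> R \<Longrightarrow> g \<in> R \<Longrightarrow> act (s \<alpha>) f = f \<Longrightarrow> dem \<alpha> (f * g) = f * dem \<alpha> g"
  by (simp add: dem_mult dem_of_invariant)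

text \<open>The difference of \<open>f\<close> and its reflection changes sign under the reflection,
  and so does \<alpha>; the quotient is therefore fixed.\<close>

lemma act_dem:
  assumes "f \<in> R" shows "act (s \<alpha>) (dem \<alpha> f) = dem \<alpha> f"
proof -
  have "act (s \<alpha>) (\<alpha> * dem \<alpha> f) = - (\<alpha> * dem \<alpha> f)"
    unfolding dem_eq[OF assms] using \<alpha> by (simp add: act_diff)
  then have "\<alpha> * act (s \<alpha>) (dem \<alpha> f) = \<alpha> * dem \<alpha> f"
    using \<alpha> by (simp add: act_mult act_refl_self)
  then show ?thesis
    using poly_cancel[OF root_poly[OF \<alpha>] _ _ _ root_nonzero[OF \<alpha>]] assms act_refl_poly dem_poly by blast
qed

lemma dem_dem: "f \<in> R \<Longrightarrow> dem \<alpha> (dem \<alpha> f) = 0"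
  by (simp add: dem_of_invariant dem_poly act_dem)

lemma dem_act: "f \<in> R \<Longrightarrow> dem \<alpha> (act (s \<alpha>) f) = - dem \<alpha> f"
  using \<alpha> by (intro dem_unique) (auto simp: act_refl_poly poly_uminus dem_poly dem_eq)

end

section \<open>Demazure operators along arbitrary words\<close>

definition Dw :: "('h \<Rightarrow> complex) list \<Rightarrow> ('h \<Rightarrow> complex) \<Rightarrow> 'h \<Rightarrow> complex" where
  "Dw as = foldr (\<lambda>\<alpha> D. dem \<alpha> \<circ> D) as id"

lemma Dw_Nil [simp]: "Dw [] f = f" and Dw_Cons [simp]: "Dw (a # as) f = dem a (Dw as f)"
  by (simp_all add: Dw_def comp_apply id_apply)

lemma Dw_append: "Dw (as @ bs) f = Dw as (Dw bs f)"
  by (induction as) auto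

lemma Dw_poly: "set as \<subseteq> \<Phi> \<Longrightarrow> f \<in> R \<Longrightarrow> Dw as f \<in> R"
  by (induction as) (auto simp: dem_poly)

lemma Dw_add: "set as \<subseteq> \<Phi> \<Longrightarrow> f \<in> R \<Longrightarrow> g \<in> R \<Longrightarrow> Dw as (f + g) = Dw as f + Dw as g"
  by (induction as) (auto simp: dem_add Dw_poly)

lemma Dw_0: "set as \<subseteq> \<Phi> \<Longrightarrow> Dw as 0 = 0"
  by (induction as) (auto simp: dem_0)

lemma Dw_invariant_mult:
  assumes "set as \<subseteq> \<Phi>" "f \<in> R" "g \<in> R" "\<And>a. a \<in> set as \<Longrightarrow> act (s a) f = f"
  shows "Dw as (f * g) = f * Dw as g"
  using assms by (induction as) (auto simp: dem_invariant_mult Dw_poly)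

lemma Dw_const_mult:
  "set as \<subseteq> \<Phi> \<Longrightarrow> g \<in> R \<Longrightarrow> Dw as ((\<lambda>_. c) * g) = (\<lambda>_. c) * Dw as g"
  by (rule Dw_invariant_mult) (auto simp: poly_funs.const act_const)

end

section \<open>Chevalley's formula and independence of the reduced word\<close>

context root_basis
begin

abbreviation "\<Delta> \<equiv> demazure_elt sc cr simples"

text \<open>Cutting the operator off at length \<open>k\<close> lets one expression cover both a
  reduced word (its operator) and a word that is not reduced (zero). It also leaves in Chevalley's
  sum only those inversions that lower the length by exactly one.\<close>

definition \<Gamma> :: "nat \<Rightarrow> ('h \<Rightarrow> 'h) \<Rightarrow> ('h \<Rightarrow> complex) \<Rightarrow> 'h \<Rightarrow> complex" where
  "\<Gamma> k v f = (if len v = k then \<Delta> v f else 0)"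

lemma demazure_elt_obtain:
  assumes "v \<in> G simples"
  obtains as where "set as \<subseteq> simples" "wd as = v" "length as = len v" "\<Delta> v = Dw as"
proof -
  have "\<exists>as. reduced_word sc cr simples v as" using reduced_word_exists[OF order_refl assms] by metis
  then have "reduced_word sc cr simples v (SOME as. reduced_word sc cr simples v as)" by (rule someI_ex)
  with that show ?thesis unfolding reduced_word_def demazure_elt_def Dw_def by blast
qed

lemma set_simples_roots: "set as \<subseteq> simples \<Longrightarrow> set as \<subseteq> \<Phi>"
  using simples_roots by blast

lemma len_comp_refl_le: "w \<in> G simples \<Longrightarrow> a \<in> simples \<Longrightarrow> len (w \<circ> s a) \<le> Suc (len w)"
  using length_up[of w a] length_down[of w a] by (cases "a \<in> Inv w") auto

lemma wd_snoc: "wd (as @ [a]) = wd as \<circ> s a"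
  by (simp add: wd_append wd_Cons)

definition word_indep :: "nat \<Rightarrow> bool" where
  "word_indep k \<longleftrightarrow> (\<forall>as f. set as \<subseteq> simples \<and> length as = k \<and> f \<in> R \<longrightarrow> Dw as f = \<Gamma> k (wd as) f)"

definition chevalley :: "nat \<Rightarrow> bool" where
  "chevalley k \<longleftrightarrow> (\<forall>as f \<mu>. set as \<subseteq> simples \<and> length as = k \<and> len (wd as) = k \<and> f \<in> R \<and> \<mu> \<in> dual sc \<longrightarrow>
     Dw as (\<mu> * f) = act (wd as) \<mu> * Dw as f +
       (\<Sum>\<gamma>\<in>Inv (wd as). (\<lambda>_. \<mu> (cr \<gamma>)) * \<Gamma> (k - 1) (wd as \<circ> s \<gamma>) f))"

lemma chevalleyD:
  assumes "chevalley k" "set as \<subseteq> simples" "length as = k" "wd as = w" "len w = k" "f \<in> R" "\<mu> \<in> dual sc"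
  shows "Dw as (\<mu> * f) = act w \<mu> * Dw as f +
       (\<Sum>\<gamma>\<in>Inv w. (\<lambda>_. \<mu> (cr \<gamma>)) * \<Gamma> (k - 1) (w \<circ> s \<gamma>) f)"
  using assms unfolding chevalley_def by blast

text \<open>Split off the last letter \<open>a\<close> and apply the twisted Leibniz rule for
  \<open>dem a\<close>. The inversions of the new product are \<open>a\<close>, which gives the
  constant term, and the transported old inversions, which give the sum by induction.\<close>

lemma chevalley_Suc:
  assumes S: "word_indep k" and L: "chevalley k"
  shows "chevalley (Suc k)"
  unfolding chevalley_def
proof (intro allI impI, elim conjE)
  fix as f \<mu>
  assume as: "set as \<subseteq> simples" "length as = Suc k" "len (wd as) = Suc k" "f \<in> R" "\<mu> \<in> dual sc"
  obtain bs a where ba: "as = bs @ [a]" using as(2) by (cases as rule: rev_cases) auto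
  let ?w = "wd bs"
  have b: "set bs \<subseteq> simples" "length bs = k" "a \<in> simples" "a \<in> \<Phi>" "set bs \<subseteq> \<Phi>"
    using as ba simples_roots by auto
  have w: "?w \<in> G simples" "?w \<in> G \<Phi>" using b GS G_wd by blast+
  have e: "wd as = ?w \<circ> s a" by (simp add: ba wd_snoc)
  have lw: "len ?w = k" using len_comp_refl_le[OF w(1) b(3)] as(3) e length_le[OF b(1)] b(2) by simp
  have anI: "a \<notin> Inv ?w" using length_down[OF w(1) b(3)] lw as(3) e by auto
  note I = Inv_comp_refl[OF w(2) b(3) anI]
  \<comment> \<open>If the shortened element has length \<open>k - 1\<close>, appending
    \<open>a\<close> to its word gives a word of length \<open>k\<close>, reduced or not, so
    \<open>word_indep k\<close> applies. Otherwise it is at least two below \<open>k\<close>, and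
    both sides are zero.\<close>
  have tm: "\<Gamma> k (?w \<circ> s \<gamma> \<circ> s a) f = \<Gamma> (k - 1) (?w \<circ> s \<gamma>) (dem a f)" if g: "\<gamma> \<in> Inv ?w" for \<gamma>
  proof -
    let ?v = "?w \<circ> s \<gamma>"
    have v: "?v \<in> G simples" "len ?v < k" using length_refl_lt[OF w(1) g] lw by auto
    show ?thesis
    proof (cases "len ?v = k - 1")
      case True
      obtain cs where cs: "set cs \<subseteq> simples" "wd cs = ?v" "length cs = len ?v" "\<Delta> ?v = Dw cs"
        using demazure_elt_obtain[OF v(1)] .
      have "length (cs @ [a]) = k" "set (cs @ [a]) \<subseteq> simples" using cs True v b by auto
      then have "Dw (cs @ [a]) f = \<Gamma> k (wd (cs @ [a])) f"
        using S as(4) unfolding word_indep_def by blast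
      then have "Dw (cs @ [a]) f = \<Gamma> k (?v \<circ> s a) f" unfolding wd_snoc cs(2) .
      then show ?thesis using True cs by (simp add: \<Gamma>_def Dw_append)
    next
      case False
      then show ?thesis using v len_comp_refl_le[OF v(1) b(3)] by (simp add: \<Gamma>_def)
    qed
  qed
  have mu': "act (s a) \<mu> \<in> dual sc" using as b by (simp add: act_refl_dual)
  have df: "dem a f \<in> R" using as b by (simp add: dem_poly)
  have "Dw as (\<mu> * f) = Dw bs ((\<lambda>_. \<mu> (cr a)) * f + act (s a) \<mu> * dem a f)"
    using as b by (simp add: ba Dw_append dem_mult dem_linear poly_funs.linear)
  also have "\<dots> = (\<lambda>_. \<mu> (cr a)) * Dw bs f + Dw bs (act (s a) \<mu> * dem a f)"
    using as b mu' df
    by (simp add: Dw_add Dw_const_mult poly_funs.mult poly_funs.const poly_funs.linear)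
  also have "Dw bs (act (s a) \<mu> * dem a f) = act ?w (act (s a) \<mu>) * Dw bs (dem a f) +
     (\<Sum>\<gamma>\<in>Inv ?w. (\<lambda>_. act (s a) \<mu> (cr \<gamma>)) * \<Gamma> (k - 1) (?w \<circ> s \<gamma>) (dem a f))"
    using L b lw mu' df unfolding chevalley_def by blast
  also have "act ?w (act (s a) \<mu>) = act (wd as) \<mu>"
    unfolding e using w b by (simp add: act_G_comp refl_GS)
  also have "Dw bs (dem a f) = Dw as f" by (simp add: ba Dw_append)
  \<comment> \<open>This is the summand of the new inversion \<open>a\<close>: multiplying
    \<open>wd as\<close> by its reflection undoes the last letter.\<close>
  also have "Dw bs f = \<Gamma> k (wd as \<circ> s a) f"
    using S b as(4) unfolding word_indep_def e comp_refl_refl[OF b(4)] by blast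
  also have "(\<Sum>\<gamma>\<in>Inv ?w. (\<lambda>_. act (s a) \<mu> (cr \<gamma>)) * \<Gamma> (k - 1) (?w \<circ> s \<gamma>) (dem a f)) =
     (\<Sum>\<gamma>\<in>Inv ?w. (\<lambda>_. \<mu> (cr (act (s a) \<gamma>))) * \<Gamma> k (wd as \<circ> s (act (s a) \<gamma>)) f)"
  proof (rule sum.cong[OF HOL.refl])
    fix \<gamma> assume g: "\<gamma> \<in> Inv ?w"
    then have gr: "\<gamma> \<in> \<Phi>" by (simp add: Inv_def pos_root)
    have c: "act (s a) \<mu> (cr \<gamma>) = \<mu> (cr (act (s a) \<gamma>))"
      unfolding coroot_refl[OF gr b(4)] using b by (simp add: act_refl comp_apply)
    have "s a \<circ> s (act (s a) \<gamma>) = s a \<circ> (s (act (s a) \<gamma>) \<circ> s a) \<circ> s a"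
      using b by (simp add: comp_assoc)
    also have "\<dots> = s a \<circ> (s a \<circ> s \<gamma>) \<circ> s a"
      using refl_conj_G[OF refl_GS[OF b(3)] gr] by simp
    also have "\<dots> = s \<gamma> \<circ> s a" using b by (simp add: refl_refl_comp)
    finally have "wd as \<circ> s (act (s a) \<gamma>) = ?w \<circ> s \<gamma> \<circ> s a" unfolding e by (simp add: comp_assoc)
    with c tm[OF g] show "(\<lambda>_. act (s a) \<mu> (cr \<gamma>)) * \<Gamma> (k - 1) (?w \<circ> s \<gamma>) (dem a f) =
      (\<lambda>_. \<mu> (cr (act (s a) \<gamma>))) * \<Gamma> k (wd as \<circ> s (act (s a) \<gamma>)) f" by simp
  qed
  also have "\<dots> = (\<Sum>\<gamma>\<in>act (s a) ` Inv ?w. (\<lambda>_. \<mu> (cr \<gamma>)) * \<Gamma> k (wd as \<circ> s \<gamma>) f)"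
    using inj_act_G[OF refl_GS[OF b(3)]] inj_on_subset by (subst sum.reindex) (auto simp: comp_def)
  finally have "Dw as (\<mu> * f) = (\<lambda>_. \<mu> (cr a)) * \<Gamma> k (wd as \<circ> s a) f + (act (wd as) \<mu> * Dw as f +
     (\<Sum>\<gamma>\<in>act (s a) ` Inv ?w. (\<lambda>_. \<mu> (cr \<gamma>)) * \<Gamma> k (wd as \<circ> s \<gamma>) f))" .
  also have "\<dots> = act (wd as) \<mu> * Dw as f + ((\<lambda>_. \<mu> (cr a)) * \<Gamma> k (wd as \<circ> s a) f +
     (\<Sum>\<gamma>\<in>act (s a) ` Inv ?w. (\<lambda>_. \<mu> (cr \<gamma>)) * \<Gamma> k (wd as \<circ> s \<gamma>) f))"
    by (rule add.left_commute)
  also have "(\<lambda>_. \<mu> (cr a)) * \<Gamma> k (wd as \<circ> s a) f +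
     (\<Sum>\<gamma>\<in>act (s a) ` Inv ?w. (\<lambda>_. \<mu> (cr \<gamma>)) * \<Gamma> k (wd as \<circ> s \<gamma>) f) =
     (\<Sum>\<gamma>\<in>Inv (wd as). (\<lambda>_. \<mu> (cr \<gamma>)) * \<Gamma> k (wd as \<circ> s \<gamma>) f)"
    unfolding I(1)[folded e] by (rule sum.insert[OF finite_imageI[OF finite_Inv] I(2), symmetric])
  finally show "Dw as (\<mu> * f) = act (wd as) \<mu> * Dw as f +
       (\<Sum>\<gamma>\<in>Inv (wd as). (\<lambda>_. \<mu> (cr \<gamma>)) * \<Gamma> (Suc k - 1) (wd as \<circ> s \<gamma>) f)"
    unfolding diff_Suc_1 .
qed

text \<open>Two reduced words for \<open>v\<close> have the same correction terms in the Leibniz rule, so the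
  difference \<open>E\<close> of their operators satisfies \<open>E (f g) = v f \<cdot> E g\<close>, and it kills constants.\<close>

lemma word_indep_Suc:
  assumes S: "word_indep k" and L: "chevalley (Suc k)"
  shows "word_indep (Suc k)"
  unfolding word_indep_def
proof (intro allI impI, elim conjE)
  fix as f
  assume as: "set as \<subseteq> simples" "length as = Suc k" "f \<in> R"
  let ?v = "wd as"
  \<comment> \<open>The rightmost letter acts first, and its operator annihilates constants.\<close>
  have kill: "Dw cs 1 = 0" if c: "set cs \<subseteq> \<Phi>" "length cs = Suc k" for cs
  proof -
    obtain bs a where "cs = bs @ [a]" using c(2) by (cases cs rule: rev_cases) auto
    then show ?thesis using c(1) by (simp add: Dw_append one_fun_def dem_const Dw_0)
  qed
  show "Dw as f = \<Gamma> (Suc k) ?v f"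
  proof (cases "len ?v = Suc k")
    case True
    obtain cs where cs: "set cs \<subseteq> simples" "wd cs = ?v" "length cs = len ?v" "\<Delta> ?v = Dw cs"
      using demazure_elt_obtain[OF G_wd[OF as(1)]] .
    note r = set_simples_roots[OF as(1)] set_simples_roots[OF cs(1)]
    define E where "E g = Dw as g - Dw cs g" for g
    have E_lin: "E (\<mu> * g) = act ?v \<mu> * E g" if "\<mu> \<in> dual sc" "g \<in> R" for \<mu> g
    proof -
      let ?c = "\<Sum>\<gamma>\<in>Inv ?v. (\<lambda>_. \<mu> (cr \<gamma>)) * \<Gamma> (Suc k - 1) (?v \<circ> s \<gamma>) g"
      have "Dw as (\<mu> * g) = act ?v \<mu> * Dw as g + ?c"
        by (rule chevalleyD[OF L as(1,2) HOL.refl True that(2,1)])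
      moreover have "Dw cs (\<mu> * g) = act ?v \<mu> * Dw cs g + ?c"
        by (rule chevalleyD[OF L cs(1) _ cs(2) True that(2,1)]) (simp add: cs(3) True)
      ultimately show ?thesis unfolding E_def by (simp only: right_diff_distrib add_diff_add diff_self add_0_right)
    qed
    have "E (f * g) = act ?v f * E g" if "g \<in> R" for g
      using as(3) that
    proof (induction arbitrary: g)
      case (const c)
      show ?case unfolding E_def Dw_const_mult[OF r(1) const] Dw_const_mult[OF r(2) const] act_const
        by (rule right_diff_distrib[symmetric])
    next
      case (linear \<mu>)
      then show ?case by (rule E_lin)
    next
      case (add f1 f2)
      have m: "f1 * g \<in> R" "f2 * g \<in> R" using add by (auto intro: poly_funs.mult)
      have "E ((f1 + f2) * g) = E (f1 * g) + E (f2 * g)"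
        unfolding E_def distrib_right Dw_add[OF r(1) m] Dw_add[OF r(2) m] by (rule add_diff_add)
      also have "\<dots> = act ?v (f1 + f2) * E g"
        unfolding act_add distrib_right add.IH(1)[OF add.prems] add.IH(2)[OF add.prems] ..
      finally show ?case .
    next
      case (mult f1 f2)
      have "f2 * g \<in> R" using mult by (auto intro: poly_funs.mult)
      then show ?case
        unfolding mult.assoc act_mult mult.IH(2)[OF mult.prems, symmetric] by (rule mult.IH(1))
    qed
    moreover have "E 1 = 0" using kill[OF r(1)] kill[OF r(2)] as cs True by (simp add: E_def)
    ultimately have "E f = 0" by (metis mult.right_neutral mult_zero_right poly_one)
    then show ?thesis using True cs by (simp add: \<Gamma>_def E_def)
  next
    case False
    obtain bs a where ba: "as = bs @ [a]" using as(2) by (cases as rule: rev_cases) auto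
    have b: "set bs \<subseteq> simples" "length bs = k" "a \<in> simples" "a \<in> \<Phi>" "set bs \<subseteq> \<Phi>"
      using as ba simples_roots by auto
    have w: "wd bs \<in> G simples" using b G_wd by blast
    have df: "dem a f \<in> R" using as b by (simp add: dem_poly)
    have Sb: "Dw bs (dem a f) = \<Gamma> k (wd bs) (dem a f)" using S b df unfolding word_indep_def by blast
    \<comment> \<open>If \<open>bs\<close> is reduced, \<open>a\<close> is an inversion of
      \<open>wd bs\<close>, which then also has a reduced word ending in \<open>a\<close>. Applied
      after \<open>dem a\<close>, that word contains the square of \<open>dem a\<close>, which is
      zero.\<close>
    have "\<Gamma> k (wd bs) (dem a f) = 0"
    proof (cases "len (wd bs) = k")
      case True
      have "a \<in> Inv (wd bs)" using length_up[OF w b(3)] True False by (auto simp: ba wd_snoc)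
      from length_down[OF w b(3) this] have l: "Suc (len (wd bs \<circ> s a)) = k" using True by simp
      have g: "wd bs \<circ> s a \<in> G simples" using w b by (simp add: GS_comp_refl)
      obtain cs where cs: "set cs \<subseteq> simples" "wd cs = wd bs \<circ> s a" "length cs = len (wd bs \<circ> s a)"
        using demazure_elt_obtain[OF g] by metis
      have "wd (cs @ [a]) = wd bs" using cs b by (simp add: wd_snoc comp_refl_refl)
      then have "\<Gamma> k (wd bs) (dem a f) = Dw (cs @ [a]) (dem a f)"
        using S b df cs l unfolding word_indep_def by auto
      also have "\<dots> = 0" using as b cs by (simp add: Dw_append dem_dem Dw_0 set_simples_roots)
      finally show ?thesis .
    qed (simp add: \<Gamma>_def)
    then show ?thesis using False Sb by (simp add: \<Gamma>_def ba Dw_append)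
  qed
qed

text \<open>At each step the formula for \<open>Suc k\<close> comes first, from both statements at
  \<open>k\<close>; independence for \<open>Suc k\<close> then uses that new formula.\<close>

lemma word_indep_chevalley: "word_indep k \<and> chevalley k"
proof (induction k)
  case 0
  have "\<Delta> id = Dw []" using demazure_elt_obtain[OF G_id] by (metis length_id length_0_conv)
  then show ?case
    by (simp add: word_indep_def chevalley_def \<Gamma>_def Inv_id)
next
  case (Suc k)
  then show ?case using chevalley_Suc word_indep_Suc by blast
qed

lemma Dw_eq:
  "set as \<subseteq> simples \<Longrightarrow> f \<in> R \<Longrightarrow> Dw as f = (if len (wd as) = length as then \<Delta> (wd as) f else 0)"
  using word_indep_chevalley[of "length as"] by (simp add: word_indep_def \<Gamma>_def)

lemma \<Delta>_leibniz:
  assumes "w \<in> G simples" "f \<in> R" "\<mu> \<in> dual sc"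
  shows "\<Delta> w (\<mu> * f) = act w \<mu> * \<Delta> w f +
     (\<Sum>\<gamma>\<in>Inv w. (\<lambda>_. \<mu> (cr \<gamma>)) * \<Gamma> (len w - 1) (w \<circ> s \<gamma>) f)"
proof -
  obtain as where as: "set as \<subseteq> simples" "wd as = w" "length as = len w" "\<Delta> w = Dw as"
    using demazure_elt_obtain[OF assms(1)] .
  have "Dw as (\<mu> * f) = act (wd as) \<mu> * Dw as f +
       (\<Sum>\<gamma>\<in>Inv (wd as). (\<lambda>_. \<mu> (cr \<gamma>)) * \<Gamma> (len w - 1) (wd as \<circ> s \<gamma>) f)"
    using word_indep_chevalley[of "len w"] as(1,3) HOL.refl _ assms(2,3) unfolding as(2)[symmetric]
    by (intro chevalleyD) (simp_all add: as(2))
  then show ?thesis unfolding as(2,4) .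
qed

text \<open>Concatenated reduced words form a word for the product. It is reduced exactly when the
  lengths add up, and otherwise its operator vanishes.\<close>

lemma \<Delta>_comp:
  assumes "u \<in> G simples" "v \<in> G simples" "f \<in> R"
  shows "\<Delta> u (\<Delta> v f) = (if len (u \<circ> v) = len u + len v then \<Delta> (u \<circ> v) f else 0)"
proof -
  obtain as where as: "set as \<subseteq> simples" "wd as = u" "length as = len u" "\<Delta> u = Dw as"
    using demazure_elt_obtain[OF assms(1)] .
  obtain bs where bs: "set bs \<subseteq> simples" "wd bs = v" "length bs = len v" "\<Delta> v = Dw bs"
    using demazure_elt_obtain[OF assms(2)] .
  show ?thesis
    using Dw_eq[of "as @ bs" f] as bs assms by (simp add: Dw_append wd_append)
qed

lemma \<Delta>_poly: "w \<in> G simples \<Longrightarrow> f \<in> R \<Longrightarrow> \<Delta> w f \<in> R"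
  by (erule demazure_elt_obtain) (simp add: Dw_poly set_simples_roots)

lemma \<Delta>_add: "w \<in> G simples \<Longrightarrow> f \<in> R \<Longrightarrow> g \<in> R \<Longrightarrow> \<Delta> w (f + g) = \<Delta> w f + \<Delta> w g"
  by (erule demazure_elt_obtain) (simp add: Dw_add set_simples_roots)

lemma \<Delta>_0: "w \<in> G simples \<Longrightarrow> \<Delta> w 0 = 0"
  by (erule demazure_elt_obtain) (simp add: Dw_0 set_simples_roots)

lemma \<Delta>_id: "f \<in> R \<Longrightarrow> \<Delta> id f = f"
  using Dw_eq[of "[]" f] by simp

lemma \<Delta>_refl: "\<alpha> \<in> simples \<Longrightarrow> f \<in> R \<Longrightarrow> \<Delta> (s \<alpha>) f = dem \<alpha> f"
proof -
  assume a: "\<alpha> \<in> simples" "f \<in> R"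
  have "len (s \<alpha>) = 1"
    using length_up[OF G_id a(1)] by (simp add: Inv_id)
  then show ?thesis using Dw_eq[of "[\<alpha>]" f] a by (simp add: wd_Cons)
qed

end

section \<open>Homogeneous polynomials\<close>

lemmas fun_apply = plus_fun_apply times_fun_apply zero_fun_apply one_fun_apply minus_apply uminus_apply

declare fun_apply [simp del] fscale_apply [simp del]

definition cst :: "complex \<Rightarrow> 'h \<Rightarrow> complex" where "cst c = (\<lambda>_. c)"

lemma cst_apply: "cst c h = c"
  by (simp add: cst_def)

lemma cst_0 [simp]: "cst 0 = 0" and cst_1 [simp]: "cst 1 = 1"
  by (simp_all add: cst_def zero_fun_def one_fun_def)

lemma cst_mult: "cst (a * b) = cst a * cst b" and cst_add: "cst (a + b) = cst a + cst b"
  by (simp_all add: cst_def times_fun_def plus_fun_def)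

lemma cst_eq_0_iff: "cst c = 0 \<longleftrightarrow> c = 0"
  by (auto simp: cst_def zero_fun_def fun_eq_iff)

lemma cst_sum: "cst (\<Sum>i\<in>A. f i) = (\<Sum>i\<in>A. cst (f i))"
  by (induction A rule: infinite_finite_induct) (simp_all add: cst_add)

context root_system
begin

text \<open>The degree is an integer, with only zero in negative degrees, so operators that lower
  degrees need no side condition. It is the ordinary polynomial degree, half the one in
  \<open>sym_alg\<close>.\<close>

definition homog :: "int \<Rightarrow> ('h \<Rightarrow> complex) \<Rightarrow> bool" where
  "homog d f \<longleftrightarrow> (if d \<ge> 0 then f \<in> R \<and> (\<forall>c h. f (sc c h) = c ^ nat d * f h) else f = 0)"

lemma homog_poly: "homog d f \<Longrightarrow> f \<in> R"
  by (auto simp: homog_def split: if_splits)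

lemma homog_neg: "homog d f \<Longrightarrow> d < 0 \<Longrightarrow> f = 0"
  by (simp add: homog_def)

lemma homog_0 [simp]: "homog d 0"
  by (auto simp: homog_def fun_apply)

lemma homog_add: "homog d f \<Longrightarrow> homog d g \<Longrightarrow> homog d (f + g)"
  by (auto simp: homog_def poly_funs.add fun_apply distrib_left)

lemma homog_mult: "homog d f \<Longrightarrow> homog e g \<Longrightarrow> homog (d + e) (f * g)"
proof (cases "d < 0 \<or> e < 0")
  case False
  assume "homog d f" "homog e g"
  with False show ?thesis
    by (auto simp: homog_def poly_funs.mult fun_apply nat_add_distrib power_add)
qed (auto dest: homog_neg)

lemma cst_poly [simp]: "cst c \<in> R"
  unfolding cst_def by (rule poly_funs.const)

lemma homog_cst: "homog 0 (cst c)"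
  by (simp add: homog_def cst_apply)

lemma homog_cst_mult: "homog d f \<Longrightarrow> homog d (cst c * f)"
  using homog_mult[OF homog_cst, of d f c] by simp

lemma homog_uminus: "homog d f \<Longrightarrow> homog d (- f)"
  by (auto simp: homog_def poly_uminus fun_apply)

lemma homog_diff: "homog d f \<Longrightarrow> homog d g \<Longrightarrow> homog d (f - g)"
  using homog_add[of d f "- g"] homog_uminus[of d g] by simp

lemma homog_sum: "(\<And>i. i \<in> A \<Longrightarrow> homog d (f i)) \<Longrightarrow> homog d (\<Sum>i\<in>A. f i)"
  by (induction A rule: infinite_finite_induct) (simp_all add: homog_add)

lemma homog_power: "homog d f \<Longrightarrow> homog (int n * d) (f ^ n)"
proof (induction n)
  case 0
  show ?case using homog_cst[of 1] by simp
next
  case (Suc n)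
  then show ?case using homog_mult[of d f "int n * d" "f ^ n"] by (simp add: distrib_right)
qed

lemma homog_linear: "f \<in> dual sc \<Longrightarrow> homog 1 f"
  by (simp add: homog_def poly_funs.linear dual_scale)

lemma homog_prod_linear: "A \<subseteq> dual sc \<Longrightarrow> finite A \<Longrightarrow> homog (int (card A)) (\<Prod>A)"
proof (induction A rule: infinite_finite_induct)
  case (insert x F)
  then show ?case using homog_mult[OF homog_linear[of x], of "int (card F)" "\<Prod>F"] by simp
qed (use homog_cst[of 1] in auto)

lemma homog_0_cst: assumes "homog 0 f" shows "f = cst (f 0)"
proof
  fix h
  \<comment> \<open>Scaling by 0 in degree 0 gives the factor \<open>0 ^ 0 = 1\<close>.\<close>
  from assms have "f (sc 0 h) = f h" by (simp add: homog_def del: scale_zero_left)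
  then show "f h = cst (f 0) h" by (simp add: cst_apply)
qed

lemma homog_act:
  assumes "w \<in> G \<Phi>" "homog d f" shows "homog d (act w f)"
proof -
  from inv_G_G[OF assms(1) order_refl assms(1)] obtain as
    where as: "set as \<subseteq> \<Phi>" "inv_into UNIV w = wd as" by (rule G_obtain)
  have "act w f (sc c h) = c ^ nat d * act w f h" if "d \<ge> 0" for c h
    using assms(2) that wd_linear(2)[OF as(1)] by (simp add: homog_def act_def as(2) comp_apply)
  with act_poly[OF assms(1) homog_poly[OF assms(2)]] assms(2) show ?thesis
    by (auto simp: homog_def act_zero)
qed

text \<open>This makes the quotient defining a Demazure operator homogeneous. Cancelling
  \<open>f\<close> from the scaling law of the product leaves a law for \<open>g\<close> with
  \<open>c ^ nat d\<close> on one side; it is divided out as a polynomial in \<open>c\<close>, so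
  that \<open>c = 0\<close> causes no trouble.\<close>

lemma homog_cancel:
  assumes f: "homog d f" "f \<noteq> 0" and g: "g \<in> R" and fg: "homog (d + e) (f * g)"
  shows "homog e g"
proof (cases "d + e < 0")
  case True
  then have "f * g = 0" using fg homog_neg by blast
  then have "g = 0" using poly_domain[OF homog_poly[OF f(1)] g] f(2) by blast
  then show ?thesis by simp
next
  case False
  have d: "d \<ge> 0" using f homog_neg by force
  define k where "k = nat (d + e)"
  have key: "c ^ nat d * g (sc c h) = c ^ k * g h" for c h
  proof -
    let ?g1 = "cst (c ^ nat d) * (g \<circ> sc c)" and ?g2 = "cst (c ^ k) * g"
    have p: "?g1 \<in> R" "?g2 \<in> R"
      using comp_linear_poly[OF g, of "sc c"] g
      by (auto intro!: poly_funs.mult simp: scale_right_distrib scale_left_commute)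
    have "f * ?g1 = f * ?g2"
    proof
      fix h
      have "(f * ?g1) h = (c ^ nat d * f h) * g (sc c h)" by (simp add: fun_apply cst_apply comp_apply)
      also have "\<dots> = (f * g) (sc c h)" using f(1) d by (simp add: homog_def fun_apply)
      also have "\<dots> = c ^ k * (f * g) h" using fg False by (simp add: homog_def k_def)
      also have "\<dots> = (f * ?g2) h" by (simp add: fun_apply cst_apply)
      finally show "(f * ?g1) h = (f * ?g2) h" .
    qed
    then have "?g1 = ?g2" using poly_cancel[OF homog_poly[OF f(1)] p _ f(2)] by blast
    from fun_cong[OF this, of h] show ?thesis by (simp add: fun_apply cst_apply comp_apply)
  qed
  \<comment> \<open>On the line through \<open>h\<close> the scaling law becomes an identity of
    univariate polynomials, in which powers of the variable can be cancelled.\<close>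
  have line: "\<exists>p. (\<forall>t. g (sc t h) = poly p t) \<and>
      monom 1 (nat d) * p = monom (poly p 1) k" for h
  proof -
    obtain p where p: "\<And>t. g (sc t h) = poly p t" using poly_on_line[OF g, of 0 h] by auto
    have "poly (monom 1 (nat d) * p - monom (poly p 1) k) t = 0" for t
      using key[of t h] p[of t] p[of 1] by (simp add: poly_monom)
    then have "monom 1 (nat d) * p - monom (poly p 1) k = 0" using poly_all_0_iff_0 by blast
    with p show ?thesis by auto
  qed
  show ?thesis
  proof (cases "e \<ge> 0")
    case True
    have "g (sc c h) = c ^ nat e * g h" for c h
    proof -
      obtain p where p: "\<And>t. g (sc t h) = poly p t" "monom 1 (nat d) * p = monom (poly p 1) k"
        using line by blast
      have "k = nat d + nat e" using True d by (simp add: k_def nat_add_distrib)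
      then have "monom 1 (nat d) * p = monom 1 (nat d) * monom (poly p 1) (nat e)"
        using p(2) by (simp add: mult_monom)
      then have "p = monom (poly p 1) (nat e)" by (simp add: monom_eq_0_iff)
      then have "poly p c = poly (monom (poly p 1) (nat e)) c" by simp
      then show ?thesis using p(1)[of c] p(1)[of 1] by (simp add: poly_monom)
    qed
    with True g show ?thesis by (simp add: homog_def)
  next
    case e: False
    have "g h = 0" for h
    proof -
      obtain p where p: "\<And>t. g (sc t h) = poly p t" "monom 1 (nat d) * p = monom (poly p 1) k"
        using line by blast
      have "k < nat d" using e d False by (simp add: k_def)
      then obtain j where j: "nat d = k + Suc j" by (metis add_Suc_right less_imp_Suc_add)
      \<comment> \<open>Here the factor on the left has the larger exponent: after cancelling,
        evaluation at 0 shows that the value at \<open>h\<close> is zero.\<close>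
      have "monom 1 k * (monom 1 (Suc j) * p) = monom 1 k * [:poly p 1:]"
        using p(2) by (simp add: j mult_monom flip: mult.assoc monom_0)
      then have "monom 1 (Suc j) * p = [:poly p 1:]"
        by (metis mult_left_cancel monom_eq_0_iff one_neq_zero)
      then have "poly (monom 1 (Suc j) * p) 0 = poly [:poly p 1:] 0" by simp
      then have "poly p 1 = 0" by (simp add: poly_monom)
      then show "g h = 0" using p(1)[of 1] by simp
    qed
    then have "g = 0" by (auto simp: fun_apply)
    then show ?thesis by simp
  qed
qed

lemma homog_dem:
  assumes "\<alpha> \<in> \<Phi>" "homog d f" shows "homog (d - 1) (dem \<alpha> f)"
proof (rule homog_cancel[of 1 \<alpha>])
  show "homog 1 \<alpha>" using assms(1) by (simp add: homog_linear root_dual)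
  show "\<alpha> \<noteq> 0" using assms(1) by (rule root_nonzero)
  show "dem \<alpha> f \<in> R" using assms by (simp add: dem_poly homog_poly)
  show "homog (1 + (d - 1)) (\<alpha> * dem \<alpha> f)"
    using assms by (simp add: dem_eq homog_poly homog_diff homog_act G_refl)
qed

lemma homog_Dw: "set as \<subseteq> \<Phi> \<Longrightarrow> homog d f \<Longrightarrow> homog (d - int (length as)) (Dw as f)"
proof (induction as)
  case (Cons a as)
  then show ?case using homog_dem[of a "d - int (length as)" "Dw as f"] by (simp add: algebra_simps)
qed simp

text \<open>Summing over all coroots makes this bilinear form invariant under reflections, which
  permute the coroots. Integrality gives it positive integral values on pairs of equal
  roots.\<close>

definition form :: "('h \<Rightarrow> complex) \<Rightarrow> ('h \<Rightarrow> complex) \<Rightarrow> complex" where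
  "form x y = (\<Sum>\<delta>\<in>\<Phi>. x (cr \<delta>) * y (cr \<delta>))"

lemma form_refl:
  assumes "\<gamma> \<in> \<Phi>" shows "form (act (s \<gamma>) x) (act (s \<gamma>) y) = form x y"
proof -
  have "form (act (s \<gamma>) x) (act (s \<gamma>) y) = (\<Sum>\<delta>\<in>\<Phi>. x (cr (act (s \<gamma>) \<delta>)) * y (cr (act (s \<gamma>) \<delta>)))"
    unfolding form_def
  proof (rule sum.cong[OF HOL.refl])
    fix \<delta> assume "\<delta> \<in> \<Phi>"
    show "act (s \<gamma>) x (cr \<delta>) * act (s \<gamma>) y (cr \<delta>) = x (cr (act (s \<gamma>) \<delta>)) * y (cr (act (s \<gamma>) \<delta>))"
      unfolding coroot_refl[OF \<open>\<delta> \<in> \<Phi>\<close> assms] using assms by (simp add: act_refl comp_apply)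
  qed
  also have "\<dots> = form x y"
    unfolding form_def
    by (rule sum.reindex_bij_witness[of _ "act (s \<gamma>)" "act (s \<gamma>)"])
      (use assms act_refl_root in simp_all)
  finally show ?thesis .
qed

text \<open>Invariance under the reflection in \<gamma>, which negates \<gamma>. It expresses a
  coroot through the form, the usual two over the squared length.\<close>

lemma form_coroot:
  assumes "\<gamma> \<in> \<Phi>" "x \<in> dual sc"
  shows "2 * form x \<gamma> = x (cr \<gamma>) * form \<gamma> \<gamma>"
proof -
  have "form x \<gamma> = form (refl_dual cr \<gamma> x) (- \<gamma>)"
    using form_refl[OF assms(1), of x \<gamma>] assms by (simp add: act_refl_self dual_refl)
  also have "\<dots> = x (cr \<gamma>) * form \<gamma> \<gamma> - form x \<gamma>"
    by (simp add: form_def refl_dual_def fun_apply algebra_simps sum_subtractf sum_distrib_left sum_negf)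
  finally show ?thesis by simp
qed

text \<open>All summands are squares of integers, and the coroot of \<gamma> itself contributes
  4.\<close>

lemma form_pos:
  assumes "\<gamma> \<in> \<Phi>" shows "\<exists>K>0. form \<gamma> \<gamma> = of_int K"
proof -
  have "\<exists>k. \<forall>\<delta>\<in>\<Phi>. \<gamma> (cr \<delta>) = of_int (k \<delta>)"
    using integral[OF _ assms] by (intro bchoice) (auto elim: Ints_cases)
  then obtain k where k: "\<And>\<delta>. \<delta> \<in> \<Phi> \<Longrightarrow> \<gamma> (cr \<delta>) = of_int (k \<delta>)" by blast
  have "form \<gamma> \<gamma> = of_int (\<Sum>\<delta>\<in>\<Phi>. k \<delta> * k \<delta>)" unfolding form_def by (simp add: k)
  moreover have "k \<gamma> = 2"
    using k[OF assms] root_coroot[OF assms] by (metis of_int_eq_iff of_int_numeral)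
  then have "0 < (\<Sum>\<delta>\<in>\<Phi>. k \<delta> * k \<delta>)"
    using finite_roots assms by (intro sum_pos2[of _ \<gamma>]) auto
  ultimately show ?thesis by blast
qed

end

section \<open>Non-vanishing of the top Demazure operator\<close>

context root_basis
begin

text \<open>This is the sum of the positive roots, twice the customary half sum, hence the value 2
  on simple coroots.\<close>

definition rho :: "'h \<Rightarrow> complex" where "rho = \<Sum>P"

lemma rho_dual: "rho \<in> dual sc"
proof -
  have "fs.subspace (dual sc)" using span_roots fs.subspace_span by metis
  then show ?thesis unfolding rho_def by (rule fs.subspace_sum) (simp add: root_dual pos_root)
qed

text \<open>A simple reflection permutes the other positive roots and negates \<alpha>, so it
  subtracts twice \<alpha> from \<open>rho\<close>.\<close>

lemma rho_simple:
  assumes "\<alpha> \<in> simples" shows "rho (cr \<alpha>) = 2"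
proof -
  have a: "\<alpha> \<in> P" "\<alpha> \<in> \<Phi>" using assms simple_pos simple_root by auto
  have perm: "act (s \<alpha>) \<gamma> \<in> P - {\<alpha>}" if "\<gamma> \<in> P - {\<alpha>}" for \<gamma>
  proof -
    have "act (s \<alpha>) \<gamma> \<noteq> \<alpha>"
    proof
      assume "act (s \<alpha>) \<gamma> = \<alpha>"
      then have "\<gamma> = - \<alpha>" using a act_refl_self act_refl_invol by metis
      then show False using that a neg_not_pos by auto
    qed
    then show ?thesis using that assms simple_perm by auto
  qed
  have "rho = \<alpha> + \<Sum>(P - {\<alpha>})" unfolding rho_def using finite_pos a(1) by (rule sum.remove)
  then have "act (s \<alpha>) rho = - \<alpha> + (\<Sum>\<gamma>\<in>P - {\<alpha>}. act (s \<alpha>) \<gamma>)"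
    using a by (simp add: act_add act_sum act_refl_self)
  also have "(\<Sum>\<gamma>\<in>P - {\<alpha>}. act (s \<alpha>) \<gamma>) = \<Sum>(P - {\<alpha>})"
    by (rule sum.reindex_bij_witness[of _ "act (s \<alpha>)" "act (s \<alpha>)"])
      (use perm a in \<open>simp_all only: act_refl_invol\<close>)
  also have "\<dots> = rho - \<alpha>" using \<open>rho = _\<close> by simp
  finally have "act (s \<alpha>) rho (cr \<alpha>) = (- \<alpha> + (rho - \<alpha>)) (cr \<alpha>)" by simp
  then show ?thesis
    using a by (simp add: dual_refl rho_dual refl_dual_def root_coroot fun_apply)
qed

text \<open>Pairing \<open>rho\<close> with a simple root under \<open>form\<close> gives a positive
  integer, and \<gamma> is a nonzero natural combination of simple roots; \<open>form_coroot\<close>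
  converts the pairing into the value on the coroot.\<close>

lemma rho_pos:
  assumes "\<gamma> \<in> P" shows "\<exists>r>0. rho (cr \<gamma>) = complex_of_real r"
proof -
  obtain n :: "_ \<Rightarrow> nat" where n: "\<gamma> = (\<Sum>\<beta>\<in>simples. fscale (of_nat (n \<beta>)) \<beta>)"
    using assms pos_co by metis
  have "\<exists>k. \<forall>\<beta>\<in>\<Phi>. k \<beta> > 0 \<and> form \<beta> \<beta> = of_int (k \<beta>)"
    using form_pos by (intro bchoice) auto
  then obtain k where k: "\<And>\<beta>. \<beta> \<in> \<Phi> \<Longrightarrow> k \<beta> > 0" "\<And>\<beta>. \<beta> \<in> \<Phi> \<Longrightarrow> form \<beta> \<beta> = of_int (k \<beta>)" by blast
  have form_simple: "form rho \<beta> = of_int (k \<beta>)" if "\<beta> \<in> simples" for \<beta>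
    using form_coroot[OF simple_root[OF that] rho_dual] rho_simple[OF that] k(2)[OF simple_root[OF that]] by simp
  have "form rho \<gamma> = (\<Sum>\<beta>\<in>simples. of_nat (n \<beta>) * form rho \<beta>)"
  proof -
    have "\<gamma> h = (\<Sum>\<beta>\<in>simples. of_nat (n \<beta>) * \<beta> h)" for h
      by (subst n) (simp add: sum_fun_apply fscale_apply)
    then have "form rho \<gamma> = (\<Sum>\<delta>\<in>\<Phi>. \<Sum>\<beta>\<in>simples. of_nat (n \<beta>) * (rho (cr \<delta>) * \<beta> (cr \<delta>)))"
      by (simp add: form_def sum_distrib_left algebra_simps)
    also have "\<dots> = (\<Sum>\<beta>\<in>simples. \<Sum>\<delta>\<in>\<Phi>. of_nat (n \<beta>) * (rho (cr \<delta>) * \<beta> (cr \<delta>)))"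
      by (rule sum.swap)
    finally show ?thesis by (simp add: form_def sum_distrib_left)
  qed
  also have "\<dots> = of_int (\<Sum>\<beta>\<in>simples. int (n \<beta>) * k \<beta>)" by (simp add: form_simple)
  finally have fm: "form rho \<gamma> = of_int (\<Sum>\<beta>\<in>simples. int (n \<beta>) * k \<beta>)" .
  have "\<exists>\<beta>\<in>simples. n \<beta> \<noteq> 0"
  proof (rule ccontr)
    assume "\<not> ?thesis"
    then have "(\<Sum>\<beta>\<in>simples. fscale (of_nat (n \<beta>)) \<beta>) = 0"
      by (intro sum.neutral) simp
    then show False using n assms pos_root root_nonzero by metis
  qed
  then obtain \<beta> where b: "\<beta> \<in> simples" "n \<beta> \<noteq> 0" by blast
  have M: "0 < (\<Sum>\<beta>\<in>simples. int (n \<beta>) * k \<beta>)"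
    using finite_simples b k(1)[OF simple_root]
    by (intro sum_pos2[of _ \<beta>]) (auto simp: order.strict_implies_order)
  define M where "M = (\<Sum>\<beta>\<in>simples. int (n \<beta>) * k \<beta>)"
  have g: "\<gamma> \<in> \<Phi>" using assms by (rule pos_root)
  have "2 * of_int M = rho (cr \<gamma>) * of_int (k \<gamma>)"
    using form_coroot[OF g rho_dual] fm k(2)[OF g] by (simp add: M_def[symmetric])
  then have "rho (cr \<gamma>) = complex_of_real (2 * of_int M / of_int (k \<gamma>))"
    using k(1)[OF g] by (simp add: field_simps)
  moreover have "0 < (2 * of_int M / of_int (k \<gamma>) :: real)" using M k(1)[OF g] by (simp add: M_def[symmetric])
  ultimately show ?thesis by blast
qed

lemma homog_Demazure: "w \<in> G simples \<Longrightarrow> homog d f \<Longrightarrow> homog (d - int (len w)) (\<Delta> w f)"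
  by (erule demazure_elt_obtain) (metis homog_Dw set_simples_roots)

lemma ex_Inv_simple:
  assumes "w \<in> G simples" "len w = Suc k"
  shows "\<exists>\<alpha>\<in>simples \<inter> Inv w. len (w \<circ> s \<alpha>) = k"
proof -
  obtain as where as: "set as \<subseteq> simples" "wd as = w" "length as = len w"
    using demazure_elt_obtain[OF assms(1)] by metis
  then obtain bs a where ba: "as = bs @ [a]" using assms(2) by (cases as rule: rev_cases) auto
  have a: "a \<in> simples" "set bs \<subseteq> simples" "length bs = k" using as ba assms(2) by auto
  have e: "w \<circ> s a = wd bs"
    unfolding as(2)[symmetric] ba wd_snoc using a simple_root by (simp add: comp_refl_refl)
  then have "len (w \<circ> s a) \<le> k" using length_le[OF a(2)] a(3) by simp
  then have "a \<in> Inv w" using length_up[OF assms(1) a(1)] assms(2) by auto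
  with length_down[OF assms(1) a(1)] a(1) assms(2) show ?thesis by auto
qed

text \<open>By the Leibniz rule \<open>\<Delta>\<^sub>w (\<rho>\<^sup>k)\<close> is a sum over chains in the Bruhat order with positive coefficients.\<close>

lemma \<Delta>_rho_pos:
  "w \<in> G simples \<Longrightarrow> \<exists>r>0. \<Delta> w (rho ^ len w) = cst (complex_of_real r)"
proof (induction "len w" arbitrary: w)
  case 0
  then have "w = id" using length_0 by metis
  then show ?case by (intro exI[of _ 1]) (simp add: \<Delta>_id)
next
  case (Suc k)
  have w: "w \<in> G simples" by fact
  have rp: "rho ^ k \<in> R" using poly_power poly_funs.linear rho_dual by blast
  have "homog (int k - int (len w)) (\<Delta> w (rho ^ k))"
    using homog_Demazure[OF w homog_power[OF homog_linear[OF rho_dual], of k]] by simp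
  \<comment> \<open>The exponent is one less than the length, so this image would have degree -1.
    Only the sum in Chevalley's formula survives.\<close>
  then have z: "\<Delta> w (rho ^ k) = 0" using Suc(2) homog_neg by force
  have "\<exists>r\<ge>0. (\<lambda>_. rho (cr \<gamma>)) * \<Gamma> k (w \<circ> s \<gamma>) (rho ^ k) = cst (complex_of_real r) \<and> (len (w \<circ> s \<gamma>) = k \<longrightarrow> r > 0)"
    if g: "\<gamma> \<in> Inv w" for \<gamma>
  proof (cases "len (w \<circ> s \<gamma>) = k")
    case True
    obtain r where r: "r > 0" "\<Delta> (w \<circ> s \<gamma>) (rho ^ k) = cst (complex_of_real r)"
      using Suc(1)[OF True[symmetric] length_refl_lt(1)[OF w g]] True by auto
    obtain r' where r': "r' > 0" "rho (cr \<gamma>) = complex_of_real r'"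
      using rho_pos[of \<gamma>] g by (auto simp: Inv_def)
    show ?thesis using r r' True
      by (intro exI[of _ "r' * r"]) (simp add: \<Gamma>_def cst_mult flip: cst_def)
  qed (auto simp: \<Gamma>_def intro!: exI[of _ 0])
  then obtain r where r: "\<And>\<gamma>. \<gamma> \<in> Inv w \<Longrightarrow> r \<gamma> \<ge> 0"
    "\<And>\<gamma>. \<gamma> \<in> Inv w \<Longrightarrow> (\<lambda>_. rho (cr \<gamma>)) * \<Gamma> k (w \<circ> s \<gamma>) (rho ^ k) = cst (complex_of_real (r \<gamma>))"
    "\<And>\<gamma>. \<gamma> \<in> Inv w \<Longrightarrow> len (w \<circ> s \<gamma>) = k \<Longrightarrow> r \<gamma> > 0"
    by metis
  \<comment> \<open>A last letter of a reduced word supplies one strictly positive summand; the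
    others are only known to be nonnegative.\<close>
  obtain \<alpha> where a: "\<alpha> \<in> Inv w" "len (w \<circ> s \<alpha>) = k" using ex_Inv_simple[OF w Suc(2)[symmetric]] by blast
  have "\<Delta> w (rho * rho ^ k) = act w rho * \<Delta> w (rho ^ k) +
      (\<Sum>\<gamma>\<in>Inv w. (\<lambda>_. rho (cr \<gamma>)) * \<Gamma> (len w - 1) (w \<circ> s \<gamma>) (rho ^ k))"
    using w rp rho_dual by (rule \<Delta>_leibniz)
  also have "\<dots> = (\<Sum>\<gamma>\<in>Inv w. (\<lambda>_. rho (cr \<gamma>)) * \<Gamma> k (w \<circ> s \<gamma>) (rho ^ k))"
    unfolding z Suc(2)[symmetric] by simp
  also have "\<dots> = (\<Sum>\<gamma>\<in>Inv w. cst (complex_of_real (r \<gamma>)))"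
    using r(2) by (rule sum.cong[OF HOL.refl])
  also have "\<dots> = cst (complex_of_real (\<Sum>\<gamma>\<in>Inv w. r \<gamma>))" by (simp add: cst_sum)
  finally have "\<Delta> w (rho ^ len w) = cst (complex_of_real (\<Sum>\<gamma>\<in>Inv w. r \<gamma>))"
    unfolding Suc(2)[symmetric] power_Suc .
  moreover have "0 < (\<Sum>\<gamma>\<in>Inv w. r \<gamma>)"
    using finite_Inv a(1) r(3)[OF a] r(1) by (intro sum_pos2[of _ \<alpha>]) auto
  ultimately show ?case by blast
qed

end

lemma cst_uminus: "cst (- c) = - cst c"
  by (simp add: cst_def fun_eq_iff fun_apply)

context root_system
begin

lemma root_add: "\<gamma> \<in> \<Phi> \<Longrightarrow> \<gamma> (h + k) = \<gamma> h + \<gamma> k"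
  and root_diff: "\<gamma> \<in> \<Phi> \<Longrightarrow> \<gamma> (h - k) = \<gamma> h - \<gamma> k"
  and root_scale: "\<gamma> \<in> \<Phi> \<Longrightarrow> \<gamma> (sc c h) = c * \<gamma> h"
  using dual_add[OF root_dual] dual_diff[OF root_dual] dual_scale[OF root_dual] by blast+

lemma cst_invariant [simp]: "act w (cst c) = cst c"
  unfolding cst_def by (rule act_const)

text \<open>A line joining two points of the kernel of \<gamma> stays in it, so a factor that is
  nonzero somewhere on the hyperplane can be cancelled there.\<close>

lemma vanish_on_kernel_cancel:
  assumes g: "\<gamma> \<in> \<Phi>" and p: "p \<in> R" "p k \<noteq> 0" "\<gamma> k = 0" and f: "f \<in> R"
    and z: "\<And>h. \<gamma> h = 0 \<Longrightarrow> (p * f) h = 0" and h: "\<gamma> h = 0"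
  shows "f h = 0"
proof -
  have "f (h + sc 0 (k - h)) = 0"
  proof (rule poly_line_cancel[OF p(1) f, of h "k - h" 1])
    fix t
    have "\<gamma> (h + sc t (k - h)) = 0"
      using p(3) h by (simp add: root_add root_scale root_diff g)
    then show "p (h + sc t (k - h)) * f (h + sc t (k - h)) = 0"
      using z by (simp add: fun_apply)
  qed (use p(2) in simp)
  then show ?thesis by simp
qed

text \<open>With \<open>c = 1/2\<close> the substitution in \<open>divided_difference\<close>
  projects onto the kernel of \<gamma>. The subtracted term vanishes and \<open>f\<close> itself is
  the multiple of \<gamma>.\<close>

lemma vanish_on_kernel_dvd:
  assumes g: "\<gamma> \<in> \<Phi>" and f: "f \<in> R" and z: "\<And>h. \<gamma> h = 0 \<Longrightarrow> f h = 0"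
  shows "\<exists>g\<in>R. f = \<gamma> * g"
proof -
  obtain q where q: "q \<in> R" "f - (f \<circ> (\<lambda>h. h - sc (1 / 2 * \<gamma> h) (cr \<gamma>))) = \<gamma> * q"
    using divided_difference[OF g f, of "1/2"] by blast
  have "f \<circ> (\<lambda>h. h - sc (1 / 2 * \<gamma> h) (cr \<gamma>)) = 0"
  proof
    fix h
    have "\<gamma> (h - sc (1 / 2 * \<gamma> h) (cr \<gamma>)) = 0"
      using g by (simp add: root_diff root_scale root_coroot)
    then show "(f \<circ> (\<lambda>h. h - sc (1 / 2 * \<gamma> h) (cr \<gamma>))) h = 0 h"
      using z by (simp add: comp_apply fun_apply)
  qed
  with q show ?thesis by auto
qed

end

section \<open>The top Demazure operator of a parabolic subgroup\<close>

context parabolic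
begin

abbreviation "N \<equiv> len w0"
abbreviation "D \<equiv> \<Delta> w0"
abbreviation "\<mu> \<equiv> mu cr \<Phi> simples J"

definition RJ :: "('h \<Rightarrow> complex) set" where
  "RJ = {f \<in> R. \<forall>w\<in>G J. act w f = f}"

lemma J_simple: "\<alpha> \<in> J \<Longrightarrow> \<alpha> \<in> simples" and J_root: "\<alpha> \<in> J \<Longrightarrow> \<alpha> \<in> \<Phi>"
  using J simples_roots by auto

lemma w0_GS: "w0 \<in> G simples"
  using w0_mem GJ_GS by blast

lemma RJ_poly: "f \<in> RJ \<Longrightarrow> f \<in> R"
  by (simp add: RJ_def)

lemma RJ_act: "f \<in> RJ \<Longrightarrow> w \<in> G J \<Longrightarrow> act w f = f"
  by (simp add: RJ_def)

lemma RJI: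
  assumes "f \<in> R" "\<And>\<alpha>. \<alpha> \<in> J \<Longrightarrow> act (s \<alpha>) f = f"
  shows "f \<in> RJ"
proof -
  have "act (wd as) f = f" if "set as \<subseteq> J" for as
    using that
  proof (induction as)
    case (Cons a as)
    then have "set (a # as) \<subseteq> \<Phi>" using J simples_roots by blast
    then show ?case using Cons assms(2) by (simp add: act_wd_Cons)
  qed simp
  then show ?thesis using assms(1) by (auto simp: RJ_def elim!: G_obtain)
qed

lemma RJ_mult: "f \<in> RJ \<Longrightarrow> g \<in> RJ \<Longrightarrow> f * g \<in> RJ"
  and RJ_add: "f \<in> RJ \<Longrightarrow> g \<in> RJ \<Longrightarrow> f + g \<in> RJ"
  and RJ_diff: "f \<in> RJ \<Longrightarrow> g \<in> RJ \<Longrightarrow> f - g \<in> RJ"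
  and RJ_cst [simp]: "cst c \<in> RJ"
  by (auto simp: RJ_def act_mult act_add act_diff poly_funs.mult poly_funs.add poly_diff)

lemma RJ_0 [simp]: "0 \<in> RJ" and RJ_1 [simp]: "1 \<in> RJ"
  using RJ_cst[of 0] RJ_cst[of 1] by simp_all

lemma Demazure_J_obtain:
  assumes "w \<in> G J"
  obtains as where "set as \<subseteq> J" "wd as = w" "length as = len w" "\<And>f. f \<in> R \<Longrightarrow> \<Delta> w f = Dw as f"
proof -
  obtain as where as: "set as \<subseteq> J" "wd as = w" "length as = len w"
    using reduced_exists[OF J assms] length_eq[OF GJ_GS[OF assms]] by metis
  moreover have "\<Delta> w f = Dw as f" if "f \<in> R" for f
    using Dw_eq[of as f] as that J by auto
  ultimately show ?thesis using that by blast
qed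

lemma set_J_roots: "set as \<subseteq> J \<Longrightarrow> set as \<subseteq> \<Phi>"
  using J simples_roots by blast

lemma Demazure_RJ_mult:
  assumes "w \<in> G J" "g \<in> RJ" "f \<in> R"
  shows "\<Delta> w (g * f) = g * \<Delta> w f"
proof -
  obtain as where as: "set as \<subseteq> J" "wd as = w" "length as = len w" "\<And>f. f \<in> R \<Longrightarrow> \<Delta> w f = Dw as f"
    using Demazure_J_obtain[OF assms(1)] by blast
  have "Dw as (g * f) = g * Dw as f"
    using as(1) assms(2,3) J_root
    by (intro Dw_invariant_mult) (auto simp: RJ_poly RJ_act G_refl)
  then show ?thesis using as(4) assms by (simp add: poly_funs.mult RJ_poly)
qed

lemma Demazure_uminus: "w \<in> G simples \<Longrightarrow> f \<in> R \<Longrightarrow> \<Delta> w (- f) = - \<Delta> w f"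
  using \<Delta>_add[of w f "- f"] by (simp add: poly_uminus \<Delta>_0 eq_neg_iff_add_eq_0 add.commute)

lemma Demazure_diff: "w \<in> G simples \<Longrightarrow> f \<in> R \<Longrightarrow> g \<in> R \<Longrightarrow> \<Delta> w (f - g) = \<Delta> w f - \<Delta> w g"
  using \<Delta>_add[of w f "- g"] by (simp add: poly_uminus Demazure_uminus)

lemma Demazure_sum:
  assumes "w \<in> G simples" "\<And>i. i \<in> A \<Longrightarrow> f i \<in> R"
  shows "\<Delta> w (\<Sum>i\<in>A. f i) = (\<Sum>i\<in>A. \<Delta> w (f i))"
  using assms(2)
proof (induction A rule: infinite_finite_induct)
  case (insert x F)
  then show ?case using assms(1) by (simp add: \<Delta>_add poly_sum)
qed (simp_all add: \<Delta>_0 assms(1))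

text \<open>Composing with the operator of a simple reflection gives zero: if the length goes up by
  the assumption, otherwise by \<open>\<Delta>_comp\<close>. Being killed by that operator means
  being fixed by the reflection.\<close>

lemma Demazure_invariantI:
  assumes w: "w \<in> G J" and f: "f \<in> R"
    and z: "\<And>v. v \<in> G J \<Longrightarrow> len v = Suc (len w) \<Longrightarrow> \<Delta> v f = 0"
  shows "\<Delta> w f \<in> RJ"
proof (rule RJI)
  show p: "\<Delta> w f \<in> R" using w f by (simp add: \<Delta>_poly GJ_GS)
  fix \<alpha> assume a: "\<alpha> \<in> J"
  have "len (s \<alpha>) = 1"
    using length_up[OF G_id J_simple[OF a]] by (simp add: Inv_id)
  moreover have "s \<alpha> \<circ> w \<in> G J" using a w by (simp add: G_comp G_refl)
  ultimately have "\<Delta> (s \<alpha>) (\<Delta> w f) = 0"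
    using \<Delta>_comp[of "s \<alpha>" w f] a w f z[of "s \<alpha> \<circ> w"] by (auto simp: G_refl J_simple GJ_GS)
  then show "act (s \<alpha>) (\<Delta> w f) = \<Delta> w f"
    using \<Delta>_refl[OF J_simple[OF a] p] dem_zero_iff[OF J_root[OF a] p] by simp
qed

lemma D_RJ: "f \<in> R \<Longrightarrow> D f \<in> RJ"
  using len_le_w0 by (intro Demazure_invariantI w0_mem) force+

text \<open>Every \<alpha> in \<open>J\<close> is an inversion of \<open>w0\<close>, so
  \<open>w0\<close> has a reduced word ending in \<alpha>.\<close>

lemma D_dem:
  assumes "\<alpha> \<in> J" shows "\<exists>v\<in>G simples. \<forall>f\<in>R. D f = \<Delta> v (dem \<alpha> f)"
proof -
  have a: "\<alpha> \<in> simples" "\<alpha> \<in> Inv w0"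
    using assms J_simple simple_pos sub_roots.base by (auto simp: Inv_w0)
  have l: "len w0 = Suc (len (w0 \<circ> s \<alpha>))" using length_down[OF w0_GS a] .
  have v: "w0 \<circ> s \<alpha> \<in> G simples" using a w0_GS by (simp add: GS_comp_refl)
  have "len (s \<alpha>) = 1" using length_up[OF G_id a(1)] by (simp add: Inv_id)
  then have "D f = \<Delta> (w0 \<circ> s \<alpha>) (dem \<alpha> f)" if "f \<in> R" for f
    using \<Delta>_comp[OF v G_refl[OF a(1)] that] l a that by (simp add: \<Delta>_refl comp_refl_refl simple_root)
  with v show ?thesis by blast
qed

lemma D_act_refl:
  assumes "\<alpha> \<in> J" "f \<in> R" shows "D (act (s \<alpha>) f) = - D f"
proof -
  obtain v where v: "v \<in> G simples" "\<And>f. f \<in> R \<Longrightarrow> D f = \<Delta> v (dem \<alpha> f)" using D_dem[OF assms(1)] by blast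
  show ?thesis
    using assms J_root v by (simp add: act_refl_poly dem_act Demazure_uminus dem_poly)
qed

text \<open>As \<open>D\<close> factors through \<open>dem \<alpha>\<close>, it suffices to apply
  \<open>dem \<alpha>\<close> to both products; each becomes
  \<open>dem \<alpha> f * dem \<alpha> g\<close>, because images of \<open>dem \<alpha>\<close> are
  fixed by the reflection.\<close>

lemma D_adjoint_dem:
  assumes a: "\<alpha> \<in> J" and fg: "f \<in> R" "g \<in> R"
  shows "D (dem \<alpha> f * g) = D (f * dem \<alpha> g)"
proof -
  obtain v where v: "v \<in> G simples" "\<And>f. f \<in> R \<Longrightarrow> D f = \<Delta> v (dem \<alpha> f)" using D_dem[OF a] by blast
  have r: "\<alpha> \<in> \<Phi>" using a by (rule J_root)
  have p: "dem \<alpha> f \<in> R" "dem \<alpha> g \<in> R" using fg r by (simp_all add: dem_poly)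
  have "dem \<alpha> (dem \<alpha> f * g) = dem \<alpha> f * dem \<alpha> g"
    using dem_invariant_mult[OF r p(1) fg(2) act_dem[OF r fg(1)]] .
  moreover have "dem \<alpha> (f * dem \<alpha> g) = dem \<alpha> f * dem \<alpha> g"
    using dem_invariant_mult[OF r p(2) fg(1) act_dem[OF r fg(2)]] by (simp add: mult.commute)
  ultimately show ?thesis using v p fg by (simp add: poly_funs.mult)
qed

text \<open>The letters move across one at a time and arrive in reverse order, which is a reduced
  word for the inverse.\<close>

lemma D_adjoint:
  assumes w: "w \<in> G J" and fg: "f \<in> R" "g \<in> R"
  shows "D (\<Delta> w f * g) = D (f * \<Delta> (inv_into UNIV w) g)"
proof -
  obtain as where as: "set as \<subseteq> J" "wd as = w" "length as = len w" "\<And>f. f \<in> R \<Longrightarrow> \<Delta> w f = Dw as f"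
    using Demazure_J_obtain[OF w] by blast
  have "D (Dw as f * g) = D (f * Dw (rev as) g)" using as(1) fg(2)
  proof (induction as arbitrary: g)
    case (Cons a as)
    then have "D (Dw (a # as) f * g) = D (Dw as f * dem a g)"
      using fg(1) set_J_roots[of as] by (simp add: D_adjoint_dem Dw_poly)
    with Cons show ?case by (simp add: Dw_append dem_poly J_root)
  qed simp
  moreover have "\<Delta> (inv_into UNIV w) g = Dw (rev as) g"
  proof -
    have i: "inv_into UNIV w = wd (rev as)" using inv_wd[OF set_J_roots[OF as(1)]] as(2) by simp
    have "len (wd (rev as)) = length (rev as)" using length_inv[OF GJ_GS[OF w]] as(3) i by simp
    then show ?thesis using Dw_eq[of "rev as" g] as(1) J fg(2) unfolding i by auto
  qed
  ultimately show ?thesis using as(4) fg(1) by simp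
qed

section \<open>Signs, antisymmetrization and divisibility by the product of roots\<close>

abbreviation eps :: "('h \<Rightarrow> 'h) \<Rightarrow> complex" where "eps w \<equiv> (- 1) ^ len w"

lemma eps_comp_refl:
  assumes "w \<in> G simples" "\<alpha> \<in> simples" shows "eps (w \<circ> s \<alpha>) = - eps w"
  using length_up[OF assms] length_down[OF assms] by (cases "\<alpha> \<in> Inv w") auto

lemma eps_wd: "set as \<subseteq> simples \<Longrightarrow> eps (wd as) = (- 1) ^ length as"
proof (induction as rule: rev_induct)
  case (snoc a as)
  then show ?case using eps_comp_refl[OF G_wd, of as a] by (simp add: wd_snoc)
qed simp

lemma eps_refl_comp:
  assumes "w \<in> G simples" "\<alpha> \<in> simples" shows "eps (s \<alpha> \<circ> w) = - eps w"
proof -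
  obtain as where "set as \<subseteq> simples" "w = wd as" using assms by (auto elim: G_obtain)
  then show ?thesis using eps_wd[of as] eps_wd[of "\<alpha> # as"] assms by (simp add: wd_Cons)
qed

lemma D_act:
  assumes "w \<in> G J" "f \<in> R" shows "D (act w f) = cst (eps w) * D f"
proof -
  obtain as where as: "set as \<subseteq> J" "w = wd as" using assms by (auto elim: G_obtain)
  have "D (act (wd as) f) = cst ((- 1) ^ length as) * D f" using as(1)
  proof (induction as)
    case (Cons a as)
    then have p: "act (wd as) f \<in> R" and "set (a # as) \<subseteq> \<Phi>"
      using assms(2) set_J_roots[of "a # as"] act_poly[OF G_wd] by auto
    then have "D (act (wd (a # as)) f) = - (cst ((- 1) ^ length as) * D f)"
      using Cons D_act_refl[of a "act (wd as) f"] by (simp add: act_wd_Cons)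
    also have "\<dots> = cst ((- 1) ^ length (a # as)) * D f"
      by (simp add: cst_uminus)
    finally show ?case .
  qed simp
  then show ?thesis using as J eps_wd[of as] by simp
qed

definition anti :: "('h \<Rightarrow> complex) \<Rightarrow> 'h \<Rightarrow> complex" where
  "anti f = (\<Sum>w\<in>G J. cst (eps w) * act w f)"

lemma anti_poly: "f \<in> R \<Longrightarrow> anti f \<in> R"
  unfolding anti_def by (intro poly_sum poly_funs.mult cst_poly act_poly GJ)

text \<open>By \<open>D_act\<close> the operator turns each translate into a signed copy of
  \<open>D f\<close>, and the sign cancels the one in \<open>anti\<close>.\<close>

lemma D_anti:
  assumes "f \<in> R" shows "D (anti f) = cst (of_nat (card (G J))) * D f"
proof -
  have "D (cst (eps w) * act w f) = D f" if w: "w \<in> G J" for w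
  proof -
    have "D (cst (eps w) * act w f) = cst (eps w) * (cst (eps w) * D f)"
      using Demazure_RJ_mult[OF w0_mem RJ_cst act_poly[OF GJ[OF w] assms]] D_act[OF w assms] by simp
    also have "\<dots> = cst (eps w * eps w) * D f" by (simp only: cst_mult mult.assoc)
    finally show ?thesis by (simp flip: power_mult_distrib)
  qed
  moreover have "D (anti f) = (\<Sum>w\<in>G J. D (cst (eps w) * act w f))"
    unfolding anti_def
    by (intro Demazure_sum w0_GS poly_funs.mult cst_poly act_poly GJ assms)
  ultimately have "D (anti f) = (\<Sum>w\<in>G J. D f)" by simp
  also have "\<dots> = cst (of_nat (card (G J))) * D f"
    by (simp add: fun_eq_iff sum_fun_apply fun_apply cst_apply)
  finally show ?thesis .
qed

lemma act_refl_anti: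
  assumes "\<alpha> \<in> J" shows "act (s \<alpha>) (anti f) = - anti f"
proof -
  have a: "s \<alpha> \<in> G J" "\<alpha> \<in> \<Phi>" "\<alpha> \<in> simples" using assms by (auto simp: G_refl J_root J_simple)
  have "act (s \<alpha>) (anti f) = (\<Sum>w\<in>G J. cst (eps w) * act (s \<alpha> \<circ> w) f)"
    unfolding anti_def act_sum act_mult cst_invariant
    using a by (intro sum.cong) (simp_all add: act_G_comp GJ)
  also have "\<dots> = (\<Sum>w\<in>G J. - (cst (eps w) * act w f))"
  proof (rule sum.reindex_bij_witness[of _ "\<lambda>w. s \<alpha> \<circ> w" "\<lambda>w. s \<alpha> \<circ> w"])
    fix w assume w: "w \<in> G J"
    show "- (cst (eps (s \<alpha> \<circ> w)) * act (s \<alpha> \<circ> w) f) = cst (eps w) * act (s \<alpha> \<circ> w) f"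
      using eps_refl_comp[OF GJ_GS[OF w] a(3)] by (simp add: cst_uminus)
  qed (use a in \<open>auto simp: refl_refl_comp G_comp\<close>)
  also have "\<dots> = - anti f" by (simp add: anti_def sum_negf)
  finally show ?thesis .
qed

lemma act_anti: "w \<in> G J \<Longrightarrow> act w (anti f) = cst (eps w) * anti f"
proof -
  assume "w \<in> G J"
  then obtain as where as: "set as \<subseteq> J" "w = wd as" by (auto elim: G_obtain)
  have "act (wd as) (anti f) = cst ((- 1) ^ length as) * anti f" using as(1)
  proof (induction as)
    case (Cons a as)
    then have "act (wd (a # as)) (anti f) = cst ((- 1) ^ length as) * - anti f"
      using set_J_roots[of "a # as"] by (simp add: act_wd_Cons act_mult act_refl_anti)
    also have "\<dots> = cst ((- 1) ^ length (a # as)) * anti f"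
      by (simp add: cst_uminus)
    finally show ?case .
  qed simp
  then show ?thesis using as J eps_wd[of as] by simp
qed

text \<open>All of \<open>PJ\<close> are inversions of \<open>w0\<close>, and along a word for
  \<open>w0\<close> each inversion is either the last letter or a translate of an earlier inversion.
  It extends antisymmetry from simple reflections to all reflections in \<open>PJ\<close>.\<close>

lemma PJ_conj_simple:
  assumes "\<gamma> \<in> PJ" shows "\<exists>u\<in>G J. \<exists>\<alpha>\<in>J. \<gamma> = act u \<alpha>"
proof -
  obtain as where as: "set as \<subseteq> J" "w0 = wd as" using w0_mem by (auto elim: G_obtain)
  have "\<gamma> \<in> Inv (wd as) \<Longrightarrow> \<exists>u\<in>G J. \<exists>\<alpha>\<in>J. \<gamma> = act u \<alpha>" for \<gamma> using as(1)
  proof (induction as arbitrary: \<gamma> rule: rev_induct)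
    case Nil
    then show ?case using Inv_id by simp
  next
    case (snoc a as)
    have a: "a \<in> J" "wd as \<in> G \<Phi>" using snoc set_J_roots by (auto intro!: G_wd)
    have "\<gamma> \<in> insert a (act (s a) ` Inv (wd as))"
      using snoc(2) Inv_comp_refl_subset[OF a(2) J_simple[OF a(1)]] unfolding wd_snoc by blast
    then show ?case
    proof
      assume "\<gamma> = a"
      then show ?thesis using a(1) by (intro bexI[of _ id] bexI[of _ a]) auto
    next
      assume "\<gamma> \<in> act (s a) ` Inv (wd as)"
      then obtain \<delta> where d: "\<delta> \<in> Inv (wd as)" "\<gamma> = act (s a) \<delta>" by blast
      have "\<exists>u\<in>G J. \<exists>\<alpha>\<in>J. \<delta> = act u \<alpha>" using snoc.IH[of \<delta>] snoc.prems d(1) by simp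
      then obtain u \<alpha> where u: "u \<in> G J" "\<alpha> \<in> J" "\<gamma> = act (s a) (act u \<alpha>)" unfolding d(2) by blast
      then have "\<gamma> = act (s a \<circ> u) \<alpha>" using a by (simp add: act_G_comp GJ G_refl)
      then show ?thesis using u a by (intro bexI[of _ "s a \<circ> u"] bexI[of _ \<alpha>]) (auto simp: G_comp G_refl)
    qed
  qed
  then show ?thesis using assms Inv_w0 as(2) by simp
qed

lemma act_refl_root_anti:
  assumes "\<gamma> \<in> PJ" shows "act (s \<gamma>) (anti f) = - anti f"
proof -
  obtain u \<alpha> where u: "u \<in> G J" "\<alpha> \<in> J" "\<gamma> = act u \<alpha>" using PJ_conj_simple[OF assms] by blast
  have g: "s \<gamma> \<in> G \<Phi>" using assms by (simp add: G_refl pos_root)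
  have "s \<gamma> \<circ> u = u \<circ> s \<alpha>" unfolding u(3) by (rule refl_conj_G[OF GJ[OF u(1)] J_root[OF u(2)]])
  then have "act (s \<gamma>) (act u (anti f)) = act u (act (s \<alpha>) (anti f))"
    using g u J_root G_refl[of \<alpha> \<Phi>] by (metis act_G_comp GJ)
  then have "cst (eps u) * act (s \<gamma>) (anti f) = cst (eps u) * - anti f"
    using u by (simp add: act_anti act_mult act_refl_anti act_uminus)
  then have "cst (eps u) * (cst (eps u) * act (s \<gamma>) (anti f)) = cst (eps u) * (cst (eps u) * - anti f)"
    by simp
  then show ?thesis by (simp add: mult.assoc[symmetric] cst_mult[symmetric] del: mult_minus_right flip: power_mult_distrib)
qed

text \<open>If \<beta> vanished on the kernel of \<gamma>, it would be a multiple of \<gamma>, hence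
  plus or minus \<gamma> since \<Phi> is reduced; positivity leaves only equality.\<close>

lemma pos_roots_kernel:
  assumes "\<beta> \<in> P" "\<gamma> \<in> P" "\<beta> \<noteq> \<gamma>" shows "\<exists>k. \<gamma> k = 0 \<and> \<beta> k \<noteq> 0"
proof (rule ccontr)
  assume n: "\<not> ?thesis"
  have r: "\<beta> \<in> \<Phi>" "\<gamma> \<in> \<Phi>" using assms by (auto simp: pos_root)
  have "\<beta> h = \<beta> (cr \<gamma>) / 2 * \<gamma> h" for h
  proof -
    have "\<gamma> (h - sc (\<gamma> h / 2) (cr \<gamma>)) = 0"
      using r by (simp add: root_diff root_scale root_coroot)
    then have "\<beta> (h - sc (\<gamma> h / 2) (cr \<gamma>)) = 0" using n by blast
    then show ?thesis using r by (simp add: root_diff root_scale)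
  qed
  then have e: "\<beta> = fscale (\<beta> (cr \<gamma>) / 2) \<gamma>" unfolding fscale_def by (intro ext)
  then have "\<beta> (cr \<gamma>) / 2 = 1 \<or> \<beta> (cr \<gamma>) / 2 = - 1" using reduced r by metis
  then show False
  proof
    assume "\<beta> (cr \<gamma>) / 2 = 1"
    then show False using e assms(3) by simp
  next
    assume "\<beta> (cr \<gamma>) / 2 = - 1"
    then have "\<beta> = - \<gamma>" using e by simp
    then show False using assms r neg_not_pos by blast
  qed
qed

lemma vanish_cancel_prod:
  assumes g: "\<gamma> \<in> P" "g \<in> R" and "finite T" "T \<subseteq> P - {\<gamma>}"
    and "\<And>h. \<gamma> h = 0 \<Longrightarrow> (\<Prod>T * g) h = 0" and "\<gamma> h = 0"
  shows "g h = 0"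
  using assms(3-6)
proof (induction T arbitrary: h rule: finite_induct)
  case empty
  then show ?case by simp
next
  case (insert \<beta> T)
  have b: "\<beta> \<in> P" "\<beta> \<noteq> \<gamma>" "\<beta> \<in> \<Phi>" using insert.prems(1) pos_root by auto
  obtain k where k: "\<gamma> k = 0" "\<beta> k \<noteq> 0" using pos_roots_kernel[OF b(1) g(1) b(2)] by blast
  have "\<Prod>T \<in> R" using insert.prems(1) by (intro poly_prod root_poly) (auto simp: pos_root)
  then have p: "\<Prod>T * g \<in> R" using g(2) by (rule poly_funs.mult)
  have e: "\<Prod>(insert \<beta> T) * g = \<beta> * (\<Prod>T * g)"
    unfolding prod.insert[OF insert.hyps] mult.assoc ..
  have "(\<Prod>T * g) h = 0" if "\<gamma> h = 0" for h
    using insert.prems(2)[unfolded e] that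
    by (rule vanish_on_kernel_cancel[OF pos_root[OF g(1)] root_poly[OF b(3)] k(2,1) p])
  then show ?case using insert.IH insert.prems(1,3) by blast
qed

text \<open>Antisymmetry makes \<open>f\<close> vanish on the kernel of each root in
  \<open>PJ\<close>. The roots are divided out one by one: those already extracted do not vanish
  identically on the next kernel, so the remaining factor does.\<close>

lemma mu_dvd_antisymmetric:
  assumes f: "f \<in> R" and anti: "\<And>\<gamma>. \<gamma> \<in> PJ \<Longrightarrow> act (s \<gamma>) f = - f"
  shows "\<exists>g\<in>R. f = \<mu> * g"
proof -
  have "finite S \<Longrightarrow> S \<subseteq> PJ \<Longrightarrow> \<exists>g\<in>R. f = \<Prod>S * g" for S
  proof (induction S rule: finite_induct)
    case empty
    then show ?case using f by simp
  next
    case (insert \<gamma> S)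
    then obtain g where g: "g \<in> R" "f = \<Prod>S * g" by auto
    have gr: "\<gamma> \<in> \<Phi>" "\<gamma> \<in> P" using insert pos_root by auto
    have z: "(\<Prod>S * g) h = 0" if "\<gamma> h = 0" for h
    proof -
      have "\<gamma> * dem \<gamma> f = f - act (s \<gamma>) f" using gr f by (simp add: dem_eq)
      also have "\<dots> = f + f" using anti insert by simp
      finally have "(\<gamma> * dem \<gamma> f) h = f h + f h" by (simp add: fun_apply)
      then have "f h = 0" using that by (simp add: fun_apply)
      then show ?thesis unfolding g(2)[symmetric] .
    qed
    have "S \<subseteq> P - {\<gamma>}" using insert(2,4) by auto
    from vanish_on_kernel_dvd[OF gr(1) g(1) vanish_cancel_prod[OF gr(2) g(1) insert(1) this z]] obtain q where "q \<in> R" "g = \<gamma> * q" by blast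
    then show ?case using g insert by (intro bexI[of _ q]) (simp_all add: mult_ac)
  qed
  from this[OF finite_PJ order_refl] show ?thesis by (simp add: mu_def)
qed

lemma homog_mu: "homog (int N) \<mu>"
  unfolding mu_def len_w0 using finite_PJ by (intro homog_prod_linear) (auto simp: root_dual pos_root)

lemma mu_poly: "\<mu> \<in> R"
  using homog_mu homog_poly by blast

lemma homog_D: "homog d f \<Longrightarrow> homog (d - int N) (D f)"
  using homog_Demazure w0_GS by blast

text \<open>Degree 0 makes \<open>D \<mu>\<close> a constant function, and evaluation at 0 reads the
  constant off.\<close>

definition "cmu = D \<mu> 0"

lemma D_mu: "D \<mu> = cst cmu"
  unfolding cmu_def using homog_0_cst[of "D \<mu>"] homog_D[OF homog_mu] by simp

lemma cmu_nonzero: "cmu \<noteq> 0"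
proof
  assume "cmu = 0"
  then have z: "D \<mu> = 0" by (simp add: D_mu)
  have G0: "card (G J) \<noteq> 0" using finite_GJ G_id[of J] by (metis card_0_eq empty_iff)
  let ?f = "rho ^ N"
  have h: "homog (int N) ?f" using homog_power[OF homog_linear[OF rho_dual], of N] by simp
  have p: "?f \<in> R" using homog_poly[OF h] .
  obtain g where g: "g \<in> R" "anti ?f = \<mu> * g"
    using mu_dvd_antisymmetric[OF anti_poly[OF p] act_refl_root_anti] by blast
  have "homog (int N) (anti ?f)"
    unfolding anti_def by (intro homog_sum homog_cst_mult homog_act GJ h)
  moreover have "\<mu> \<noteq> 0"
  proof
    assume "\<mu> = 0"
    then have "D (anti ?f) = 0" using g w0_GS by (simp add: \<Delta>_0)
    then show False using \<Delta>_rho_pos[OF w0_GS] D_anti[OF p] G0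
      by (auto simp: cst_mult[symmetric] cst_eq_0_iff)
  qed
  \<comment> \<open>The antisymmetrized power and \<mu> have the same degree, so the quotient is a
    constant. Applying \<open>D\<close> now gives zero, whereas \<open>D_anti\<close> gives a
    nonzero multiple of \<open>D ?f\<close>.\<close>
  ultimately have "homog 0 g" using homog_cancel[OF homog_mu _ g(1), of 0] g(2) by simp
  then have "anti ?f = cst (g 0) * \<mu>" using g(2) homog_0_cst by (metis mult.commute)
  then have "D (anti ?f) = 0" using Demazure_RJ_mult[OF w0_mem RJ_cst mu_poly] z by simp
  then show False using \<Delta>_rho_pos[OF w0_GS] D_anti[OF p] G0
    by (auto simp: cst_mult[symmetric] cst_eq_0_iff)
qed

end

section \<open>Dual bases of the polynomial ring over the parabolic invariants\<close>

context parabolic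
begin

abbreviation "b w \<equiv> \<Delta> w \<mu>"
text \<open>This is the left complement of \<open>w\<close>: the one element whose product with
  \<open>w\<close> is \<open>w0\<close>.\<close>

abbreviation "opp w \<equiv> w0 \<circ> inv_into UNIV w"

lemma b_poly: "w \<in> G J \<Longrightarrow> b w \<in> R"
  by (simp add: \<Delta>_poly GJ_GS mu_poly)

lemma homog_b: "w \<in> G J \<Longrightarrow> homog (int N - int (len w)) (b w)"
  using homog_Demazure[OF GJ_GS homog_mu] .

lemma opp_GJ: "w \<in> G J \<Longrightarrow> opp w \<in> G J"
  by (simp add: G_comp inv_GJ w0_mem)

lemma comp_eq_w0_iff: "u \<in> G J \<Longrightarrow> w \<in> G J \<Longrightarrow> u \<circ> w = w0 \<longleftrightarrow> u = opp w"
  by (metis GJ comp_assoc comp_id inv_G_comp)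

lemma len_opp: "w \<in> G J \<Longrightarrow> len (opp w) + len w = N"
  using complement_left[of w] comp_eq_w0_iff by metis

text \<open>When the lengths sum to at least \<open>N\<close>, they can add up only to
  \<open>N\<close> exactly, for the product \<open>w0\<close>. This is the triangularity that drives
  both the dual family and independence.\<close>

lemma Demazure_b:
  assumes "u \<in> G J" "w \<in> G J" "len u + len w \<ge> N"
  shows "\<Delta> u (b w) = (if u = opp w then cst cmu else 0)"
proof -
  have uw: "u \<circ> w \<in> G J" using assms by (simp add: G_comp)
  have "\<Delta> u (b w) = (if len (u \<circ> w) = len u + len w then \<Delta> (u \<circ> w) \<mu> else 0)"
    using assms by (intro \<Delta>_comp GJ_GS mu_poly)
  moreover have "len (u \<circ> w) = len u + len w \<longleftrightarrow> u \<circ> w = w0"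
  proof
    assume "len (u \<circ> w) = len u + len w"
    then show "u \<circ> w = w0" using longest_unique[OF uw] len_le_w0[OF uw] assms(3) by simp
  next
    assume e: "u \<circ> w = w0"
    then have "u = opp w" using comp_eq_w0_iff assms by blast
    then show "len (u \<circ> w) = len u + len w" using len_opp[OF assms(2)] unfolding e by simp
  qed
  ultimately have "\<Delta> u (b w) = (if u \<circ> w = w0 then D \<mu> else 0)" by metis
  then show ?thesis unfolding D_mu comp_eq_w0_iff[OF assms(1,2)] .
qed

text \<open>The dual family is built by induction on the length \<open>m\<close>.  The error term \<open>E f\<close> of the truncated
  expansion is killed by all \<open>\<Delta>\<^sub>v\<close> with \<open>len v + m > N\<close>, so \<open>\<Delta>\<^sub>v (E f)\<close> is invariant when
  \<open>len v + m = N\<close>; adjointness rewrites this next coefficient as \<open>D (f \<cdot> y)\<close>.\<close>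

lemma dual_step:
  assumes m: "m \<le> N"
    and x: "\<And>w. w \<in> G J \<Longrightarrow> homog (int (len w)) (x w)"
    and E: "\<And>f. f \<in> R \<Longrightarrow> E f = f - (\<Sum>w\<in>{w \<in> G J. len w < m}. D (f * x w) * b w)"
    and z: "\<And>f v. f \<in> R \<Longrightarrow> v \<in> G J \<Longrightarrow> len v + m > N \<Longrightarrow> \<Delta> v (E f) = 0"
    and w: "w \<in> G J" "len w = m"
  defines "zw \<equiv> \<Delta> (inv_into UNIV (opp w)) \<mu>"
  defines "y \<equiv> cst (1 / cmu\<^sup>2) * (zw - (\<Sum>u\<in>{u \<in> G J. len u < m}. D (b u * zw) * x u))"
  shows "homog (int m) y"
    and "\<And>f. f \<in> R \<Longrightarrow> \<Delta> (opp w) (E f) \<in> RJ"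
    and "\<And>f. f \<in> R \<Longrightarrow> D (f * y) = cst (1 / cmu) * \<Delta> (opp w) (E f)"
proof -
  have o: "opp w \<in> G J" "len (opp w) + m = N" using w opp_GJ len_opp by auto
  have zwh: "homog (int m) zw"
  proof -
    have "len (inv_into UNIV (opp w)) = len (opp w)" using o by (intro length_inv GJ_GS)
    then have "int m = int N - int (len (inv_into UNIV (opp w)))" using o(2) by linarith
    then show ?thesis
      unfolding zw_def using homog_Demazure[OF GJ_GS[OF inv_GJ[OF o(1)]] homog_mu] by (simp only:)
  qed
  have xp: "x u \<in> R" if "u \<in> G J" for u using x[OF that] by (rule homog_poly)
  have zp: "zw \<in> R" using zwh by (rule homog_poly)
  have "homog (int m) (D (b u * zw) * x u)" if u: "u \<in> G J" for u
  proof -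
    have "homog (int N - int (len u) + int m - int N + int (len u)) (D (b u * zw) * x u)"
      by (intro homog_mult homog_D homog_b x u zwh)
    then show ?thesis by (simp add: algebra_simps)
  qed
  then show "homog (int m) y"
    unfolding y_def by (intro homog_cst_mult homog_diff zwh homog_sum) auto
  fix f assume f: "f \<in> R"
  have DR: "D (g * h) \<in> RJ" if "g \<in> R" "h \<in> R" for g h using that by (intro D_RJ poly_funs.mult)
  have Ep: "E f \<in> R" unfolding E[OF f]
    using f xp b_poly by (intro poly_diff poly_sum poly_funs.mult RJ_poly[OF DR]) auto
  show inv: "\<Delta> (opp w) (E f) \<in> RJ"
    using o z[OF f] Ep by (intro Demazure_invariantI) auto
  let ?L = "{u \<in> G J. len u < m}"
  have s: "D ((\<Sum>u\<in>?L. p u) * h) = (\<Sum>u\<in>?L. D (p u * h))" if "\<And>u. u \<in> G J \<Longrightarrow> p u \<in> R" "h \<in> R" for p h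
    unfolding sum_distrib_right using that by (intro Demazure_sum w0_GS poly_funs.mult) auto
  \<comment> \<open>Subtracting the lower terms from \<open>zw\<close> has the same effect as
    subtracting them from \<open>f\<close>: by linearity over the invariants both give
    \<open>D (E f * zw)\<close>.\<close>
  have "D (f * (zw - (\<Sum>u\<in>?L. D (b u * zw) * x u))) = D (f * zw) - D ((\<Sum>u\<in>?L. D (b u * zw) * x u) * f)"
    unfolding right_diff_distrib mult.commute[of f "sum _ _"]
    using f zp xp b_poly by (intro Demazure_diff w0_GS poly_funs.mult poly_sum RJ_poly[OF DR]) auto
  also have "D ((\<Sum>u\<in>?L. D (b u * zw) * x u) * f) = (\<Sum>u\<in>?L. D (D (b u * zw) * x u * f))"
    using f zp xp b_poly by (intro s poly_funs.mult RJ_poly[OF DR]) auto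
  also have "\<dots> = (\<Sum>u\<in>?L. D (b u * zw) * D (f * x u))"
  proof (rule sum.cong[OF HOL.refl])
    fix u assume u: "u \<in> ?L"
    then have "D (D (b u * zw) * (x u * f)) = D (b u * zw) * D (x u * f)"
      using f zp xp b_poly by (intro Demazure_RJ_mult w0_mem DR poly_funs.mult) auto
    then show "D (D (b u * zw) * x u * f) = D (b u * zw) * D (f * x u)"
      by (simp only: mult.assoc mult.commute[of f])
  qed
  also have "D (f * zw) - \<dots> = D (E f * zw)"
  proof -
    have "D (E f * zw) = D (f * zw) - D ((\<Sum>u\<in>?L. D (f * x u) * b u) * zw)"
      unfolding E[OF f] left_diff_distrib
      using f zp xp b_poly by (intro Demazure_diff w0_GS poly_funs.mult poly_sum RJ_poly[OF DR]) auto
    also have "D ((\<Sum>u\<in>?L. D (f * x u) * b u) * zw) = (\<Sum>u\<in>?L. D (D (f * x u) * b u * zw))"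
      using f zp xp b_poly by (intro s poly_funs.mult RJ_poly[OF DR]) auto
    also have "\<dots> = (\<Sum>u\<in>?L. D (b u * zw) * D (f * x u))"
    proof (rule sum.cong[OF HOL.refl])
      fix u assume u: "u \<in> ?L"
      then have "D (D (f * x u) * (b u * zw)) = D (f * x u) * D (b u * zw)"
        using f zp xp b_poly by (intro Demazure_RJ_mult w0_mem DR poly_funs.mult) auto
      then show "D (D (f * x u) * b u * zw) = D (b u * zw) * D (f * x u)"
        by (simp only: mult.assoc mult.commute[of "D (b u * zw)"])
    qed
    finally show ?thesis ..
  qed
  also have "D (E f * zw) = D (\<Delta> (opp w) (E f) * \<mu>)"
    unfolding zw_def using D_adjoint[OF o(1) Ep mu_poly] ..
  also have "\<dots> = \<Delta> (opp w) (E f) * cst cmu"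
    unfolding Demazure_RJ_mult[OF w0_mem inv mu_poly] D_mu ..
  finally have *: "D (f * (zw - (\<Sum>u\<in>?L. D (b u * zw) * x u))) = \<Delta> (opp w) (E f) * cst cmu" .
  \<comment> \<open>Of the two factors \<open>1 / cmu\<close>, one cancels the constant
    \<open>D \<mu>\<close> just produced; the other is kept for the constant with which
    \<open>opp w\<close> maps \<open>b w\<close>.\<close>
  have "D (f * y) = D (cst (1 / cmu\<^sup>2) * (f * (zw - (\<Sum>u\<in>?L. D (b u * zw) * x u))))"
    unfolding y_def by (simp only: mult.left_commute[of f])
  also have "\<dots> = cst (1 / cmu\<^sup>2) * (\<Delta> (opp w) (E f) * cst cmu)"
    unfolding *[symmetric] using f zp xp b_poly
    by (intro Demazure_RJ_mult w0_mem RJ_cst poly_funs.mult poly_diff poly_sum RJ_poly[OF DR]) auto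
  also have "\<dots> = (cst (1 / cmu\<^sup>2) * cst cmu) * \<Delta> (opp w) (E f)" by (simp only: mult_ac)
  also have "cst (1 / cmu\<^sup>2) * cst cmu = cst (1 / cmu)"
    unfolding cst_mult[symmetric] using cmu_nonzero by (simp add: power2_eq_square)
  finally show "D (f * y) = cst (1 / cmu) * \<Delta> (opp w) (E f)" .
qed

lemma partial_dual:
  "\<exists>x. (\<forall>w\<in>G J. homog (int (len w)) (x w)) \<and>
     (\<forall>f\<in>R. \<forall>v\<in>G J. len v + m > N \<longrightarrow>
        \<Delta> v (f - (\<Sum>w\<in>{w \<in> G J. len w < m}. D (f * x w) * b w)) = 0)"
proof (induction m)
  case 0
  \<comment> \<open>At \<open>m = 0\<close> the condition on \<open>v\<close> is empty.\<close>
  have "\<not> N < len v" if "v \<in> G J" for v using len_le_w0[OF that] by simp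
  then show ?case by (intro exI[of _ "\<lambda>_. 0"]) simp
next
  case (Suc m)
  then obtain x where x: "\<And>w. w \<in> G J \<Longrightarrow> homog (int (len w)) (x w)" and
    z: "\<And>f v. f \<in> R \<Longrightarrow> v \<in> G J \<Longrightarrow> len v + m > N \<Longrightarrow>
      \<Delta> v (f - (\<Sum>w\<in>{w \<in> G J. len w < m}. D (f * x w) * b w)) = 0" by blast
  show ?case
  proof (cases "m \<le> N")
    case False
    then have "{w \<in> G J. len w < Suc m} = {w \<in> G J. len w < m}"
      using len_le_w0 by (force simp: less_Suc_eq)
    then show ?thesis using x z False by (intro exI[of _ x]) auto
  next
    case True
    define E where "E f = f - (\<Sum>w\<in>{w \<in> G J. len w < m}. D (f * x w) * b w)" for f
    define y where "y w = (let zw = \<Delta> (inv_into UNIV (opp w)) \<mu> in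
      cst (1 / cmu\<^sup>2) * (zw - (\<Sum>u\<in>{u \<in> G J. len u < m}. D (b u * zw) * x u)))" for w
    have zE: "\<Delta> v (E f) = 0" if "f \<in> R" "v \<in> G J" "len v + m > N" for f v
      using z[OF that] by (simp only: E_def)
    note step = dual_step[OF True x E_def zE]
    \<comment> \<open>Elements of length \<open>m\<close> receive their value now; shorter ones keep
      theirs.\<close>
    define x' where "x' w = (if len w = m then y w else x w)" for w
    have x'h: "homog (int (len w)) (x' w)" if "w \<in> G J" for w
      using x[OF that] step(1)[OF _ _ _ _ that] that by (auto simp: x'_def y_def Let_def)
    have "\<Delta> v (f - (\<Sum>w\<in>{w \<in> G J. len w < Suc m}. D (f * x' w) * b w)) = 0"
      if f: "f \<in> R" and v: "v \<in> G J" "len v + Suc m > N" for f v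
    proof -
      let ?M = "{w \<in> G J. len w = m}" and ?L = "{w \<in> G J. len w < m}"
      have fin: "finite ?M" "finite ?L" using finite_GJ by auto
      have xp: "x u \<in> R" if "u \<in> G J" for u using x[OF that] by (rule homog_poly)
      have Ep: "E f \<in> R" unfolding E_def
        using f xp b_poly by (intro poly_diff poly_sum poly_funs.mult RJ_poly[OF D_RJ]) auto
      define a where "a w = cst (1 / cmu) * \<Delta> (opp w) (E f)" for w
      have a: "a w \<in> RJ" "D (f * y w) = a w" if "w \<in> ?M" for w
        using step(2,3)[OF _ _ _ _ _ _ f, of w] that by (auto simp: a_def y_def Let_def intro!: RJ_mult)
      have split: "{w \<in> G J. len w < Suc m} = ?L \<union> ?M" by (auto simp: less_Suc_eq)
      have "(\<Sum>w\<in>{w \<in> G J. len w < Suc m}. D (f * x' w) * b w) =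
          (\<Sum>w\<in>?L. D (f * x' w) * b w) + (\<Sum>w\<in>?M. D (f * x' w) * b w)"
        unfolding split using fin by (intro sum.union_disjoint) auto
      also have "(\<Sum>w\<in>?L. D (f * x' w) * b w) = (\<Sum>w\<in>?L. D (f * x w) * b w)"
        by (rule sum.cong) (auto simp: x'_def)
      also have "(\<Sum>w\<in>?M. D (f * x' w) * b w) = (\<Sum>w\<in>?M. a w * b w)"
        by (rule sum.cong) (use a(2) in \<open>auto simp: x'_def\<close>)
      finally have e: "f - (\<Sum>w\<in>{w \<in> G J. len w < Suc m}. D (f * x' w) * b w) = E f - (\<Sum>w\<in>?M. a w * b w)"
        unfolding E_def by (simp only: diff_diff_add)
      have "\<Delta> v (E f - (\<Sum>w\<in>?M. a w * b w)) = \<Delta> v (E f) - (\<Sum>w\<in>?M. a w * \<Delta> v (b w))"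
      proof -
        have "\<Delta> v (\<Sum>w\<in>?M. a w * b w) = (\<Sum>w\<in>?M. \<Delta> v (a w * b w))"
          using a(1) b_poly RJ_poly v by (intro Demazure_sum GJ_GS poly_funs.mult) auto
        also have "\<dots> = (\<Sum>w\<in>?M. a w * \<Delta> v (b w))"
          using a(1) b_poly v by (intro sum.cong HOL.refl Demazure_RJ_mult) auto
        finally show ?thesis
          using Demazure_diff[OF GJ_GS[OF v(1)] Ep poly_sum, of ?M "\<lambda>w. a w * b w"] a(1) b_poly RJ_poly
          by (simp add: poly_funs.mult)
      qed
      \<comment> \<open>The lengths of \<open>v\<close> and \<open>w\<close> sum to at least
        \<open>N\<close>, so \<open>Demazure_b\<close> applies. On the boundary exactly one
        \<open>w\<close> has \<open>v\<close> as left complement, and its term equals the remaining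
        error; beyond it there is none and the error is already killed.\<close>
      also have "(\<Sum>w\<in>?M. a w * \<Delta> v (b w)) = (\<Sum>w\<in>?M. if v = opp w then a w * cst cmu else 0)"
        using v by (intro sum.cong HOL.refl) (auto simp: Demazure_b)
      also have "\<dots> = \<Delta> v (E f)"
      proof (cases "len v + m = N")
        case True
        obtain w where w: "w \<in> G J" "v \<circ> w = w0" "len v + len w = N"
          using complement_right[OF v(1)] by blast
        then have wM: "w \<in> ?M" "v = opp w" using True comp_eq_w0_iff[OF v(1)] by auto
        have "(\<Sum>u\<in>?M. if v = opp u then a u * cst cmu else 0) = (\<Sum>u\<in>?M. if u = w then a w * cst cmu else 0)"
        proof (rule sum.cong[OF HOL.refl])
          fix u assume u: "u \<in> ?M"
          have "v = opp u \<longleftrightarrow> u = w"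
            using w u comp_eq_w0_iff[OF v(1)] inv_G_comp(1)[OF GJ[OF v(1)]] wM(2)
            by (metis (no_types, lifting) comp_assoc id_comp mem_Collect_eq)
          then show "(if v = opp u then a u * cst cmu else 0) = (if u = w then a w * cst cmu else 0)" by auto
        qed
        also have "\<dots> = a w * cst cmu" using wM fin by simp
        also have "\<dots> = (cst (1 / cmu) * cst cmu) * \<Delta> v (E f)" unfolding a_def wM(2) by (simp only: mult_ac)
        also have "cst (1 / cmu) * cst cmu = 1" unfolding cst_mult[symmetric] using cmu_nonzero by simp
        finally show ?thesis by simp
      next
        case False
        then have big: "len v + m > N" using v(2) by simp
        have "v \<noteq> opp u" if "u \<in> ?M" for u using len_opp[of u] that big by auto
        then have "(\<Sum>u\<in>?M. if v = opp u then a u * cst cmu else 0) = 0" by (intro sum.neutral) auto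
        then show ?thesis using zE[OF f v(1) big] by simp
      qed
      finally show ?thesis unfolding e by simp
    qed
    then show ?thesis using x'h by (intro exI[of _ x']) blast
  qed
qed

text \<open>At \<open>m = Suc N\<close> the condition admits \<open>v = id\<close>, so the error of
  the expansion is itself zero.\<close>

lemma dual_family:
  "\<exists>x. (\<forall>w\<in>G J. homog (int (len w)) (x w)) \<and> (\<forall>f\<in>R. f = (\<Sum>w\<in>G J. D (f * x w) * b w))"
proof -
  obtain x where x: "\<And>w. w \<in> G J \<Longrightarrow> homog (int (len w)) (x w)" and
    z: "\<And>f v. f \<in> R \<Longrightarrow> v \<in> G J \<Longrightarrow> len v + Suc N > N \<Longrightarrow>
      \<Delta> v (f - (\<Sum>w\<in>{w \<in> G J. len w < Suc N}. D (f * x w) * b w)) = 0"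
    using partial_dual[of "Suc N"] by blast
  have L: "{w \<in> G J. len w < Suc N} = G J" using len_le_w0 by (auto simp: less_Suc_eq_le)
  have "f = (\<Sum>w\<in>G J. D (f * x w) * b w)" if f: "f \<in> R" for f
  proof -
    have "(\<Sum>w\<in>G J. D (f * x w) * b w) \<in> R"
      using f b_poly homog_poly[OF x] by (intro poly_sum poly_funs.mult RJ_poly[OF D_RJ]) auto
    then have "\<Delta> id (f - (\<Sum>w\<in>G J. D (f * x w) * b w)) = f - (\<Sum>w\<in>G J. D (f * x w) * b w)"
      using f by (intro \<Delta>_id poly_diff)
    with z[OF f G_id] show ?thesis unfolding L by simp
  qed
  with x show ?thesis by blast
qed

text \<open>Apply the operator of \<open>opp w\<close>, by induction on the length of
  \<open>w\<close>: shorter terms have zero coefficient by induction, and \<open>Demazure_b\<close>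
  kills all the others except \<open>w\<close>.\<close>

lemma b_independent:
  assumes a: "\<And>w. w \<in> G J \<Longrightarrow> a w \<in> RJ" and sum: "(\<Sum>w\<in>G J. a w * b w) = 0" and w: "w \<in> G J"
  shows "a w = 0"
  using w
proof (induction "len w" arbitrary: w rule: less_induct)
  case less
  note w = \<open>w \<in> G J\<close>
  have o: "opp w \<in> G J" "len (opp w) + len w = N" using w opp_GJ len_opp by auto
  have "0 = \<Delta> (opp w) (\<Sum>u\<in>G J. a u * b u)" using o unfolding sum by (simp add: \<Delta>_0 GJ_GS)
  also have "\<dots> = (\<Sum>u\<in>G J. \<Delta> (opp w) (a u * b u))"
    by (intro Demazure_sum GJ_GS o poly_funs.mult RJ_poly[OF a] b_poly)
  also have "\<dots> = (\<Sum>u\<in>G J. a u * \<Delta> (opp w) (b u))"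
    using o a b_poly by (intro sum.cong HOL.refl Demazure_RJ_mult)
  also have "\<dots> = (\<Sum>u\<in>G J. if u = w then a w * cst cmu else 0)"
  proof (rule sum.cong[OF HOL.refl])
    fix u assume u: "u \<in> G J"
    show "a u * \<Delta> (opp w) (b u) = (if u = w then a w * cst cmu else 0)"
    proof (cases "len u < len w")
      case True
      then show ?thesis using less(1)[OF True u] by auto
    next
      case False
      then have "\<Delta> (opp w) (b u) = (if opp w = opp u then cst cmu else 0)"
        using o by (intro Demazure_b u) auto
      moreover have "opp w = opp u \<longleftrightarrow> u = w"
        using comp_eq_w0_iff[OF o(1) u] comp_eq_w0_iff[OF o(1) w] inv_G_comp(1)[OF GJ[OF o(1)]]
        by (metis (no_types, lifting) comp_assoc id_comp)
      ultimately show ?thesis by auto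
    qed
  qed
  also have "\<dots> = a w * cst cmu" using w finite_GJ by simp
  finally show ?case
    using poly_domain[of "cst cmu" "a w"] cmu_nonzero a[OF w] RJ_poly
    by (simp add: cst_eq_0_iff mult.commute)
qed

definition dualb :: "('h \<Rightarrow> 'h) \<Rightarrow> 'h \<Rightarrow> complex" where
  "dualb = (SOME x. (\<forall>w\<in>G J. homog (int (len w)) (x w)) \<and> (\<forall>f\<in>R. f = (\<Sum>w\<in>G J. D (f * x w) * b w)))"

lemma homog_dualb: "w \<in> G J \<Longrightarrow> homog (int (len w)) (dualb w)"
  and expand_b: "f \<in> R \<Longrightarrow> f = (\<Sum>w\<in>G J. D (f * dualb w) * b w)"
  using someI_ex[OF dual_family] unfolding dualb_def by blast+

lemma dualb_poly: "w \<in> G J \<Longrightarrow> dualb w \<in> R"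
  using homog_dualb homog_poly by blast

lemma D_mult_RJ: "f \<in> R \<Longrightarrow> g \<in> R \<Longrightarrow> D (f * g) \<in> RJ"
  by (intro D_RJ poly_funs.mult)

text \<open>The expansion of \<open>b v\<close> in the family \<open>b\<close> must agree with the
  trivial one, by independence.\<close>

lemma D_b_dualb:
  assumes "v \<in> G J" "w \<in> G J" shows "D (b v * dualb w) = (if v = w then 1 else 0)"
proof -
  have "(\<Sum>w\<in>G J. (D (b v * dualb w) - (if v = w then 1 else 0)) * b w) =
      (\<Sum>w\<in>G J. D (b v * dualb w) * b w) - (\<Sum>w\<in>G J. if w = v then b v else 0)"
    unfolding left_diff_distrib sum_subtractf by (intro arg_cong2[of _ _ _ _ "(-)"] sum.cong) auto
  also have "\<dots> = 0" using expand_b[OF b_poly[OF assms(1)]] assms finite_GJ by simp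
  finally have "D (b v * dualb w) - (if v = w then 1 else 0) = 0"
    using assms b_poly dualb_poly by (intro b_independent[of "\<lambda>w. D (b v * dualb w) - (if v = w then 1 else 0)"])
      (auto intro!: RJ_diff D_mult_RJ)
  then show ?thesis by simp
qed

text \<open>The difference of the two sides is orthogonal to every \<open>b v\<close> for the form
  \<open>D (f * g)\<close>, hence to all of \<open>R\<close>, since \<open>b\<close> spans over the
  invariants. Its own expansion in \<open>b\<close> then has zero coefficients.\<close>

lemma expand_dualb:
  assumes f: "f \<in> R" shows "f = (\<Sum>w\<in>G J. D (f * b w) * dualb w)"
proof -
  let ?S = "\<Sum>w\<in>G J. D (f * b w) * dualb w"
  have S: "?S \<in> R"
    using f b_poly dualb_poly by (intro poly_sum poly_funs.mult RJ_poly[OF D_mult_RJ]) auto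
  have dp: "f - ?S \<in> R" using f S by (rule poly_diff)
  have ortho: "D ((f - ?S) * b v) = 0" if v: "v \<in> G J" for v
  proof -
    have "D (?S * b v) = (\<Sum>w\<in>G J. D (D (f * b w) * dualb w * b v))"
      unfolding sum_distrib_right using f b_poly dualb_poly v
      by (intro Demazure_sum w0_GS poly_funs.mult RJ_poly[OF D_mult_RJ]) auto
    also have "\<dots> = (\<Sum>w\<in>G J. D (f * b w) * D (b v * dualb w))"
    proof (rule sum.cong[OF HOL.refl])
      fix w assume w: "w \<in> G J"
      have "D (D (f * b w) * (dualb w * b v)) = D (f * b w) * D (dualb w * b v)"
        using f b_poly dualb_poly v w by (intro Demazure_RJ_mult w0_mem D_mult_RJ poly_funs.mult) auto
      then show "D (D (f * b w) * dualb w * b v) = D (f * b w) * D (b v * dualb w)"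
        by (simp only: mult.assoc mult.commute[of "b v"])
    qed
    also have "\<dots> = (\<Sum>w\<in>G J. if w = v then D (f * b v) else 0)"
      using v by (intro sum.cong HOL.refl) (auto simp: D_b_dualb)
    also have "\<dots> = D (f * b v)" using v finite_GJ by simp
    finally have "D (f * b v) - D (?S * b v) = 0" by simp
    moreover have "D ((f - ?S) * b v) = D (f * b v) - D (?S * b v)"
      unfolding left_diff_distrib using f S b_poly[OF v] by (intro Demazure_diff w0_GS poly_funs.mult)
    ultimately show ?thesis by simp
  qed
  have "D ((f - ?S) * g) = 0" if g: "g \<in> R" for g
  proof -
    have t: "D (g * dualb w) * b w \<in> R" if "w \<in> G J" for w
      using that g b_poly dualb_poly by (intro poly_funs.mult RJ_poly[OF D_mult_RJ])
    have "D ((f - ?S) * g) = D (\<Sum>w\<in>G J. (f - ?S) * (D (g * dualb w) * b w))"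
      using expand_b[OF g] by (simp only: sum_distrib_left[symmetric])
    also have "\<dots> = (\<Sum>w\<in>G J. D ((f - ?S) * (D (g * dualb w) * b w)))"
      by (intro Demazure_sum w0_GS poly_funs.mult[OF dp] t)
    also have "\<dots> = (\<Sum>w\<in>G J. D (g * dualb w) * D ((f - ?S) * b w))"
      unfolding mult.left_commute[of "f - ?S"]
      using dp g dualb_poly b_poly
      by (intro sum.cong HOL.refl Demazure_RJ_mult w0_mem D_mult_RJ poly_funs.mult)
    also have "\<dots> = 0" by (intro sum.neutral) (simp add: ortho)
    finally show ?thesis .
  qed
  then have "(\<Sum>w\<in>G J. D ((f - ?S) * dualb w) * b w) = 0"
    using dualb_poly by (intro sum.neutral) auto
  then have "f - ?S = 0" using expand_b[OF dp] by simp
  then show ?thesis by simp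
qed

end

section \<open>Additive maps and decompositions into homogeneous elements\<close>

text \<open>Both groups and the closure condition are bundled in, so one fact suffices to move a map
  through sums. Record schemes allow algebras, modules and tensor products as source or
  target.\<close>

definition additive :: "('a, 'm, 'x) module_scheme \<Rightarrow> ('b, 'n, 'y) module_scheme \<Rightarrow> ('m \<Rightarrow> 'n) \<Rightarrow> bool" where
  "additive M N h \<longleftrightarrow> abelian_group M \<and> abelian_group N \<and> h \<in> carrier M \<rightarrow> carrier N \<and>
     (\<forall>u\<in>carrier M. \<forall>v\<in>carrier M. h (u \<oplus>\<^bsub>M\<^esub> v) = h u \<oplus>\<^bsub>N\<^esub> h v)"

lemma additiveI:
  assumes "abelian_group M" "abelian_group N" "\<And>u. u \<in> carrier M \<Longrightarrow> h u \<in> carrier N"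
    "\<And>u v. u \<in> carrier M \<Longrightarrow> v \<in> carrier M \<Longrightarrow> h (u \<oplus>\<^bsub>M\<^esub> v) = h u \<oplus>\<^bsub>N\<^esub> h v"
  shows "additive M N h"
  using assms by (auto simp: additive_def)

lemma additive_closed: "additive M N h \<Longrightarrow> u \<in> carrier M \<Longrightarrow> h u \<in> carrier N"
  and additive_add: "additive M N h \<Longrightarrow> u \<in> carrier M \<Longrightarrow> v \<in> carrier M \<Longrightarrow> h (u \<oplus>\<^bsub>M\<^esub> v) = h u \<oplus>\<^bsub>N\<^esub> h v"
  by (auto simp: additive_def)

lemma additive_zero: assumes "additive M N h" shows "h \<zero>\<^bsub>M\<^esub> = \<zero>\<^bsub>N\<^esub>"
proof -
  interpret M: abelian_group M using assms by (simp add: additive_def)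
  interpret N: abelian_group N using assms by (simp add: additive_def)
  have c: "h \<zero>\<^bsub>M\<^esub> \<in> carrier N" using assms by (simp add: additive_closed)
  have "h \<zero>\<^bsub>M\<^esub> \<oplus>\<^bsub>N\<^esub> h \<zero>\<^bsub>M\<^esub> = h \<zero>\<^bsub>M\<^esub>"
    using additive_add[OF assms M.zero_closed M.zero_closed] by simp
  then show ?thesis using c by (metis N.a_assoc N.r_neg N.r_zero N.a_inv_closed)
qed

lemma additive_uminus:
  assumes h: "additive M N h" and u: "u \<in> carrier M" shows "h (\<ominus>\<^bsub>M\<^esub> u) = \<ominus>\<^bsub>N\<^esub> h u"
proof -
  interpret M: abelian_group M using assms by (simp add: additive_def)
  interpret N: abelian_group N using assms by (simp add: additive_def)
  have "h (\<ominus>\<^bsub>M\<^esub> u) \<oplus>\<^bsub>N\<^esub> h u = \<zero>\<^bsub>N\<^esub>"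
    using additive_add[OF h M.a_inv_closed[OF u] u] additive_zero[OF h] u by (simp add: M.l_neg)
  then show ?thesis using N.minus_equality additive_closed[OF h] u by auto
qed

lemma additive_finsum:
  assumes h: "additive M N h" and "finite A" "\<And>i. i \<in> A \<Longrightarrow> f i \<in> carrier M"
  shows "h (\<Oplus>\<^bsub>M\<^esub>i\<in>A. f i) = (\<Oplus>\<^bsub>N\<^esub>i\<in>A. h (f i))"
  using assms(2,3)
proof (induction A rule: finite_induct)
  interpret M: abelian_group M using assms by (simp add: additive_def)
  interpret N: abelian_group N using assms by (simp add: additive_def)
  {
    case empty
    then show ?case using additive_zero[OF h] by simp
  next
    case (insert i A)
    have 1: "f \<in> A \<rightarrow> carrier M" "f i \<in> carrier M" using insert.prems by auto
    then have 2: "(\<lambda>i. h (f i)) \<in> A \<rightarrow> carrier N" "h (f i) \<in> carrier N" using additive_closed[OF h] by auto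
    have "h (f i \<oplus>\<^bsub>M\<^esub> (\<Oplus>\<^bsub>M\<^esub>i\<in>A. f i)) = h (f i) \<oplus>\<^bsub>N\<^esub> h (\<Oplus>\<^bsub>M\<^esub>i\<in>A. f i)"
      using 1 by (intro additive_add[OF h] M.finsum_closed)
    then show ?case
      using insert.IH insert.prems M.finsum_insert[OF insert.hyps 1] N.finsum_insert[OF insert.hyps 2] by simp
  }
qed

lemma additive_comp: "additive M N h \<Longrightarrow> additive N L g \<Longrightarrow> additive M L (\<lambda>u. g (h u))"
  by (auto simp: additive_def Pi_iff)

lemma (in abelian_group) additive_subgroupI:
  assumes "K \<subseteq> carrier G" "\<zero> \<in> K" "\<And>u v. u \<in> K \<Longrightarrow> v \<in> K \<Longrightarrow> u \<oplus> v \<in> K" "\<And>u. u \<in> K \<Longrightarrow> \<ominus> u \<in> K"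
  shows "additive_subgroup K G"
  using assms by (intro additive_subgroup.intro subgroup.intro) (auto simp: a_inv_def)

lemma (in abelian_group) finsum_mem:
  assumes "\<zero> \<in> K" "\<And>u v. u \<in> K \<Longrightarrow> v \<in> K \<Longrightarrow> u \<oplus> v \<in> K" "K \<subseteq> carrier G" "\<And>i. i \<in> A \<Longrightarrow> f i \<in> K"
  shows "(\<Oplus>i\<in>A. f i) \<in> K"
  using assms(4)
proof (induction A rule: infinite_finite_induct)
  case (insert x F)
  then have "f \<in> F \<rightarrow> carrier G" "f x \<in> carrier G" using assms(3) by auto
  with insert assms show ?case by (simp add: finsum_insert)
qed (use assms in simp_all)

text \<open>This is the existence half of \<open>graded_decomp\<close>, over any finite index set
  instead of the exact support.\<close>

definition decomposable :: "('a, 'm) graded \<Rightarrow> 'm \<Rightarrow> bool" where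
  "decomposable M X \<longleftrightarrow> (\<exists>S x. finite S \<and> (\<forall>d. x d \<in> grade M d) \<and> X = (\<Oplus>\<^bsub>M\<^esub>d\<in>S. x d))"

text \<open>This is the uniqueness half: a vanishing finite sum of homogeneous elements of distinct
  degrees has vanishing terms.\<close>

definition graded_indep :: "('a, 'm) graded \<Rightarrow> bool" where
  "graded_indep M \<longleftrightarrow> (\<forall>S x. finite S \<longrightarrow> (\<forall>d. x d \<in> grade M d) \<longrightarrow> (\<Oplus>\<^bsub>M\<^esub>d\<in>S. x d) = \<zero>\<^bsub>M\<^esub> \<longrightarrow>
     (\<forall>d\<in>S. x d = \<zero>\<^bsub>M\<^esub>))"

lemma graded_indepD:
  assumes "graded_indep M" "finite S" "\<And>d. x d \<in> grade M d" "(\<Oplus>\<^bsub>M\<^esub>d\<in>S. x d) = \<zero>\<^bsub>M\<^esub>" "d \<in> S"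
  shows "x d = \<zero>\<^bsub>M\<^esub>"
  using assms(1)[unfolded graded_indep_def, rule_format, of S x d] assms(2-5) by simp

locale graded_group = abelian_group M for M :: "('a, 'm) graded" (structure) +
  assumes grade_subgroup: "additive_subgroup (grade M d) M"
begin

lemma grade_carrier: "u \<in> grade M d \<Longrightarrow> u \<in> carrier M"
  using additive_subgroup.a_subset[OF grade_subgroup] by blast

lemma grade_zero: "\<zero> \<in> grade M d"
  using additive_subgroup.zero_closed[OF grade_subgroup] .

lemma grade_add: "u \<in> grade M d \<Longrightarrow> v \<in> grade M d \<Longrightarrow> u \<oplus> v \<in> grade M d"
  using additive_subgroup.a_closed[OF grade_subgroup] .

lemma grade_uminus: "u \<in> grade M d \<Longrightarrow> \<ominus> u \<in> grade M d"
  using additive_subgroup.a_inv_closed[OF grade_subgroup] .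

lemma grade_finsum: "(\<And>i. i \<in> A \<Longrightarrow> f i \<in> grade M d) \<Longrightarrow> (\<Oplus>i\<in>A. f i) \<in> grade M d"
  using grade_carrier by (intro finsum_mem grade_zero grade_add) auto

lemma finsum_extend:
  assumes "finite T" "S \<subseteq> T" "\<And>d. x d \<in> carrier M"
  shows "(\<Oplus>d\<in>S. x d) = (\<Oplus>d\<in>T. if d \<in> S then x d else \<zero>)"
  using assms by (intro add.finprod_mono_neutral_cong_left) auto

lemma decomposable_add:
  assumes "decomposable M X" "decomposable M Y" shows "decomposable M (X \<oplus> Y)"
proof -
  obtain S x where S: "finite S" "\<And>d. x d \<in> grade M d" "X = (\<Oplus>d\<in>S. x d)"
    using assms(1) unfolding decomposable_def by auto
  obtain T y where T: "finite T" "\<And>d. y d \<in> grade M d" "Y = (\<Oplus>d\<in>T. y d)"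
    using assms(2) unfolding decomposable_def by auto
  let ?x = "\<lambda>d. if d \<in> S then x d else \<zero>" and ?y = "\<lambda>d. if d \<in> T then y d else \<zero>"
  have c: "?x d \<in> grade M d" "?y d \<in> grade M d" for d using S T grade_zero by auto
  have "X = (\<Oplus>d\<in>S \<union> T. ?x d)" unfolding S(3) using S T grade_carrier by (intro finsum_extend) auto
  moreover have "Y = (\<Oplus>d\<in>S \<union> T. ?y d)" unfolding T(3) using S T grade_carrier by (intro finsum_extend) auto
  ultimately have "X \<oplus> Y = (\<Oplus>d\<in>S \<union> T. ?x d \<oplus> ?y d)"
    using c grade_carrier by (subst finsum_addf) (auto simp del: if_split)
  then show ?thesis unfolding decomposable_def using S(1) T(1) c grade_add
    by (intro exI[of _ "S \<union> T"] exI[of _ "\<lambda>d. ?x d \<oplus> ?y d"]) auto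
qed

lemma decomposable_homogeneous:
  assumes "u \<in> grade M d" shows "decomposable M u"
  unfolding decomposable_def
  using assms grade_zero grade_carrier[OF assms]
  by (intro exI[of _ "{d}"] exI[of _ "\<lambda>d'. if d' = d then u else \<zero>"]) (auto simp: finsum_insert)

lemma decomposable_finsum:
  assumes "\<And>i. i \<in> A \<Longrightarrow> f i \<in> carrier M" "\<And>i. i \<in> A \<Longrightarrow> decomposable M (f i)"
  shows "decomposable M (\<Oplus>i\<in>A. f i)"
proof -
  have "(\<Oplus>i\<in>A. f i) \<in> {u \<in> carrier M. decomposable M u}"
    using assms decomposable_add decomposable_homogeneous[OF grade_zero]
    by (intro finsum_mem) auto
  then show ?thesis by simp
qed

lemma graded_decompI:
  assumes dec: "\<And>X. X \<in> carrier M \<Longrightarrow> decomposable M X" and ind: "graded_indep M"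
  shows "graded_decomp M"
  unfolding graded_decomp_def
proof (intro conjI allI ballI grade_subgroup)
  fix m assume "m \<in> carrier M"
  then obtain S x where S: "finite S" "\<And>d. x d \<in> grade M d" "m = (\<Oplus>d\<in>S. x d)"
    using dec unfolding decomposable_def by blast
  let ?Q = "\<lambda>x. (\<forall>d. x d \<in> grade M d) \<and> finite {d. x d \<noteq> \<zero>} \<and> m = (\<Oplus>d\<in>{d. x d \<noteq> \<zero>}. x d)"
  show "\<exists>!x. ?Q x"
  proof (rule ex1I)
    \<comment> \<open>The family may be nonzero outside \<open>S\<close>, whereas
      \<open>graded_decomp\<close> sums over the full support, so it is cut off.\<close>
    let ?x = "\<lambda>d. if d \<in> S then x d else \<zero>"
    have sub: "{d. ?x d \<noteq> \<zero>} \<subseteq> S" by auto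
    have "m = (\<Oplus>d\<in>S. ?x d)" unfolding S(3) using grade_carrier[OF S(2)] by (intro finsum_cong') auto
    also have "\<dots> = (\<Oplus>d\<in>{d. ?x d \<noteq> \<zero>}. ?x d)"
      using S(1) sub grade_carrier[OF S(2)] by (intro add.finprod_mono_neutral_cong_right) auto
    finally show "?Q ?x" using S grade_zero finite_subset[OF sub] by auto
  next
    have uniq: "x d = y d" if "?Q x" "?Q y" for x y d
    proof -
      let ?S = "{d. x d \<noteq> \<zero>} \<union> {d. y d \<noteq> \<zero>}"
      have c: "x d \<in> carrier M" "y d \<in> carrier M" for d using that grade_carrier by auto
      have "m = (\<Oplus>d\<in>?S. x d)"
        using that c by (subst conjunct2[OF conjunct2[OF that(1)]], intro add.finprod_mono_neutral_cong_left) auto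
      moreover have "m = (\<Oplus>d\<in>?S. y d)"
        using that c by (subst conjunct2[OF conjunct2[OF that(2)]], intro add.finprod_mono_neutral_cong_left) auto
      moreover have "additive M M (\<lambda>u. \<ominus> u)"
        using abelian_group_axioms by (intro additiveI) (auto simp: minus_add)
      ultimately have "(\<Oplus>d\<in>?S. x d) \<oplus> (\<Oplus>d\<in>?S. \<ominus> y d) = m \<oplus> \<ominus> m"
        using additive_finsum[of M M "\<lambda>u. \<ominus> u" ?S y] that c by simp
      then have sm: "(\<Oplus>d\<in>?S. x d \<oplus> \<ominus> y d) = \<zero>"
        using c \<open>m \<in> carrier M\<close> by (subst finsum_addf) (auto simp: r_neg)
      have fin: "finite ?S" using that by blast
      have gr: "x d \<oplus> \<ominus> y d \<in> grade M d" for d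
        using grade_add grade_uminus spec[OF conjunct1[OF that(1)]] spec[OF conjunct1[OF that(2)]] by blast
      have z: "x d \<oplus> \<ominus> y d = \<zero>" if "d \<in> ?S" for d
        by (rule graded_indepD[OF ind fin gr sm that])
      show ?thesis
      proof (cases "d \<in> ?S")
        case True
        from z[OF this] show ?thesis using c by (metis minus_equality minus_minus a_inv_closed)
      qed auto
    qed
    have Q: "?Q (\<lambda>d. if d \<in> S then x d else \<zero>)"
    proof -
      let ?x = "\<lambda>d. if d \<in> S then x d else \<zero>"
      have sub: "{d. ?x d \<noteq> \<zero>} \<subseteq> S" by auto
      have "m = (\<Oplus>d\<in>S. ?x d)" unfolding S(3) using grade_carrier[OF S(2)] by (intro finsum_cong') auto
      also have "\<dots> = (\<Oplus>d\<in>{d. ?x d \<noteq> \<zero>}. ?x d)"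
        using S(1) sub grade_carrier[OF S(2)] by (intro add.finprod_mono_neutral_cong_right) auto
      finally show ?thesis using S grade_zero finite_subset[OF sub] by auto
    qed
    fix y assume "?Q y"
    then show "y = (\<lambda>d. if d \<in> S then x d else \<zero>)" using uniq[OF _ Q] by (intro ext) blast
  qed
qed

end

lemma graded_decompD:
  assumes M: "abelian_group M" and g: "graded_decomp M"
  shows "graded_group M" "X \<in> carrier M \<Longrightarrow> decomposable M X" "graded_indep M"
proof -
  show gg: "graded_group M"
    using M g by (auto simp: graded_group_def graded_group_axioms_def graded_decomp_def)
  interpret graded_group M by fact
  show "decomposable M X" if "X \<in> carrier M"
  proof -
    have "\<exists>!x. (\<forall>d. x d \<in> grade M d) \<and> finite {d. x d \<noteq> \<zero>\<^bsub>M\<^esub>} \<and>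
        X = (\<Oplus>\<^bsub>M\<^esub>d\<in>{d. x d \<noteq> \<zero>\<^bsub>M\<^esub>}. x d)"
      using g that unfolding graded_decomp_def by blast
    then obtain x where x: "(\<forall>d. x d \<in> grade M d) \<and> finite {d. x d \<noteq> \<zero>\<^bsub>M\<^esub>} \<and>
        X = (\<Oplus>\<^bsub>M\<^esub>d\<in>{d. x d \<noteq> \<zero>\<^bsub>M\<^esub>}. x d)" by (elim ex1E)
    then show ?thesis unfolding decomposable_def
      by (intro exI[of _ "{d. x d \<noteq> \<zero>\<^bsub>M\<^esub>}"] exI[of _ x]) simp
  qed
  show "graded_indep M"
    unfolding graded_indep_def
  proof (intro allI impI ballI)
    fix S x d
    assume S: "finite S" "\<forall>d. x d \<in> grade M d" "(\<Oplus>\<^bsub>M\<^esub>d\<in>S. x d) = \<zero>\<^bsub>M\<^esub>" "d \<in> S"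
    let ?Q = "\<lambda>x. (\<forall>d. x d \<in> grade M d) \<and> finite {d. x d \<noteq> \<zero>\<^bsub>M\<^esub>} \<and>
        \<zero>\<^bsub>M\<^esub> = (\<Oplus>\<^bsub>M\<^esub>d\<in>{d. x d \<noteq> \<zero>\<^bsub>M\<^esub>}. x d)"
    let ?x = "\<lambda>d. if d \<in> S then x d else \<zero>\<^bsub>M\<^esub>"
    have ex: "\<exists>!x. ?Q x" using g zero_closed unfolding graded_decomp_def by blast
    have sub: "{d. ?x d \<noteq> \<zero>\<^bsub>M\<^esub>} \<subseteq> S" by auto
    have "\<zero>\<^bsub>M\<^esub> = (\<Oplus>\<^bsub>M\<^esub>d\<in>S. ?x d)" unfolding S(3)[symmetric] using grade_carrier[OF spec[OF S(2)]] by (intro finsum_cong') auto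
    also have "\<dots> = (\<Oplus>\<^bsub>M\<^esub>d\<in>{d. ?x d \<noteq> \<zero>\<^bsub>M\<^esub>}. ?x d)"
      using S(1) sub grade_carrier[OF spec[OF S(2)]] by (intro add.finprod_mono_neutral_cong_right) auto
    finally have q1: "?Q ?x" using S grade_zero finite_subset[OF sub] by auto
    \<comment> \<open>Zero is also decomposed by the zero family, so uniqueness makes all terms
      vanish.\<close>
    have q2: "?Q (\<lambda>_. \<zero>\<^bsub>M\<^esub>)" using grade_zero by simp
    from ex obtain z where z: "\<forall>y. ?Q y \<longrightarrow> y = z" by (rule ex1E)
    have "?x = z" by (rule mp[OF spec[OF z] q1])
    also have "\<dots> = (\<lambda>_. \<zero>\<^bsub>M\<^esub>)" by (rule sym, rule mp[OF spec[OF z] q2])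
    finally have "?x = (\<lambda>_. \<zero>\<^bsub>M\<^esub>)" .
    from fun_cong[OF this, of d] S(4) show "x d = \<zero>\<^bsub>M\<^esub>" by simp
  qed
qed

lemma gmodD:
  assumes "M \<in> gmod A"
  shows "Module.module A M" "fin_dim A M" "graded_decomp M" "graded_group M" "abelian_group M"
    "\<And>i j a m. a \<in> grade A i \<Longrightarrow> m \<in> grade M j \<Longrightarrow> a \<odot>\<^bsub>M\<^esub> m \<in> grade M (i + j)"
proof -
  show m: "Module.module A M" and "fin_dim A M" and g: "graded_decomp M"
    and "\<And>i j a m. a \<in> grade A i \<Longrightarrow> m \<in> grade M j \<Longrightarrow> a \<odot>\<^bsub>M\<^esub> m \<in> grade M (i + j)"
    using assms by (auto simp: gmod_def)
  show a: "abelian_group M" using m by (rule Module.module.axioms)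
  show "graded_group M" using graded_decompD[OF a g] by blast
qed

lemma ghomD:
  assumes "f \<in> ghom A M N"
  shows "f \<in> extensional (carrier M)" "\<And>u. u \<in> carrier M \<Longrightarrow> f u \<in> carrier N"
    "\<And>u v. u \<in> carrier M \<Longrightarrow> v \<in> carrier M \<Longrightarrow> f (u \<oplus>\<^bsub>M\<^esub> v) = f u \<oplus>\<^bsub>N\<^esub> f v"
    "\<And>a u. a \<in> carrier A \<Longrightarrow> u \<in> carrier M \<Longrightarrow> f (a \<odot>\<^bsub>M\<^esub> u) = a \<odot>\<^bsub>N\<^esub> f u"
    "\<And>d u. u \<in> grade M d \<Longrightarrow> f u \<in> grade N d"
  using assms by (auto simp: ghom_def PiE_def image_subset_iff)

lemma ghomI:
  assumes "f \<in> extensional (carrier M)" "\<And>u. u \<in> carrier M \<Longrightarrow> f u \<in> carrier N"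
    "\<And>u v. u \<in> carrier M \<Longrightarrow> v \<in> carrier M \<Longrightarrow> f (u \<oplus>\<^bsub>M\<^esub> v) = f u \<oplus>\<^bsub>N\<^esub> f v"
    "\<And>a u. a \<in> carrier A \<Longrightarrow> u \<in> carrier M \<Longrightarrow> f (a \<odot>\<^bsub>M\<^esub> u) = a \<odot>\<^bsub>N\<^esub> f u"
    "\<And>d u. u \<in> grade M d \<Longrightarrow> f u \<in> grade N d"
  shows "f \<in> ghom A M N"
  using assms by (auto simp: ghom_def PiE_def image_subset_iff)

lemma ghom_additive: "f \<in> ghom A M N \<Longrightarrow> abelian_group M \<Longrightarrow> abelian_group N \<Longrightarrow> additive M N f"
  by (rule additiveI) (auto dest: ghomD)

lemma ghom_ext: "f \<in> ghom A M N \<Longrightarrow> g \<in> ghom A M' N' \<Longrightarrow> carrier M = carrier M' \<Longrightarrow>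
    (\<And>u. u \<in> carrier M \<Longrightarrow> f u = g u) \<Longrightarrow> f = g"
  by (rule extensionalityI[of f "carrier M" g]) (auto dest: ghomD)

text \<open>Restricting scalars, shifting degrees and passing to the regular module change other
  record fields only, so finite sums carry over.\<close>

lemma finsum_carrier_add_zero:
  assumes "carrier M = carrier N" "add M = add N" "\<zero>\<^bsub>M\<^esub> = \<zero>\<^bsub>N\<^esub>"
  shows "finsum M f A = finsum N f A"
  using assms by (simp add: finsum_def finprod_def)

section \<open>The tensor product\<close>

text \<open>These are the biadditive maps that move scalars of \<open>B\<close> across, that is, the
  ones that factor through the tensor product.\<close>

definition balanced :: "(complex, 'a) graded \<Rightarrow> (complex, 'a) graded \<Rightarrow> ('a, 'm) graded
    \<Rightarrow> ('b, 'n, 'y) module_scheme \<Rightarrow> ('a \<Rightarrow> 'm \<Rightarrow> 'n) \<Rightarrow> bool" where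
  "balanced C B M N g \<longleftrightarrow> abelian_group N \<and>
     (\<forall>a\<in>carrier C. \<forall>m\<in>carrier M. g a m \<in> carrier N) \<and>
     (\<forall>a\<in>carrier C. \<forall>a'\<in>carrier C. \<forall>m\<in>carrier M. g (a \<oplus>\<^bsub>C\<^esub> a') m = g a m \<oplus>\<^bsub>N\<^esub> g a' m) \<and>
     (\<forall>a\<in>carrier C. \<forall>m\<in>carrier M. \<forall>m'\<in>carrier M. g a (m \<oplus>\<^bsub>M\<^esub> m') = g a m \<oplus>\<^bsub>N\<^esub> g a m') \<and>
     (\<forall>a\<in>carrier C. \<forall>b\<in>carrier B. \<forall>m\<in>carrier M. g (a \<otimes>\<^bsub>C\<^esub> b) m = g a (b \<odot>\<^bsub>M\<^esub> m))"

locale tensor_product =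
  fixes C B :: "(complex, 'a) graded" and M :: "('a, 'm) graded"
  assumes cring_C: "cring C" and module_M: "Module.module B M" and sub: "carrier B \<subseteq> carrier C"
begin

abbreviation "FG \<equiv> tensor_free C M"
abbreviation "Rel \<equiv> tensor_rel C B M"
abbreviation "T \<equiv> ind C B M"
abbreviation "tc \<equiv> tensor_coset C B M"
abbreviation "CM \<equiv> carrier C \<times> carrier M"

definition t :: "'a \<Rightarrow> 'm \<Rightarrow> ('a \<times> 'm \<Rightarrow>\<^sub>0 int) set" where "t a m = tc (frag_of (a, m))"

sublocale C: cring C by (rule cring_C)
sublocale M: module B M by (rule module_M)
interpretation FG: comm_group FG by (rule abelian_free_Abelian_group)

lemma keys_minus_subset: "Poly_Mapping.keys x \<subseteq> S \<Longrightarrow> Poly_Mapping.keys y \<subseteq> S \<Longrightarrow> Poly_Mapping.keys (x - y :: 'z \<Rightarrow>\<^sub>0 int) \<subseteq> S"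
  using keys_diff[of x y] by blast

lemma frag_of_mem: "a \<in> carrier C \<Longrightarrow> m \<in> carrier M \<Longrightarrow> Poly_Mapping.keys (frag_of (a, m)) \<subseteq> CM"
  by simp

definition gens :: "('a \<times> 'm \<Rightarrow>\<^sub>0 int) set" where
  "gens = {frag_of (a \<oplus>\<^bsub>C\<^esub> a', m) - frag_of (a, m) - frag_of (a', m) | a a' m.
         a \<in> carrier C \<and> a' \<in> carrier C \<and> m \<in> carrier M} \<union>
      {frag_of (a, m \<oplus>\<^bsub>M\<^esub> m') - frag_of (a, m) - frag_of (a, m') | a m m'.
         a \<in> carrier C \<and> m \<in> carrier M \<and> m' \<in> carrier M} \<union>
      {frag_of (a \<otimes>\<^bsub>C\<^esub> b, m) - frag_of (a, b \<odot>\<^bsub>M\<^esub> m) | a b m.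
         a \<in> carrier C \<and> b \<in> carrier B \<and> m \<in> carrier M}"

lemma Rel_gens: "Rel = generate FG gens"
  by (simp add: tensor_rel_def gens_def)

lemma gens_cases [consumes 1, case_names left right mid]:
  assumes "z \<in> gens"
  obtains a a' m where "a \<in> carrier C" "a' \<in> carrier C" "m \<in> carrier M"
      "z = frag_of (a \<oplus>\<^bsub>C\<^esub> a', m) - frag_of (a, m) - frag_of (a', m)"
    | a m m' where "a \<in> carrier C" "m \<in> carrier M" "m' \<in> carrier M"
      "z = frag_of (a, m \<oplus>\<^bsub>M\<^esub> m') - frag_of (a, m) - frag_of (a, m')"
    | a b m where "a \<in> carrier C" "b \<in> carrier B" "m \<in> carrier M"
      "z = frag_of (a \<otimes>\<^bsub>C\<^esub> b, m) - frag_of (a, b \<odot>\<^bsub>M\<^esub> m)"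
  using assms unfolding gens_def
proof (elim UnE CollectE exE conjE)
qed (rule that(1); assumption | rule that(2); assumption | rule that(3); assumption)+

lemma generators_subset: "gens \<subseteq> carrier FG"
proof
  fix z assume "z \<in> gens"
  then have "Poly_Mapping.keys z \<subseteq> CM"
  proof (cases rule: gens_cases)
    case (left a a' m)
    then show ?thesis by (simp only:, intro keys_minus_subset frag_of_mem) simp_all
  next
    case (right a m m')
    then show ?thesis by (simp only:, intro keys_minus_subset frag_of_mem) simp_all
  next
    case (mid a b m)
    then show ?thesis using subsetD[OF sub, of b]
      by (simp only:, intro keys_minus_subset frag_of_mem) simp_all
  qed
  then show "z \<in> carrier FG" by simp
qed

lemma Rel_subgroup: "subgroup Rel FG"
  unfolding Rel_gens by (rule FG.generate_is_subgroup[OF generators_subset])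

lemma Rel_normal: "Rel \<lhd> FG"
  using Rel_subgroup by (simp add: FG.normal_iff_subgroup)

interpretation Q: comm_group "FG Mod Rel"
  by (rule FG.abelian_FactGroup[OF Rel_subgroup])

lemma ind_simps: "carrier T = carrier (FG Mod Rel)" "add T = monoid.mult (FG Mod Rel)"
  "\<zero>\<^bsub>T\<^esub> = \<one>\<^bsub>FG Mod Rel\<^esub>"
  by (simp_all add: ind_def Let_def)

lemma abelian_ind: "abelian_group T"
proof (rule abelian_groupI; unfold ind_simps)
qed (fact Q.m_closed Q.one_closed Q.m_assoc Q.m_comm Q.l_one Q.l_inv_ex)+

sublocale T: abelian_group T by (rule abelian_ind)

lemma tc_closed: "Poly_Mapping.keys x \<subseteq> CM \<Longrightarrow> tc x \<in> carrier T"
  by (auto simp: ind_simps tensor_coset_def carrier_FactGroup)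

lemma tc_cases:
  assumes "X \<in> carrier T" obtains x where "Poly_Mapping.keys x \<subseteq> CM" "X = tc x"
  using assms by (auto simp: ind_simps tensor_coset_def carrier_FactGroup)

lemma tc_add: "Poly_Mapping.keys x \<subseteq> CM \<Longrightarrow> Poly_Mapping.keys y \<subseteq> CM \<Longrightarrow> tc (x + y) = tc x \<oplus>\<^bsub>T\<^esub> tc y"
  using hom_mult[OF normal.r_coset_hom_Mod[OF Rel_normal], of x y]
  by (simp add: ind_simps tensor_coset_def del: mult_FactGroup)

lemma tc_0: "tc 0 = \<zero>\<^bsub>T\<^esub>"
  using FG.coset_mult_one[OF subgroup.subset[OF Rel_subgroup]] by (simp add: ind_simps tensor_coset_def)

lemma tc_diff:
  assumes "Poly_Mapping.keys x \<subseteq> CM" "Poly_Mapping.keys y \<subseteq> CM"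
  shows "tc (x - y) = tc x \<ominus>\<^bsub>T\<^esub> tc y"
proof -
  have "tc x = tc (x - y) \<oplus>\<^bsub>T\<^esub> tc y"
    using tc_add[OF keys_minus_subset[OF assms] assms(2)] by simp
  moreover have "tc x \<in> carrier T" "tc y \<in> carrier T" "tc (x - y) \<in> carrier T"
    using assms keys_minus_subset[OF assms] by (auto intro: tc_closed)
  ultimately show ?thesis
    by (metis T.a_assoc T.a_inv_closed T.minus_eq T.r_neg T.r_zero)
qed

lemma tc_eq:
  assumes "Poly_Mapping.keys x \<subseteq> CM" "Poly_Mapping.keys y \<subseteq> CM" "x - y \<in> Rel"
  shows "tc x = tc y"
proof -
  have "x \<in> Rel #>\<^bsub>FG\<^esub> y" using assms(3) by (force simp: r_coset_def)
  then show ?thesis using FG.repr_independence[OF _ _ Rel_subgroup] assms by (simp add: tensor_coset_def)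
qed

text \<open>All members of a coset give the same coset; this makes the unions over representatives
  in \<open>ind\<close> and \<open>ind_mor\<close> trivial.\<close>

lemma tc_mem:
  assumes "x \<in> tc z" "Poly_Mapping.keys z \<subseteq> CM"
  shows "Poly_Mapping.keys x \<subseteq> CM" "tc x = tc z"
proof -
  have "x \<in> Rel #>\<^bsub>FG\<^esub> z" using assms(1) by (simp add: tensor_coset_def)
  moreover have "z \<in> carrier FG" using assms(2) by simp
  ultimately have "x \<in> carrier FG" "Rel #>\<^bsub>FG\<^esub> z = Rel #>\<^bsub>FG\<^esub> x"
    using FG.r_coset_subset_G[OF subgroup.subset[OF Rel_subgroup]] FG.repr_independence[OF _ _ Rel_subgroup]
    by blast+
  then show "Poly_Mapping.keys x \<subseteq> CM" "tc x = tc z" by (simp_all add: tensor_coset_def)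
qed

lemma tc_self: "Poly_Mapping.keys z \<subseteq> CM \<Longrightarrow> z \<in> tc z"
  using FG.rcos_self[OF _ Rel_subgroup, of z] by (simp add: tensor_coset_def)

lemma t_closed [simp]: "a \<in> carrier C \<Longrightarrow> m \<in> carrier M \<Longrightarrow> t a m \<in> carrier T"
  by (simp add: t_def tc_closed)

lemma diff_frag_eq:
  assumes "Poly_Mapping.keys x \<subseteq> CM" "Poly_Mapping.keys y \<subseteq> CM" "Poly_Mapping.keys z \<subseteq> CM" "x - y - z \<in> Rel"
  shows "tc x = tc y \<oplus>\<^bsub>T\<^esub> tc z"
proof -
  have "Poly_Mapping.keys (y + z) \<subseteq> CM" using keys_add[of y z] assms by blast
  then have "tc x = tc (y + z)" using assms by (intro tc_eq) (auto simp: diff_diff_eq)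
  then show ?thesis using tc_add assms by simp
qed

lemma t_balanced: "balanced C B M T t"
  unfolding balanced_def
proof (intro conjI ballI abelian_ind)
  fix a a' m assume *: "a \<in> carrier C" "a' \<in> carrier C" "m \<in> carrier M"
  have "frag_of (a \<oplus>\<^bsub>C\<^esub> a', m) - frag_of (a, m) - frag_of (a', m) \<in> Rel"
    unfolding Rel_gens gens_def using * by (intro generate.incl) blast
  then show "t (a \<oplus>\<^bsub>C\<^esub> a') m = t a m \<oplus>\<^bsub>T\<^esub> t a' m"
    unfolding t_def using * by (intro diff_frag_eq frag_of_mem) auto
next
  fix a m m' assume *: "a \<in> carrier C" "m \<in> carrier M" "m' \<in> carrier M"
  have "frag_of (a, m \<oplus>\<^bsub>M\<^esub> m') - frag_of (a, m) - frag_of (a, m') \<in> Rel"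
    unfolding Rel_gens gens_def using * by (intro generate.incl) blast
  then show "t a (m \<oplus>\<^bsub>M\<^esub> m') = t a m \<oplus>\<^bsub>T\<^esub> t a m'"
    unfolding t_def using * by (intro diff_frag_eq frag_of_mem) auto
next
  fix a b m assume *: "a \<in> carrier C" "b \<in> carrier B" "m \<in> carrier M"
  have "frag_of (a \<otimes>\<^bsub>C\<^esub> b, m) - frag_of (a, b \<odot>\<^bsub>M\<^esub> m) \<in> Rel"
    unfolding Rel_gens gens_def using * by (intro generate.incl) blast
  then show "t (a \<otimes>\<^bsub>C\<^esub> b) m = t a (b \<odot>\<^bsub>M\<^esub> m)"
    unfolding t_def using * sub by (intro tc_eq frag_of_mem) auto
qed simp

lemma t_add_left: "a \<in> carrier C \<Longrightarrow> a' \<in> carrier C \<Longrightarrow> m \<in> carrier M \<Longrightarrow>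
    t (a \<oplus>\<^bsub>C\<^esub> a') m = t a m \<oplus>\<^bsub>T\<^esub> t a' m"
  and t_add_right: "a \<in> carrier C \<Longrightarrow> m \<in> carrier M \<Longrightarrow> m' \<in> carrier M \<Longrightarrow>
    t a (m \<oplus>\<^bsub>M\<^esub> m') = t a m \<oplus>\<^bsub>T\<^esub> t a m'"
  and t_smult: "a \<in> carrier C \<Longrightarrow> b \<in> carrier B \<Longrightarrow> m \<in> carrier M \<Longrightarrow>
    t (a \<otimes>\<^bsub>C\<^esub> b) m = t a (b \<odot>\<^bsub>M\<^esub> m)"
  using t_balanced unfolding balanced_def by blast+

lemma additive_t_left: "m \<in> carrier M \<Longrightarrow> additive C T (\<lambda>a. t a m)"
  using C.abelian_group_axioms abelian_ind by (intro additiveI) (auto simp: t_add_left)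

lemma additive_t_right: "a \<in> carrier C \<Longrightarrow> additive M T (t a)"
  using M.abelian_group_axioms abelian_ind by (intro additiveI) (auto simp: t_add_right)

text \<open>Zero and negatives need no cases: zero is a pure tensor, and the negative of a pure
  tensor is the one with its first factor negated.\<close>

lemma ind_induct [consumes 1, case_names gen add]:
  assumes "X \<in> carrier T"
    and gen: "\<And>a m. a \<in> carrier C \<Longrightarrow> m \<in> carrier M \<Longrightarrow> P (t a m)"
    and add: "\<And>X Y. X \<in> carrier T \<Longrightarrow> Y \<in> carrier T \<Longrightarrow> P X \<Longrightarrow> P Y \<Longrightarrow> P (X \<oplus>\<^bsub>T\<^esub> Y)"
  shows "P X"
proof -
  obtain x where x: "Poly_Mapping.keys x \<subseteq> CM" "X = tc x" using assms(1) by (rule tc_cases)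
  have zero: "P \<zero>\<^bsub>T\<^esub>" using gen[of "\<zero>\<^bsub>C\<^esub>" "\<zero>\<^bsub>M\<^esub>"] additive_zero[OF additive_t_left[OF M.zero_closed]] by simp
  \<comment> \<open>Induction in the free abelian group proceeds by differences, so the property is
    carried for both signs.\<close>
  have "P (tc x) \<and> P (\<ominus>\<^bsub>T\<^esub> tc x)" using x(1)
  proof (induction x rule: free_Abelian_group_induct[consumes 1, case_names nil diff single])
    case nil
    have m0: "\<ominus>\<^bsub>T\<^esub> \<zero>\<^bsub>T\<^esub> = \<zero>\<^bsub>T\<^esub>" by (rule T.minus_equality) simp_all
    show ?case unfolding tc_0 m0 using zero by blast
  next
    case (diff x y)
    have c: "tc x \<in> carrier T" "tc y \<in> carrier T" using diff tc_closed by auto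
    have "tc (x - y) = tc x \<oplus>\<^bsub>T\<^esub> \<ominus>\<^bsub>T\<^esub> tc y" using tc_diff[OF diff(1,2)] by (simp add: T.minus_eq)
    moreover have "\<ominus>\<^bsub>T\<^esub> (tc x \<oplus>\<^bsub>T\<^esub> \<ominus>\<^bsub>T\<^esub> tc y) = \<ominus>\<^bsub>T\<^esub> tc x \<oplus>\<^bsub>T\<^esub> tc y" using c by (simp add: T.minus_add)
    ultimately show ?case using diff c add by simp
  next
    case (single p)
    then obtain a m where p: "p = (a, m)" "a \<in> carrier C" "m \<in> carrier M" by auto
    have "\<ominus>\<^bsub>T\<^esub> t a m = t (\<ominus>\<^bsub>C\<^esub> a) m" using additive_uminus[OF additive_t_left[OF p(3)] p(2)] by simp
    then show ?case using p gen by (simp add: t_def[symmetric])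
  qed
  then show ?thesis using x by simp
qed

text \<open>Extend \<open>g\<close> additively to the free abelian group. Being balanced means
  killing the three families of generating relations, so the extension descends to the
  quotient.\<close>

lemma universal:
  assumes g: "balanced C B M N g"
  shows "\<exists>h. additive T N h \<and> (\<forall>a\<in>carrier C. \<forall>m\<in>carrier M. h (t a m) = g a m)"
proof -
  interpret N: abelian_group N using g by (simp add: balanced_def)
  have gc: "g a m \<in> carrier N" if "a \<in> carrier C" "m \<in> carrier M" for a m
    using g that by (simp add: balanced_def)
  have "(\<lambda>(a, m). g a m) ` CM \<subseteq> carrier (add_monoid N)" using gc by auto
  from comm_group.free_Abelian_group_universal[OF N.a_comm_group this] obtain h0
    where h0: "h0 \<in> Group.hom FG (add_monoid N)" "\<And>p. p \<in> CM \<Longrightarrow> h0 (frag_of p) = (\<lambda>(a, m). g a m) p" by blast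
  interpret H: group_hom FG "add_monoid N" h0
    using h0(1) by (intro group_hom.intro group_hom_axioms.intro) (auto simp: N.a_group)
  have hf: "h0 (frag_of (a, m)) = g a m" if "a \<in> carrier C" "m \<in> carrier M" for a m
    using h0(2)[of "(a, m)"] that by simp
  have hd: "h0 (x - y) = h0 x \<ominus>\<^bsub>N\<^esub> h0 y" if "Poly_Mapping.keys x \<subseteq> CM" "Poly_Mapping.keys y \<subseteq> CM" for x y
  proof -
    have "h0 x = h0 (x - y) \<oplus>\<^bsub>N\<^esub> h0 y"
      using H.hom_mult[of "x - y" y] that keys_minus_subset[OF that] by simp
    moreover have "h0 x \<in> carrier N" "h0 y \<in> carrier N" "h0 (x - y) \<in> carrier N"
      using H.hom_closed that keys_minus_subset[OF that] by auto
    ultimately show ?thesis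
      by (metis N.a_assoc N.a_inv_closed N.minus_eq N.r_neg N.r_zero)
  qed
  have sub2: "g a m \<oplus>\<^bsub>N\<^esub> g a' m' \<ominus>\<^bsub>N\<^esub> g a m \<ominus>\<^bsub>N\<^esub> g a' m' = \<zero>\<^bsub>N\<^esub>"
    if "a \<in> carrier C" "a' \<in> carrier C" "m \<in> carrier M" "m' \<in> carrier M" for a a' m m'
  proof -
    have u: "u \<oplus>\<^bsub>N\<^esub> v \<ominus>\<^bsub>N\<^esub> u \<ominus>\<^bsub>N\<^esub> v = (u \<oplus>\<^bsub>N\<^esub> v) \<oplus>\<^bsub>N\<^esub> \<ominus>\<^bsub>N\<^esub> (u \<oplus>\<^bsub>N\<^esub> v)"
      if "u \<in> carrier N" "v \<in> carrier N" for u v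
      using that by (simp add: N.minus_eq N.minus_add N.a_assoc)
    have c: "g a m \<in> carrier N" "g a' m' \<in> carrier N" using gc that by auto
    show ?thesis unfolding u[OF c] using c by (intro N.r_neg N.a_closed)
  qed
  have "gens \<subseteq> kernel FG (add_monoid N) h0"
  proof
    fix z assume z: "z \<in> gens"
    then have "h0 z = \<zero>\<^bsub>N\<^esub>"
    proof (cases rule: gens_cases)
      case (left a a' m)
      have "h0 z = h0 (frag_of (a \<oplus>\<^bsub>C\<^esub> a', m)) \<ominus>\<^bsub>N\<^esub> h0 (frag_of (a, m)) \<ominus>\<^bsub>N\<^esub> h0 (frag_of (a', m))"
      proof -
        note f = frag_of_mem[OF C.a_closed[OF left(1,2)] left(3)] frag_of_mem[OF left(1,3)] frag_of_mem[OF left(2,3)]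
        show ?thesis unfolding left(4) hd[OF keys_minus_subset[OF f(1,2)] f(3)] hd[OF f(1,2)] ..
      qed
      also have "\<dots> = g a m \<oplus>\<^bsub>N\<^esub> g a' m \<ominus>\<^bsub>N\<^esub> g a m \<ominus>\<^bsub>N\<^esub> g a' m"
        using left(1-3) g by (simp add: hf balanced_def)
      finally show ?thesis using sub2 left(1-3) by simp
    next
      case (right a m m')
      have "h0 z = h0 (frag_of (a, m \<oplus>\<^bsub>M\<^esub> m')) \<ominus>\<^bsub>N\<^esub> h0 (frag_of (a, m)) \<ominus>\<^bsub>N\<^esub> h0 (frag_of (a, m'))"
      proof -
        note f = frag_of_mem[OF right(1) M.a_closed[OF right(2,3)]] frag_of_mem[OF right(1,2)] frag_of_mem[OF right(1,3)]
        show ?thesis unfolding right(4) hd[OF keys_minus_subset[OF f(1,2)] f(3)] hd[OF f(1,2)] ..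
      qed
      also have "\<dots> = g a m \<oplus>\<^bsub>N\<^esub> g a m' \<ominus>\<^bsub>N\<^esub> g a m \<ominus>\<^bsub>N\<^esub> g a m'"
        using right(1-3) g by (simp add: hf balanced_def)
      finally show ?thesis using sub2 right(1-3) by simp
    next
      case (mid a b m)
      have c: "a \<otimes>\<^bsub>C\<^esub> b \<in> carrier C" "b \<odot>\<^bsub>M\<^esub> m \<in> carrier M" using mid sub by auto
      have "h0 z = g (a \<otimes>\<^bsub>C\<^esub> b) m \<ominus>\<^bsub>N\<^esub> g a (b \<odot>\<^bsub>M\<^esub> m)"
        unfolding mid(4) hd[OF frag_of_mem[OF c(1) mid(3)] frag_of_mem[OF mid(1) c(2)]]
          hf[OF c(1) mid(3)] hf[OF mid(1) c(2)] ..
      also have "g (a \<otimes>\<^bsub>C\<^esub> b) m = g a (b \<odot>\<^bsub>M\<^esub> m)" using g mid(1-3) by (simp add: balanced_def)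
      finally show ?thesis using gc[OF mid(1) c(2)] by (simp add: N.minus_eq N.r_neg)
    qed
    then show "z \<in> kernel FG (add_monoid N) h0"
      using subsetD[OF generators_subset z] by (simp add: kernel_def)
  qed
  then have "Rel \<subseteq> kernel FG (add_monoid N) h0"
    unfolding Rel_gens by (rule FG.generate_subgroup_incl[OF _ H.subgroup_kernel])
  from H.FactGroup_universal_kernel[OF Rel_normal this] obtain h
    where h: "h \<in> Group.hom (FG Mod Rel) (add_monoid N)" "\<And>x. x \<in> carrier FG \<Longrightarrow> h (Rel #>\<^bsub>FG\<^esub> x) = h0 x" by blast
  have "additive T N h"
    using h(1) abelian_ind N.abelian_group_axioms
    by (intro additiveI) (auto simp: ind_simps Group.hom_def Pi_iff simp del: mult_FactGroup)
  moreover have "h (t a m) = g a m" if "a \<in> carrier C" "m \<in> carrier M" for a m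
    using h(2)[of "frag_of (a, m)"] that hf by (simp add: t_def tensor_coset_def)
  ultimately show ?thesis by blast
qed

lemma additive_eqI:
  assumes h: "additive T N h" "additive T N h'"
    and "\<And>a m. a \<in> carrier C \<Longrightarrow> m \<in> carrier M \<Longrightarrow> h (t a m) = h' (t a m)" and X: "X \<in> carrier T"
  shows "h X = h' X"
  using X by (induction rule: ind_induct) (auto simp: assms(3) additive_add[OF h(1)] additive_add[OF h(2)])

end

text \<open>The maps in \<open>ind\<close> and \<open>ind_mor\<close>, given on representatives, are the unique additive maps with the
  expected values on pure tensors.\<close>

lemma union_lift:
  assumes "tensor_product C B M" "tensor_product C B M'"
    and p: "\<And>a m. a \<in> carrier C \<Longrightarrow> m \<in> carrier M \<Longrightarrow> fst (p a m) \<in> carrier C \<and> snd (p a m) \<in> carrier M'"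
    and E: "\<And>a m. E (a, m) = frag_of (p a m)"
    and bal: "balanced C B M (ind C B M') (\<lambda>a m. tensor_coset C B M' (frag_of (p a m)))"
  defines "h \<equiv> \<lambda>X. \<Union>x\<in>X. tensor_coset C B M' (frag_extend E x)"
  shows "additive (ind C B M) (ind C B M') h"
    and "\<And>a m. a \<in> carrier C \<Longrightarrow> m \<in> carrier M \<Longrightarrow>
      h (tensor_coset C B M (frag_of (a, m))) = tensor_coset C B M' (frag_of (p a m))"
proof -
  interpret X: tensor_product C B M by fact
  interpret Y: tensor_product C B M' by fact
  obtain k where k: "additive X.T Y.T k"
    "\<And>a m. a \<in> carrier C \<Longrightarrow> m \<in> carrier M \<Longrightarrow> k (X.t a m) = Y.tc (frag_of (p a m))"
    using X.universal[OF bal] by blast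
  \<comment> \<open>On every representative the explicit formula gives the value of the map
    \<open>k\<close> from the universal property, so the union is over copies of one coset.\<close>
  have Ez: "Poly_Mapping.keys (frag_extend E z) \<subseteq> Y.CM \<and> Y.tc (frag_extend E z) = k (X.tc z)"
    if "Poly_Mapping.keys z \<subseteq> X.CM" for z
    using that
  proof (induction z rule: free_Abelian_group_induct[consumes 1, case_names nil diff single])
    case nil
    then show ?case using additive_zero[OF k(1)] by (simp add: X.tc_0 Y.tc_0)
  next
    case (diff x y)
    then have c: "X.tc x \<in> carrier X.T" "X.tc y \<in> carrier X.T" using X.tc_closed by auto
    then have "k (X.tc (x - y)) = k (X.tc x) \<ominus>\<^bsub>Y.T\<^esub> k (X.tc y)"
      using X.tc_diff[OF diff(1,2)] additive_add[OF k(1) c(1) X.T.a_inv_closed[OF c(2)]] additive_uminus[OF k(1) c(2)]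
      by (simp add: X.T.minus_eq Y.T.minus_eq)
    then show ?case
      using diff Y.keys_minus_subset[of "frag_extend E x" Y.CM "frag_extend E y"]
        Y.tc_diff[of "frag_extend E x" "frag_extend E y"] by (simp add: frag_extend_diff)
  next
    case (single q)
    then obtain a m where "q = (a, m)" "a \<in> carrier C" "m \<in> carrier M" by auto
    then show ?case using k(2)[of a m] p[of a m] by (cases "p a m") (auto simp: X.t_def E)
  qed
  have hk: "h X = k X" if "X \<in> carrier X.T" for X
  proof -
    obtain z where z: "Poly_Mapping.keys z \<subseteq> X.CM" "X = X.tc z" using \<open>X \<in> carrier X.T\<close> by (rule X.tc_cases)
    have "Y.tc (frag_extend E x) = k X" if "x \<in> X" for x
      using X.tc_mem[of x z] z that Ez[of x] by simp
    moreover have "z \<in> X" using X.tc_self[OF z(1)] z(2) by simp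
    ultimately show ?thesis unfolding h_def by auto
  qed
  show "additive X.T Y.T h"
    using k(1) X.abelian_ind Y.abelian_ind
    by (intro additiveI) (auto simp: hk additive_closed additive_add[OF k(1)])
  show "h (X.tc (frag_of (a, m))) = Y.tc (frag_of (p a m))" if "a \<in> carrier C" "m \<in> carrier M" for a m
    using hk[OF X.t_closed[OF that]] k(2)[OF that] by (simp add: X.t_def)
qed

section \<open>Induction along a graded Frobenius extension\<close>

lemma additive_smult: "Module.module A M \<Longrightarrow> a \<in> carrier A \<Longrightarrow> additive M M (\<lambda>m. a \<odot>\<^bsub>M\<^esub> m)"
proof -
  assume M: "Module.module A M" and a: "a \<in> carrier A"
  interpret module A M by fact
  show ?thesis using a abelian_group_axioms by (intro additiveI) (auto simp: smult_r_distr)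
qed

lemma additive_smult_left: "Module.module A M \<Longrightarrow> m \<in> carrier M \<Longrightarrow> additive A M (\<lambda>a. a \<odot>\<^bsub>M\<^esub> m)"
proof -
  assume M: "Module.module A M" and m: "m \<in> carrier M"
  interpret module A M by fact
  show ?thesis using m abelian_group_axioms R.abelian_group_axioms
    by (intro additiveI) (auto simp: smult_l_distr)
qed

text \<open>\<open>fin_dim\<close> sums over a set of vectors, while the family \<open>v\<close> may
  repeat. Phrasing the span through sets \<open>L\<close> closed under addition avoids regrouping
  coefficients.\<close>

lemma fin_dim_family:
  assumes M: "Module.module A M" and "finite K" and v: "\<And>k. k \<in> K \<Longrightarrow> v k \<in> carrier M"
    and span: "\<And>m L. m \<in> carrier M \<Longrightarrow> \<zero>\<^bsub>M\<^esub> \<in> L \<Longrightarrow> (\<And>u w. u \<in> L \<Longrightarrow> w \<in> L \<Longrightarrow> u \<oplus>\<^bsub>M\<^esub> w \<in> L) \<Longrightarrow>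
      L \<subseteq> carrier M \<Longrightarrow> (\<And>c k. k \<in> K \<Longrightarrow> const A c \<odot>\<^bsub>M\<^esub> v k \<in> L) \<Longrightarrow> m \<in> L"
    and const: "\<And>c. const A c \<in> carrier A" "\<And>c d. const A (c + d) = const A c \<oplus>\<^bsub>A\<^esub> const A d"
      "const A 0 = \<zero>\<^bsub>A\<^esub>"
  shows "fin_dim A M"
proof -
  interpret module A M by fact
  let ?B = "v ` K"
  define L where "L = {m. \<exists>c. m = (\<Oplus>\<^bsub>M\<^esub>b\<in>?B. const A (c b) \<odot>\<^bsub>M\<^esub> b)}"
  have B: "finite ?B" "?B \<subseteq> carrier M" using assms(2) v by auto
  have z: "const A 0 \<odot>\<^bsub>M\<^esub> b = \<zero>\<^bsub>M\<^esub>" if "b \<in> carrier M" for b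
    using additive_zero[OF additive_smult_left[OF M that]] const(3) by simp
  have L0: "\<zero>\<^bsub>M\<^esub> \<in> L"
  proof -
    have "(\<Oplus>\<^bsub>M\<^esub>b\<in>?B. const A 0 \<odot>\<^bsub>M\<^esub> b) = (\<Oplus>\<^bsub>M\<^esub>b\<in>?B. \<zero>\<^bsub>M\<^esub>)"
      using B z by (intro M.finsum_cong') auto
    then show ?thesis unfolding L_def by (auto intro!: exI[of _ "\<lambda>_. 0"])
  qed
  have Ladd: "u \<oplus>\<^bsub>M\<^esub> w \<in> L" if uw: "u \<in> L" "w \<in> L" for u w
  proof -
    from uw obtain c d where u: "u = (\<Oplus>\<^bsub>M\<^esub>b\<in>?B. const A (c b) \<odot>\<^bsub>M\<^esub> b)"
      and w: "w = (\<Oplus>\<^bsub>M\<^esub>b\<in>?B. const A (d b) \<odot>\<^bsub>M\<^esub> b)" unfolding L_def by blast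
    have "u \<oplus>\<^bsub>M\<^esub> w = (\<Oplus>\<^bsub>M\<^esub>b\<in>?B. const A (c b) \<odot>\<^bsub>M\<^esub> b \<oplus>\<^bsub>M\<^esub> const A (d b) \<odot>\<^bsub>M\<^esub> b)"
      unfolding u w using B const(1) by (intro M.finsum_addf[symmetric]) auto
    also have "\<dots> = (\<Oplus>\<^bsub>M\<^esub>b\<in>?B. const A (c b + d b) \<odot>\<^bsub>M\<^esub> b)"
      using B const(1) by (intro M.finsum_cong') (auto simp: const(2) smult_l_distr)
    finally show ?thesis unfolding L_def by (intro CollectI exI[of _ "\<lambda>b. c b + d b"])
  qed
  have Lv: "const A c \<odot>\<^bsub>M\<^esub> v k \<in> L" if k: "k \<in> K" for c k
  proof -
    have "(\<Oplus>\<^bsub>M\<^esub>b\<in>?B. const A (if b = v k then c else 0) \<odot>\<^bsub>M\<^esub> b) =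
        (\<Oplus>\<^bsub>M\<^esub>b\<in>?B. if v k = b then const A c \<odot>\<^bsub>M\<^esub> b else \<zero>\<^bsub>M\<^esub>)"
      using B z const(1) by (intro M.finsum_cong') auto
    also have "\<dots> = const A c \<odot>\<^bsub>M\<^esub> v k"
      using B k v const(1) by (intro M.finsum_singleton) auto
    finally show ?thesis unfolding L_def by (intro CollectI exI[of _ "\<lambda>b. if b = v k then c else 0"]) simp
  qed
  have Lsub: "L \<subseteq> carrier M" unfolding L_def using B const(1) by (auto intro!: M.finsum_closed)
  show ?thesis
    unfolding fin_dim_def
  proof (intro exI[of _ ?B] conjI ballI B)
    fix m assume "m \<in> carrier M"
    then have "m \<in> L" by (rule span[OF _ L0 Ladd Lsub Lv])
    then show "\<exists>c. m = (\<Oplus>\<^bsub>M\<^esub>b\<in>?B. const A (c b) \<odot>\<^bsub>M\<^esub> b)" by (simp add: L_def)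
  qed
qed

context tensor_product
begin

interpretation Q: comm_group "FG Mod Rel"
  by (rule comm_group.abelian_FactGroup[OF abelian_free_Abelian_group Rel_subgroup])

lemma inv_ind: "X \<in> carrier T \<Longrightarrow> inv\<^bsub>FG Mod Rel\<^esub> X = \<ominus>\<^bsub>T\<^esub> X"
  using Q.l_inv[of X] Q.inv_closed[of X] T.minus_equality[of "inv\<^bsub>FG Mod Rel\<^esub> X" X]
  by (simp add: ind_simps del: mult_FactGroup one_FactGroup)

lemma grade_ind: "grade T d = generate (FG Mod Rel) {t a m | a m. \<exists>i j. i + j = d \<and> a \<in> grade C i \<and> m \<in> grade M j}"
  by (simp add: ind_def Let_def t_def)

lemma grade_t: "a \<in> grade C i \<Longrightarrow> m \<in> grade M j \<Longrightarrow> t a m \<in> grade T (i + j)"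
  unfolding grade_ind by (rule generate.incl) blast

lemma grade_ind_subgroup:
  assumes "\<And>d. grade C d \<subseteq> carrier C" "\<And>d. grade M d \<subseteq> carrier M"
  shows "additive_subgroup (grade T d) T"
proof (rule T.additive_subgroupI)
  let ?S = "{t a m | a m. \<exists>i j. i + j = d \<and> a \<in> grade C i \<and> m \<in> grade M j}"
  have S: "?S \<subseteq> carrier (FG Mod Rel)" using assms t_closed unfolding ind_simps(1)[symmetric] by blast
  show sub: "grade T d \<subseteq> carrier T" unfolding grade_ind ind_simps(1) by (rule Q.generate_incl[OF S])
  show "\<zero>\<^bsub>T\<^esub> \<in> grade T d" unfolding grade_ind ind_simps(3) by (rule generate.one)
  show "u \<oplus>\<^bsub>T\<^esub> v \<in> grade T d" if "u \<in> grade T d" "v \<in> grade T d" for u v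
    using that unfolding grade_ind ind_simps(2) by (rule generate.eng)
  show "\<ominus>\<^bsub>T\<^esub> u \<in> grade T d" if "u \<in> grade T d" for u
  proof -
    have "inv\<^bsub>FG Mod Rel\<^esub> u \<in> grade T d"
      using Q.generate_m_inv_closed[OF S] that unfolding grade_ind by blast
    then show ?thesis using inv_ind that sub by auto
  qed
qed

text \<open>A graded piece of the tensor product is generated by pure tensors of homogeneous
  elements, so a degree condition on an additive map need only be checked on these.\<close>

lemma grade_additive_image:
  assumes h: "additive T N h" and K: "additive_subgroup K N"
    and gen: "\<And>a m i j. i + j = d \<Longrightarrow> a \<in> grade C i \<Longrightarrow> m \<in> grade M j \<Longrightarrow> h (t a m) \<in> K"
    and sub: "\<And>d. grade C d \<subseteq> carrier C" "\<And>d. grade M d \<subseteq> carrier M"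
    and X: "X \<in> grade T d"
  shows "h X \<in> K"
proof -
  have tc: "t a m \<in> carrier T" if "a \<in> grade C i" "m \<in> grade M j" for a m i j
    using that sub by (intro t_closed) auto
  have "X \<in> carrier T \<and> h X \<in> K"
    using X unfolding grade_ind
  proof (induction rule: generate.induct)
    case one
    show ?case using additive_zero[OF h] additive_subgroup.zero_closed[OF K]
      unfolding ind_simps(3)[symmetric] by simp
  next
    case (incl g)
    then show ?case using gen tc by auto
  next
    case (inv g)
    then obtain a m i j where g: "g = t a m" "i + j = d" "a \<in> grade C i" "m \<in> grade M j" by auto
    have c: "t a m \<in> carrier T" using tc g by blast
    have "h (\<ominus>\<^bsub>T\<^esub> t a m) \<in> K"
      unfolding additive_uminus[OF h c] using additive_subgroup.a_inv_closed[OF K] gen g(2-4) by blast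
    then show ?case using g(1) c inv_ind by simp
  next
    case (eng u v)
    then show ?case
      using additive_add[OF h] additive_subgroup.a_closed[OF K] T.a_closed
      unfolding ind_simps(2)[symmetric] by simp
  qed
  then show ?thesis ..
qed

end

text \<open>A graded Frobenius extension \<open>C\<close> of \<open>B\<close>: a
  \<open>B\<close>-linear trace \<open>D\<close> of degree \<open>- k\<close>, and two families
  whose degrees at each index sum to \<open>k\<close>, each giving coefficients for expansion in the
  other. \<open>B\<close> carries the operations of \<open>C\<close>.\<close>

locale frobenius_pair =
  fixes C B :: "(complex, 'a) graded" and D :: "'a \<Rightarrow> 'a" and I :: "'i set" and x y :: "'i \<Rightarrow> 'a"
    and e :: "'i \<Rightarrow> int" and k :: int
  assumes cring_C: "cring C" and cring_B: "cring B"
    and B_ops: "monoid.mult B = monoid.mult C" "add B = add C" "\<one>\<^bsub>B\<^esub> = \<one>\<^bsub>C\<^esub>" "ring.zero B = ring.zero C"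
    and const_eq: "const B c = const C c"
    and sub: "carrier B \<subseteq> carrier C"
    and gradeB: "grade B d \<subseteq> carrier B" "grade B d \<subseteq> grade C d"
    and gradeC: "grade C d \<subseteq> carrier C"
    and one_grade: "\<one>\<^bsub>C\<^esub> \<in> grade C 0"
    and grade_mult: "a \<in> grade C p \<Longrightarrow> b \<in> grade C q \<Longrightarrow> a \<otimes>\<^bsub>C\<^esub> b \<in> grade C (p + q)"
    and const_B: "const C c \<in> carrier B"
    and const_add: "const C (c + c') = const C c \<oplus>\<^bsub>C\<^esub> const C c'" and const_0: "const C 0 = \<zero>\<^bsub>C\<^esub>"
    and D_closed: "a \<in> carrier C \<Longrightarrow> D a \<in> carrier B"
    and D_add: "a \<in> carrier C \<Longrightarrow> a' \<in> carrier C \<Longrightarrow> D (a \<oplus>\<^bsub>C\<^esub> a') = D a \<oplus>\<^bsub>C\<^esub> D a'"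
    and D_mult: "b \<in> carrier B \<Longrightarrow> a \<in> carrier C \<Longrightarrow> D (b \<otimes>\<^bsub>C\<^esub> a) = b \<otimes>\<^bsub>C\<^esub> D a"
    and D_grade: "a \<in> grade C d \<Longrightarrow> D a \<in> grade B (d - k)"
    and finite_I: "finite I"
    and x_grade: "i \<in> I \<Longrightarrow> x i \<in> grade C (k - e i)"
    and y_grade: "i \<in> I \<Longrightarrow> y i \<in> grade C (e i)"
    and expand_y: "a \<in> carrier C \<Longrightarrow> a = (\<Oplus>\<^bsub>C\<^esub>i\<in>I. D (a \<otimes>\<^bsub>C\<^esub> x i) \<otimes>\<^bsub>C\<^esub> y i)"
    and expand_x: "a \<in> carrier C \<Longrightarrow> a = (\<Oplus>\<^bsub>C\<^esub>i\<in>I. D (a \<otimes>\<^bsub>C\<^esub> y i) \<otimes>\<^bsub>C\<^esub> x i)"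
begin

sublocale C: cring C by (rule cring_C)

lemma x_closed [simp]: "i \<in> I \<Longrightarrow> x i \<in> carrier C" and y_closed [simp]: "i \<in> I \<Longrightarrow> y i \<in> carrier C"
  using x_grade y_grade gradeC by blast+

lemma BC: "b \<in> carrier B \<Longrightarrow> b \<in> carrier C"
  using sub by blast

lemma D_C [simp]: "a \<in> carrier C \<Longrightarrow> D a \<in> carrier C"
  using D_closed BC by blast

lemma const_C [simp]: "const C c \<in> carrier C"
  using const_B BC by blast

lemma res_simps [simp]: "carrier (res B N) = carrier N" "add (res B N) = add N" "\<zero>\<^bsub>res B N\<^esub> = \<zero>\<^bsub>N\<^esub>"
  "grade (res B N) = grade N" "b \<in> carrier B \<Longrightarrow> b \<odot>\<^bsub>res B N\<^esub> n = b \<odot>\<^bsub>N\<^esub> n"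
  by (simp_all add: res_def)

lemma abelian_res: "abelian_group N \<Longrightarrow> abelian_group (res B N)"
proof -
  assume "abelian_group N"
  then interpret abelian_group N .
  show ?thesis by (rule abelian_groupI) (auto simp: a_assoc intro: a_comm bexI[OF _ a_inv_closed] l_neg)
qed

lemma additive_subgroup_transfer:
  assumes "carrier N = carrier N'" "add N = add N'" "\<zero>\<^bsub>N\<^esub> = \<zero>\<^bsub>N'\<^esub>" "additive_subgroup K N"
  shows "additive_subgroup K N'"
  using assms by (auto simp: additive_subgroup_def subgroup_def m_inv_def)

lemma module_res:
  assumes "Module.module C N" shows "Module.module B (res B N)"
proof -
  interpret N: module C N by fact
  interpret B: cring B by (rule cring_B)
  show ?thesis
  proof (rule moduleI[OF cring_B abelian_res[OF N.abelian_group_axioms]])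
    show "\<one>\<^bsub>B\<^esub> \<odot>\<^bsub>res B N\<^esub> n = n" if "n \<in> carrier (res B N)" for n
      using that B.one_closed by (simp add: B_ops(3)[symmetric]) (simp add: B_ops)
    show "(a \<otimes>\<^bsub>B\<^esub> b) \<odot>\<^bsub>res B N\<^esub> n = a \<odot>\<^bsub>res B N\<^esub> (b \<odot>\<^bsub>res B N\<^esub> n)"
      if "a \<in> carrier B" "b \<in> carrier B" "n \<in> carrier (res B N)" for a b n
      using that B.m_closed[OF that(1,2)] BC by (simp add: B_ops N.smult_assoc1)
    show "(a \<oplus>\<^bsub>B\<^esub> b) \<odot>\<^bsub>res B N\<^esub> n = a \<odot>\<^bsub>res B N\<^esub> n \<oplus>\<^bsub>res B N\<^esub> b \<odot>\<^bsub>res B N\<^esub> n"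
      if "a \<in> carrier B" "b \<in> carrier B" "n \<in> carrier (res B N)" for a b n
      using that B.a_closed[OF that(1,2)] BC by (simp add: B_ops N.smult_l_distr)
  qed (use BC in \<open>auto simp: N.smult_r_distr\<close>)
qed

lemma finsum_res: "finsum (res B N) f A = finsum N f A"
  by (rule finsum_carrier_add_zero) simp_all

lemma res_gmod:
  assumes N: "N \<in> gmod C" shows "res B N \<in> gmod B"
proof -
  note n = gmodD[OF N]
  have "fin_dim B (res B N)"
    using n(2) unfolding fin_dim_def finsum_res const_eq by (simp add: const_B)
  moreover have "graded_decomp (res B N)"
    using n(3) additive_subgroup_transfer[of N "res B N"] unfolding graded_decomp_def finsum_res by simp
  moreover have "a \<odot>\<^bsub>res B N\<^esub> m \<in> grade (res B N) (i + j)" if "a \<in> grade B i" "m \<in> grade (res B N) j" for a m i j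
    using n(6)[OF subsetD[OF gradeB(2) that(1)], of m j] that(2) res_simps(5)[OF subsetD[OF gradeB(1) that(1)], of N m]
    by simp
  ultimately show ?thesis
    using module_res[OF n(1)] by (simp add: gmod_def)
qed

lemma res_functor: "gfunctor C B (res B) res_mor"
  unfolding gfunctor_def res_mor_def
  using res_gmod BC by (auto simp: ghom_def)

end

locale frob_ind = frobenius_pair C B D I x y e k
  for C B :: "(complex, 'a) graded" and D and I :: "'i set" and x y e k +
  fixes M :: "('a, 'm) graded"
  assumes M: "M \<in> gmod B"
begin

sublocale tensor_product C B M
  by (rule tensor_product.intro[OF cring_C gmodD(1)[OF M] sub])

sublocale GM: graded_group M by (rule gmodD(4)[OF M])

lemma smult_assoc_C: "a \<in> carrier B \<Longrightarrow> b \<in> carrier B \<Longrightarrow> m \<in> carrier M \<Longrightarrow>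
    (a \<otimes>\<^bsub>C\<^esub> b) \<odot>\<^bsub>M\<^esub> m = a \<odot>\<^bsub>M\<^esub> (b \<odot>\<^bsub>M\<^esub> m)"
  using M.smult_assoc1 B_ops by simp

lemma smult_add_C: "a \<in> carrier B \<Longrightarrow> b \<in> carrier B \<Longrightarrow> m \<in> carrier M \<Longrightarrow>
    (a \<oplus>\<^bsub>C\<^esub> b) \<odot>\<^bsub>M\<^esub> m = a \<odot>\<^bsub>M\<^esub> m \<oplus>\<^bsub>M\<^esub> b \<odot>\<^bsub>M\<^esub> m"
  using M.smult_l_distr B_ops by simp

lemma smult_ind:
  assumes a: "a \<in> carrier C"
  shows "additive T T (\<lambda>X. a \<odot>\<^bsub>T\<^esub> X)"
    and "\<And>a' m. a' \<in> carrier C \<Longrightarrow> m \<in> carrier M \<Longrightarrow> a \<odot>\<^bsub>T\<^esub> t a' m = t (a \<otimes>\<^bsub>C\<^esub> a') m"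
proof -
  have s: "(\<odot>\<^bsub>T\<^esub>) a = (\<lambda>X. \<Union>x\<in>X. tc (frag_extend (\<lambda>(a', m). frag_of (a \<otimes>\<^bsub>C\<^esub> a', m)) x))"
    by (simp add: ind_def Let_def)
  have bal: "balanced C B M T (\<lambda>a' m. tc (frag_of (a \<otimes>\<^bsub>C\<^esub> a', m)))"
    unfolding t_def[symmetric] balanced_def using a BC abelian_ind
    by (auto simp: C.r_distr t_add_left t_add_right t_smult C.m_assoc[symmetric])
  note u = union_lift[OF tensor_product_axioms tensor_product_axioms _ _ bal, of "\<lambda>(a', m). frag_of (a \<otimes>\<^bsub>C\<^esub> a', m)"]
  show "additive T T (\<lambda>X. a \<odot>\<^bsub>T\<^esub> X)" unfolding s using u(1) a by simp
  show "a \<odot>\<^bsub>T\<^esub> t a' m = t (a \<otimes>\<^bsub>C\<^esub> a') m" if "a' \<in> carrier C" "m \<in> carrier M" for a' m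
    unfolding s t_def using u(2)[OF _ _ that] a by simp
qed

lemma module_ind: "Module.module C T"
proof (rule moduleI[OF cring_C abelian_ind])
  show cl: "a \<odot>\<^bsub>T\<^esub> X \<in> carrier T" if "a \<in> carrier C" "X \<in> carrier T" for a X
    using additive_closed[OF smult_ind(1)] that .
  show "a \<odot>\<^bsub>T\<^esub> (X \<oplus>\<^bsub>T\<^esub> Y) = a \<odot>\<^bsub>T\<^esub> X \<oplus>\<^bsub>T\<^esub> a \<odot>\<^bsub>T\<^esub> Y"
    if "a \<in> carrier C" "X \<in> carrier T" "Y \<in> carrier T" for a X Y
    using additive_add[OF smult_ind(1)] that .
  show "(a \<oplus>\<^bsub>C\<^esub> b) \<odot>\<^bsub>T\<^esub> X = a \<odot>\<^bsub>T\<^esub> X \<oplus>\<^bsub>T\<^esub> b \<odot>\<^bsub>T\<^esub> X"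
    if ab: "a \<in> carrier C" "b \<in> carrier C" and X: "X \<in> carrier T" for a b X
  proof (rule additive_eqI[OF smult_ind(1)[OF C.a_closed[OF ab]] _ _ X])
    show "additive T T (\<lambda>X. a \<odot>\<^bsub>T\<^esub> X \<oplus>\<^bsub>T\<^esub> b \<odot>\<^bsub>T\<^esub> X)"
      using ab abelian_ind cl by (intro additiveI) (auto simp: additive_add[OF smult_ind(1)] T.a_ac)
  qed (use ab in \<open>auto simp: smult_ind(2) C.l_distr t_add_left\<close>)
  show "(a \<otimes>\<^bsub>C\<^esub> b) \<odot>\<^bsub>T\<^esub> X = a \<odot>\<^bsub>T\<^esub> (b \<odot>\<^bsub>T\<^esub> X)"
    if ab: "a \<in> carrier C" "b \<in> carrier C" and X: "X \<in> carrier T" for a b X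
    by (rule additive_eqI[OF smult_ind(1)[OF C.m_closed[OF ab]]
        additive_comp[OF smult_ind(1)[OF ab(2)] smult_ind(1)[OF ab(1)]] _ X])
      (use ab in \<open>auto simp: smult_ind(2) C.m_assoc\<close>)
  show "\<one>\<^bsub>C\<^esub> \<odot>\<^bsub>T\<^esub> X = X" if X: "X \<in> carrier T" for X
    by (rule additive_eqI[OF smult_ind(1)[OF C.one_closed] additiveI[OF abelian_ind abelian_ind] _ X])
      (auto simp: smult_ind(2))
qed

sublocale TM: module C T by (rule module_ind)

text \<open>The trace applied to the first factor, then acting on the second. It is the counit of
  the adjunction that has restriction on the left.\<close>

definition eps :: "('a \<times> 'm \<Rightarrow>\<^sub>0 int) set \<Rightarrow> 'm" where
  "eps = (SOME h. additive T M h \<and> (\<forall>a\<in>carrier C. \<forall>m\<in>carrier M. h (t a m) = D a \<odot>\<^bsub>M\<^esub> m))"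

lemma eps: "additive T M eps" "a \<in> carrier C \<Longrightarrow> m \<in> carrier M \<Longrightarrow> eps (t a m) = D a \<odot>\<^bsub>M\<^esub> m"
proof -
  have "D (a \<otimes>\<^bsub>C\<^esub> b) \<odot>\<^bsub>M\<^esub> m = D a \<odot>\<^bsub>M\<^esub> (b \<odot>\<^bsub>M\<^esub> m)"
    if *: "a \<in> carrier C" "b \<in> carrier B" "m \<in> carrier M" for a b m
  proof -
    have "D (a \<otimes>\<^bsub>C\<^esub> b) = D a \<otimes>\<^bsub>C\<^esub> b" using D_mult[OF *(2,1)] * BC by (simp add: C.m_comm)
    then show ?thesis using * by (simp add: smult_assoc_C D_closed)
  qed
  then have "balanced C B M M (\<lambda>a m. D a \<odot>\<^bsub>M\<^esub> m)"
    unfolding balanced_def using M.abelian_group_axioms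
    by (auto simp: D_closed D_add smult_add_C M.smult_r_distr)
  from someI_ex[OF universal[OF this]]
  show "additive T M eps" "a \<in> carrier C \<Longrightarrow> m \<in> carrier M \<Longrightarrow> eps (t a m) = D a \<odot>\<^bsub>M\<^esub> m"
    unfolding eps_def by blast+
qed

lemma eps_closed [simp]: "X \<in> carrier T \<Longrightarrow> eps X \<in> carrier M"
  using additive_closed[OF eps(1)] .

text \<open>For a pure tensor, expand the first factor in \<open>y\<close> and move the
  coefficients, which lie in \<open>B\<close>, across the tensor sign.\<close>

lemma expand_ind:
  assumes X: "X \<in> carrier T"
  shows "X = (\<Oplus>\<^bsub>T\<^esub>i\<in>I. t (y i) (eps (x i \<odot>\<^bsub>T\<^esub> X)))"
proof (rule additive_eqI[OF _ _ _ X])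
  have ad: "additive T T (\<lambda>X. t (y i) (eps (x i \<odot>\<^bsub>T\<^esub> X)))" if "i \<in> I" for i
    using additive_comp[OF additive_comp[OF smult_ind(1) eps(1)] additive_t_right] that by simp
  show "additive T T (\<lambda>X. X)" using abelian_ind by (intro additiveI) auto
  show "additive T T (\<lambda>X. \<Oplus>\<^bsub>T\<^esub>i\<in>I. t (y i) (eps (x i \<odot>\<^bsub>T\<^esub> X)))"
  proof (rule additiveI[OF abelian_ind abelian_ind])
    fix u v assume uv: "u \<in> carrier T" "v \<in> carrier T"
    have "(\<Oplus>\<^bsub>T\<^esub>i\<in>I. t (y i) (eps (x i \<odot>\<^bsub>T\<^esub> (u \<oplus>\<^bsub>T\<^esub> v)))) =
        (\<Oplus>\<^bsub>T\<^esub>i\<in>I. t (y i) (eps (x i \<odot>\<^bsub>T\<^esub> u)) \<oplus>\<^bsub>T\<^esub> t (y i) (eps (x i \<odot>\<^bsub>T\<^esub> v)))"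
      using uv by (intro T.finsum_cong') (auto simp: additive_add[OF ad])
    also have "\<dots> = (\<Oplus>\<^bsub>T\<^esub>i\<in>I. t (y i) (eps (x i \<odot>\<^bsub>T\<^esub> u))) \<oplus>\<^bsub>T\<^esub> (\<Oplus>\<^bsub>T\<^esub>i\<in>I. t (y i) (eps (x i \<odot>\<^bsub>T\<^esub> v)))"
      using uv by (intro T.finsum_addf) auto
    finally show "(\<Oplus>\<^bsub>T\<^esub>i\<in>I. t (y i) (eps (x i \<odot>\<^bsub>T\<^esub> (u \<oplus>\<^bsub>T\<^esub> v)))) =
      (\<Oplus>\<^bsub>T\<^esub>i\<in>I. t (y i) (eps (x i \<odot>\<^bsub>T\<^esub> u))) \<oplus>\<^bsub>T\<^esub> (\<Oplus>\<^bsub>T\<^esub>i\<in>I. t (y i) (eps (x i \<odot>\<^bsub>T\<^esub> v)))" .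
  qed (auto intro!: T.finsum_closed)
  fix a m assume am: "a \<in> carrier C" "m \<in> carrier M"
  have "(\<Oplus>\<^bsub>T\<^esub>i\<in>I. t (y i) (eps (x i \<odot>\<^bsub>T\<^esub> t a m))) = (\<Oplus>\<^bsub>T\<^esub>i\<in>I. t (D (a \<otimes>\<^bsub>C\<^esub> x i) \<otimes>\<^bsub>C\<^esub> y i) m)"
  proof (rule T.finsum_cong'[OF HOL.refl])
    fix i assume i: "i \<in> I"
    have "t (D (a \<otimes>\<^bsub>C\<^esub> x i) \<otimes>\<^bsub>C\<^esub> y i) m = t (y i \<otimes>\<^bsub>C\<^esub> D (x i \<otimes>\<^bsub>C\<^esub> a)) m"
      using i am by (simp add: C.m_comm)
    also have "\<dots> = t (y i) (eps (x i \<odot>\<^bsub>T\<^esub> t a m))"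
      using i am by (simp add: t_smult D_closed smult_ind(2) eps(2))
    finally show "t (y i) (eps (x i \<odot>\<^bsub>T\<^esub> t a m)) = t (D (a \<otimes>\<^bsub>C\<^esub> x i) \<otimes>\<^bsub>C\<^esub> y i) m" ..
  qed (use am in auto)
  also have "\<dots> = t (\<Oplus>\<^bsub>C\<^esub>i\<in>I. D (a \<otimes>\<^bsub>C\<^esub> x i) \<otimes>\<^bsub>C\<^esub> y i) m"
    using am finite_I by (intro additive_finsum[OF additive_t_left, symmetric]) auto
  also have "\<dots> = t a m" using expand_y[OF am(1)] by simp
  finally show "t a m = (\<Oplus>\<^bsub>T\<^esub>i\<in>I. t (y i) (eps (x i \<odot>\<^bsub>T\<^esub> t a m)))" ..
qed

text \<open>The values of \<open>eps\<close> on the multiples by \<open>x i\<close> are coordinates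
  on the tensor product.\<close>

lemma ind_eqI:
  assumes "X \<in> carrier T" "Y \<in> carrier T" "\<And>i. i \<in> I \<Longrightarrow> eps (x i \<odot>\<^bsub>T\<^esub> X) = eps (x i \<odot>\<^bsub>T\<^esub> Y)"
  shows "X = Y"
proof -
  have "(\<Oplus>\<^bsub>T\<^esub>i\<in>I. t (y i) (eps (x i \<odot>\<^bsub>T\<^esub> X))) = (\<Oplus>\<^bsub>T\<^esub>i\<in>I. t (y i) (eps (x i \<odot>\<^bsub>T\<^esub> Y)))"
    using assms by (intro T.finsum_cong') auto
  then show ?thesis using expand_ind[OF assms(1)] expand_ind[OF assms(2)] by simp
qed

lemma gradeM: "grade M d \<subseteq> carrier M"
  using GM.grade_carrier by blast

sublocale GT: graded_group T
  using abelian_ind grade_ind_subgroup[OF gradeC gradeM] by (simp add: graded_group_def graded_group_axioms_def)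

lemmas grade_image = grade_additive_image[OF _ _ _ gradeC gradeM]

lemma smult_grade:
  assumes "a \<in> grade C i" "X \<in> grade T j" shows "a \<odot>\<^bsub>T\<^esub> X \<in> grade T (i + j)"
proof (rule grade_image[OF smult_ind(1) GT.grade_subgroup _ assms(2)])
  show ac: "a \<in> carrier C" using assms gradeC by blast
  fix a' m p q assume *: "p + q = j" "a' \<in> grade C p" "m \<in> grade M q"
  then have "t (a \<otimes>\<^bsub>C\<^esub> a') m \<in> grade T (i + p + q)" using assms by (intro grade_t grade_mult)
  moreover have "a' \<in> carrier C" "m \<in> carrier M" using * gradeC gradeM by auto
  ultimately show "a \<odot>\<^bsub>T\<^esub> t a' m \<in> grade T (i + j)" using ac *(1) by (simp add: smult_ind(2) add.assoc)
qed

lemma eps_grade: assumes "X \<in> grade T d" shows "eps X \<in> grade M (d - k)"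
proof (rule grade_image[OF eps(1) GM.grade_subgroup _ assms])
  fix a m i j assume *: "i + j = d" "a \<in> grade C i" "m \<in> grade M j"
  have "D a \<odot>\<^bsub>M\<^esub> m \<in> grade M (i - k + j)" using gmodD(6)[OF M D_grade[OF *(2)] *(3)] .
  moreover have "a \<in> carrier C" "m \<in> carrier M" using * gradeC gradeM by auto
  moreover have "i - k + j = d - k" using *(1) by simp
  ultimately show "eps (t a m) \<in> grade M (d - k)" by (simp add: eps(2))
qed

text \<open>Existence uses the expansion in pure tensors with \<open>y\<close>. Independence is
  tested on coordinates: the one with index \<open>i\<close> lowers degrees by \<open>e i\<close>,
  so a relation in the tensor product becomes one in \<open>M\<close>.\<close>

lemma graded_decomp_ind: "graded_decomp T"
proof (rule GT.graded_decompI)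
  note dM = graded_decompD[OF M.abelian_group_axioms gmodD(3)[OF M]]
  fix X assume X: "X \<in> carrier T"
  have "decomposable T (t (y i) (eps (x i \<odot>\<^bsub>T\<^esub> X)))" if i: "i \<in> I" for i
  proof -
    have "eps (x i \<odot>\<^bsub>T\<^esub> X) \<in> carrier M" using X i by simp
    from dM(2)[OF this] obtain S m where S: "finite S" "\<And>d. m d \<in> grade M d" "eps (x i \<odot>\<^bsub>T\<^esub> X) = (\<Oplus>\<^bsub>M\<^esub>d\<in>S. m d)"
      unfolding decomposable_def by blast
    have mc: "m d \<in> carrier M" for d using GM.grade_carrier[OF S(2)] .
    have "t (y i) (eps (x i \<odot>\<^bsub>T\<^esub> X)) = (\<Oplus>\<^bsub>T\<^esub>d\<in>S. t (y i) (m d))"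
      unfolding S(3) using S(1) mc i by (intro additive_finsum[OF additive_t_right]) auto
    moreover have "decomposable T (\<Oplus>\<^bsub>T\<^esub>d\<in>S. t (y i) (m d))"
      using mc i GT.decomposable_homogeneous[OF grade_t[OF y_grade[OF i] S(2)]] by (intro GT.decomposable_finsum) auto
    ultimately show ?thesis by simp
  qed
  then have "decomposable T (\<Oplus>\<^bsub>T\<^esub>i\<in>I. t (y i) (eps (x i \<odot>\<^bsub>T\<^esub> X)))"
    using X by (intro GT.decomposable_finsum) auto
  then show "decomposable T X" using expand_ind[OF X] by simp
next
  note dM = graded_decompD[OF M.abelian_group_axioms gmodD(3)[OF M]]
  show "graded_indep T"
    unfolding graded_indep_def
  proof (intro allI impI ballI)
    fix S z d assume S: "finite S" "\<forall>d. z d \<in> grade T d" "(\<Oplus>\<^bsub>T\<^esub>d\<in>S. z d) = \<zero>\<^bsub>T\<^esub>" "d \<in> S"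
    have zc: "z d \<in> carrier T" for d using S(2) GT.grade_carrier by blast
    have "eps (x i \<odot>\<^bsub>T\<^esub> z d) = \<zero>\<^bsub>M\<^esub>" if i: "i \<in> I" for i
    proof -
      have h: "additive T M (\<lambda>X. eps (x i \<odot>\<^bsub>T\<^esub> X))" using additive_comp[OF smult_ind(1) eps(1)] i by simp
      have gr: "eps (x i \<odot>\<^bsub>T\<^esub> z d) \<in> grade M (d - e i)" for d
        using eps_grade[OF smult_grade[OF x_grade[OF i] spec[OF S(2), of d]]] by (simp add: algebra_simps)
      \<comment> \<open>\<open>graded_indep\<close> wants the terms indexed by their own degree, so
        the sum is reindexed by the shift \<open>e i\<close>.\<close>
      have inj: "inj_on (\<lambda>d. d - e i) S" by (auto simp: inj_on_def)
      have "(\<Oplus>\<^bsub>M\<^esub>d\<in>(\<lambda>d. d - e i) ` S. eps (x i \<odot>\<^bsub>T\<^esub> z (d + e i))) = (\<Oplus>\<^bsub>M\<^esub>d\<in>S. eps (x i \<odot>\<^bsub>T\<^esub> z (d - e i + e i)))"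
        using zc i by (intro M.finsum_reindex[OF _ inj]) auto
      also have "\<dots> = eps (x i \<odot>\<^bsub>T\<^esub> (\<Oplus>\<^bsub>T\<^esub>d\<in>S. z d))"
        using additive_finsum[OF h S(1), of z] zc by simp
      also have "\<dots> = \<zero>\<^bsub>M\<^esub>" unfolding S(3) by (rule additive_zero[OF h])
      finally have s0: "(\<Oplus>\<^bsub>M\<^esub>d\<in>(\<lambda>d. d - e i) ` S. eps (x i \<odot>\<^bsub>T\<^esub> z (d + e i))) = \<zero>\<^bsub>M\<^esub>" .
      have gr': "eps (x i \<odot>\<^bsub>T\<^esub> z (d' + e i)) \<in> grade M d'" for d' using gr[of "d' + e i"] by simp
      have "eps (x i \<odot>\<^bsub>T\<^esub> z (d - e i + e i)) = \<zero>\<^bsub>M\<^esub>"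
        by (rule graded_indepD[OF dM(3) finite_imageI[OF S(1)] gr' s0 imageI[OF S(4)]])
      then show ?thesis by simp
    qed
    then show "z d = \<zero>\<^bsub>T\<^esub>"
      using zc additive_zero[OF eps(1)] by (intro ind_eqI) auto
  qed
qed

text \<open>The tensors of the \<open>y i\<close> with a finite spanning set of \<open>M\<close>
  span, because constants lie in \<open>B\<close> and cross the tensor sign.\<close>

lemma fin_dim_ind: "fin_dim C T"
proof -
  obtain F where F: "finite F" "F \<subseteq> carrier M"
    "\<And>m. m \<in> carrier M \<Longrightarrow> \<exists>c. m = (\<Oplus>\<^bsub>M\<^esub>b\<in>F. const B (c b) \<odot>\<^bsub>M\<^esub> b)"
    using gmodD(2)[OF M] unfolding fin_dim_def by blast
  show ?thesis
  proof (rule fin_dim_family[OF module_ind, of "I \<times> F" "\<lambda>(i, b). t (y i) b"])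
    fix X L assume X: "X \<in> carrier T" and L: "\<zero>\<^bsub>T\<^esub> \<in> L" "\<And>u w. u \<in> L \<Longrightarrow> w \<in> L \<Longrightarrow> u \<oplus>\<^bsub>T\<^esub> w \<in> L"
      "L \<subseteq> carrier T" "\<And>c p. p \<in> I \<times> F \<Longrightarrow> const C c \<odot>\<^bsub>T\<^esub> (case p of (i, b) \<Rightarrow> t (y i) b) \<in> L"
    have mem: "t (y i) (eps (x i \<odot>\<^bsub>T\<^esub> X)) \<in> L" if i: "i \<in> I" for i
    proof -
      have "eps (x i \<odot>\<^bsub>T\<^esub> X) \<in> carrier M" using i X by simp
      from F(3)[OF this] obtain c where c: "eps (x i \<odot>\<^bsub>T\<^esub> X) = (\<Oplus>\<^bsub>M\<^esub>b\<in>F. const B (c b) \<odot>\<^bsub>M\<^esub> b)" by blast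
      have "t (y i) (eps (x i \<odot>\<^bsub>T\<^esub> X)) = (\<Oplus>\<^bsub>T\<^esub>b\<in>F. t (y i) (const B (c b) \<odot>\<^bsub>M\<^esub> b))"
        unfolding c using F i const_B by (intro additive_finsum[OF additive_t_right]) (auto simp: const_eq)
      also have "\<dots> \<in> L"
      proof (rule T.finsum_mem[OF L(1-3)])
        fix b assume b: "b \<in> F"
        then have "t (y i) (const B (c b) \<odot>\<^bsub>M\<^esub> b) = const C (c b) \<odot>\<^bsub>T\<^esub> t (y i) b"
          using i F(2) const_B t_smult[OF y_closed[OF i] const_B, of b]
          by (auto simp: const_eq smult_ind(2) C.m_comm)
        then show "t (y i) (const B (c b) \<odot>\<^bsub>M\<^esub> b) \<in> L" using L(4)[of "(i, b)" "c b"] i b by simp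
      qed
      finally show ?thesis .
    qed
    have "(\<Oplus>\<^bsub>T\<^esub>i\<in>I. t (y i) (eps (x i \<odot>\<^bsub>T\<^esub> X))) \<in> L" by (rule T.finsum_mem[OF L(1-3) mem])
    then show "X \<in> L" using expand_ind[OF X] by simp
  qed (use finite_I F const_add const_0 in auto)
qed

lemma ind_gmod: "T \<in> gmod C"
  using module_ind fin_dim_ind graded_decomp_ind smult_grade by (simp add: gmod_def)

end

section \<open>The two adjunctions\<close>

context frobenius_pair
begin

lemma frob_ind: "M \<in> gmod B \<Longrightarrow> frob_ind C B D I x y e k M"
  by (intro frob_ind.intro frob_ind_axioms.intro frobenius_pair_axioms)

lemma ind_mor_t:
  fixes M M' :: "('a, 'm) graded"
  assumes M: "M \<in> gmod B" "M' \<in> gmod B" and f: "f \<in> ghom B M M'"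
  shows "additive (ind C B M) (ind C B M') (ind_mor C B M M' f)"
    and "\<And>a m. a \<in> carrier C \<Longrightarrow> m \<in> carrier M \<Longrightarrow>
      ind_mor C B M M' f (tensor_product.t C B M a m) = tensor_product.t C B M' a (f m)"
proof -
  interpret X: frob_ind C B D I x y e k M by (rule frob_ind[OF M(1)])
  interpret Y: frob_ind C B D I x y e k M' by (rule frob_ind[OF M(2)])
  note f = ghomD[OF f]
  have bal: "balanced C B M Y.T (\<lambda>a m. Y.tc (frag_of (a, f m)))"
    unfolding Y.t_def[symmetric] balanced_def using f(2) Y.abelian_ind
    by (auto simp: f(3,4) Y.t_add_left Y.t_add_right Y.t_smult)
  define h where "h X = (\<Union>x\<in>X. Y.tc (frag_extend (\<lambda>(a, m). frag_of (a, f m)) x))" for X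
  note u = union_lift[OF X.tensor_product_axioms Y.tensor_product_axioms _ _ bal, of "\<lambda>(a, m). frag_of (a, f m)", folded h_def]
  have h: "additive X.T Y.T h" "\<And>a m. a \<in> carrier C \<Longrightarrow> m \<in> carrier M \<Longrightarrow> h (X.t a m) = Y.t a (f m)"
    using u f(2) by (simp_all add: X.t_def Y.t_def)
  have hi: "ind_mor C B M M' f X = h X" if "X \<in> carrier X.T" for X
    using that by (simp add: ind_mor_def h_def)
  show "additive X.T Y.T (ind_mor C B M M' f)"
    using h(1) by (auto simp: additive_def hi)
  show "ind_mor C B M M' f (X.t a m) = Y.t a (f m)" if "a \<in> carrier C" "m \<in> carrier M" for a m
    using h(2)[OF that] hi that by simp
qed

lemma ind_mor_ghom:
  fixes M M' :: "('a, 'm) graded"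
  assumes M: "M \<in> gmod B" "M' \<in> gmod B" and f: "f \<in> ghom B M M'"
  shows "ind_mor C B M M' f \<in> ghom C (ind C B M) (ind C B M')"
proof -
  interpret X: frob_ind C B D I x y e k M by (rule frob_ind[OF M(1)])
  interpret Y: frob_ind C B D I x y e k M' by (rule frob_ind[OF M(2)])
  note h = ind_mor_t[OF assms] and fh = ghomD[OF f]
  show ?thesis
  proof (rule ghomI)
    show "ind_mor C B M M' f \<in> extensional (carrier X.T)" by (simp add: ind_mor_def)
    show "ind_mor C B M M' f (a \<odot>\<^bsub>X.T\<^esub> u) = a \<odot>\<^bsub>Y.T\<^esub> ind_mor C B M M' f u"
      if a: "a \<in> carrier C" and u: "u \<in> carrier X.T" for a u
      by (rule X.additive_eqI[OF additive_comp[OF X.smult_ind(1)[OF a] h(1)] additive_comp[OF h(1) Y.smult_ind(1)[OF a]] _ u])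
        (use a fh(2) in \<open>auto simp: X.smult_ind(2) Y.smult_ind(2) h(2)\<close>)
    show "ind_mor C B M M' f u \<in> grade Y.T d" if u: "u \<in> grade X.T d" for d u
      by (rule X.grade_image[OF h(1) Y.GT.grade_subgroup _ u])
        (use fh(5) gradeC X.gradeM Y.grade_t in \<open>force simp: h(2) subset_iff\<close>)
  qed (auto simp: additive_closed[OF h(1)] additive_add[OF h(1)])
qed

lemma ind_functor: "gfunctor B C (ind C B :: ('a, 'm) graded \<Rightarrow> _) (ind_mor C B)"
  unfolding gfunctor_def
proof (intro conjI ballI)
  fix M :: "('a, 'm) graded" assume M: "M \<in> gmod B"
  interpret X: frob_ind C B D I x y e k M by (rule frob_ind[OF M])
  show "X.T \<in> gmod C" by (rule X.ind_gmod)
  have i: "restrict id (carrier M) \<in> ghom B M M"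
    by (rule ghomI) (auto simp: X.GM.grade_carrier id_apply)
  show "ind_mor C B M M (restrict id (carrier M)) = restrict id (carrier X.T)"
  proof (rule extensionalityI[of _ "carrier X.T"])
    fix u assume u: "u \<in> carrier X.T"
    have "ind_mor C B M M (restrict id (carrier M)) u = u"
      by (rule X.additive_eqI[OF ind_mor_t(1)[OF M M i] additiveI[OF X.abelian_ind X.abelian_ind] _ u])
        (auto simp: ind_mor_t(2)[OF M M i] id_apply)
    then show "ind_mor C B M M (restrict id (carrier M)) u = restrict id (carrier X.T) u"
      using u by (simp add: id_apply)
  qed (auto simp: ind_mor_def)
  fix M' :: "('a, 'm) graded" assume M': "M' \<in> gmod B"
  interpret Y: frob_ind C B D I x y e k M' by (rule frob_ind[OF M'])
  show "ind_mor C B M M' f \<in> ghom C X.T Y.T" if "f \<in> ghom B M M'" for f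
    using ind_mor_ghom[OF M M' that] .
  fix M'' :: "('a, 'm) graded" and f g assume M'': "M'' \<in> gmod B" and f: "f \<in> ghom B M M'" and g: "g \<in> ghom B M' M''"
  interpret Z: frob_ind C B D I x y e k M'' by (rule frob_ind[OF M''])
  have gf: "compose (carrier M) g f \<in> ghom B M M''"
    using ghomD[OF f] ghomD[OF g]
    by (intro ghomI) (auto simp: compose_eq X.GM.grade_carrier)
  show "ind_mor C B M M'' (compose (carrier M) g f) =
      compose (carrier X.T) (ind_mor C B M' M'' g) (ind_mor C B M M' f)"
  proof (rule extensionalityI[of _ "carrier X.T"])
    fix u assume u: "u \<in> carrier X.T"
    have "ind_mor C B M M'' (compose (carrier M) g f) u = ind_mor C B M' M'' g (ind_mor C B M M' f u)"
      by (rule X.additive_eqI[OF ind_mor_t(1)[OF M M'' gf] additive_comp[OF ind_mor_t(1)[OF M M' f] ind_mor_t(1)[OF M' M'' g]] _ u])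
        (use ghomD(2)[OF f] in \<open>auto simp: ind_mor_t(2)[OF M M'' gf] ind_mor_t(2)[OF M M' f] ind_mor_t(2)[OF M' M'' g] compose_eq\<close>)
    then show "ind_mor C B M M'' (compose (carrier M) g f) u =
      compose (carrier X.T) (ind_mor C B M' M'' g) (ind_mor C B M M' f) u"
      using u by (simp add: compose_eq)
  qed (auto simp: ind_mor_def compose_def)
qed

lemma ghom_ind_eq:
  assumes M: "M \<in> gmod B" and N: "N \<in> gmod C" and \<phi>: "\<phi> \<in> ghom C (ind C B M) N"
    and "a \<in> carrier C" "m \<in> carrier M"
  shows "\<phi> (tensor_product.t C B M a m) = a \<odot>\<^bsub>N\<^esub> \<phi> (tensor_product.t C B M \<one>\<^bsub>C\<^esub> m)"
proof -
  interpret X: frob_ind C B D I x y e k M by (rule frob_ind[OF M])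
  show ?thesis
    using ghomD(4)[OF \<phi> assms(4) X.t_closed[OF C.one_closed assms(5)]] assms(4,5)
    by (simp add: X.smult_ind(2))
qed

text \<open>A map on the tensor product is restricted along \<open>m\<close> to the tensor of 1 and
  \<open>m\<close>. Conversely \<psi> extends by letting the first factor act on the value of
  \<psi>, which is balanced because \<psi> is \<open>B\<close>-linear.\<close>

lemma ind_res_adjoint: "gadjoint B C (ind C B :: ('a, 'm) graded \<Rightarrow> _) (ind_mor C B) (res B :: ('a, 'n) graded \<Rightarrow> _) res_mor"
  unfolding gadjoint_def
proof (intro conjI ind_functor res_functor)
  let ?t = "\<lambda>M. tensor_product.t C B (M :: ('a, 'm) graded)"
  let ?\<theta> = "\<lambda>M (N :: ('a, 'n) graded) \<phi>. \<lambda>m\<in>carrier M. \<phi> (?t M \<one>\<^bsub>C\<^esub> m)"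
  have bij: "bij_betw (?\<theta> M N) (ghom C (ind C B M) N) (ghom B M (res B N))"
    if M: "M \<in> gmod B" and N: "N \<in> gmod C" for M N
  proof -
    interpret X: frob_ind C B D I x y e k M by (rule frob_ind[OF M])
    note n = gmodD[OF N]
    interpret N: module C N by (rule n(1))
    interpret GN: graded_group N by (rule n(4))
    show ?thesis
    proof (rule bij_betwI')
      fix \<phi> \<psi> assume \<phi>: "\<phi> \<in> ghom C X.T N" and \<psi>: "\<psi> \<in> ghom C X.T N"
      show "?\<theta> M N \<phi> = ?\<theta> M N \<psi> \<longleftrightarrow> \<phi> = \<psi>"
      proof
        assume eq: "?\<theta> M N \<phi> = ?\<theta> M N \<psi>"
        have 1: "\<phi> (X.t \<one>\<^bsub>C\<^esub> m) = \<psi> (X.t \<one>\<^bsub>C\<^esub> m)" if "m \<in> carrier M" for m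
          using fun_cong[OF eq, of m] that by simp
        show "\<phi> = \<psi>"
        proof (rule ghom_ext[OF \<phi> \<psi> HOL.refl])
          fix u assume u: "u \<in> carrier X.T"
          have "\<phi> (X.t a m) = \<psi> (X.t a m)" if am: "a \<in> carrier C" "m \<in> carrier M" for a m
            unfolding ghom_ind_eq[OF M N \<phi> am] ghom_ind_eq[OF M N \<psi> am] 1[OF am(2)] ..
          then show "\<phi> u = \<psi> u"
            by (rule X.additive_eqI[OF ghom_additive[OF \<phi> X.abelian_ind n(5)] ghom_additive[OF \<psi> X.abelian_ind n(5)] _ u])
        qed
      qed simp
    next
      fix \<phi> assume \<phi>: "\<phi> \<in> ghom C X.T N"
      note p = ghomD[OF \<phi>]
      show "?\<theta> M N \<phi> \<in> ghom B M (res B N)"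
      proof (rule ghomI)
        show "?\<theta> M N \<phi> (b \<odot>\<^bsub>M\<^esub> m) = b \<odot>\<^bsub>res B N\<^esub> ?\<theta> M N \<phi> m" if "b \<in> carrier B" "m \<in> carrier M" for b m
        proof -
          have "X.t \<one>\<^bsub>C\<^esub> (b \<odot>\<^bsub>M\<^esub> m) = X.t b m"
            using that X.t_smult[OF C.one_closed that] BC by simp
          then show ?thesis using that BC ghom_ind_eq[OF M N \<phi>, of b m] by simp
        qed
        show "?\<theta> M N \<phi> m \<in> grade (res B N) d" if "m \<in> grade M d" for d m
          using p(5)[OF X.grade_t[OF one_grade that]] X.GM.grade_carrier[OF that] by simp
      qed (auto simp: p(2,3) X.t_add_right)
    next
      fix \<psi> assume \<psi>: "\<psi> \<in> ghom B M (res B N)"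
      note p = ghomD[OF \<psi>]
      have pB: "\<psi> (b \<odot>\<^bsub>M\<^esub> m) = b \<odot>\<^bsub>N\<^esub> \<psi> m" if "b \<in> carrier B" "m \<in> carrier M" for b m
        using p(4)[OF that] that by simp
      have "balanced C B M N (\<lambda>a m. a \<odot>\<^bsub>N\<^esub> \<psi> m)"
        unfolding balanced_def using p(2,3) n(5) BC
        by (auto simp: pB N.smult_l_distr N.smult_r_distr N.smult_assoc1)
      from X.universal[OF this] obtain h where h: "additive X.T N h"
        "\<And>a m. a \<in> carrier C \<Longrightarrow> m \<in> carrier M \<Longrightarrow> h (X.t a m) = a \<odot>\<^bsub>N\<^esub> \<psi> m" by blast
      let ?h = "restrict h (carrier X.T)"
      have "?h \<in> ghom C X.T N"
      proof (rule ghomI)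
        show "?h (a \<odot>\<^bsub>X.T\<^esub> u) = a \<odot>\<^bsub>N\<^esub> ?h u" if a: "a \<in> carrier C" and u: "u \<in> carrier X.T" for a u
        proof -
          have "h (a \<odot>\<^bsub>X.T\<^esub> u) = a \<odot>\<^bsub>N\<^esub> h u"
            by (rule X.additive_eqI[OF additive_comp[OF X.smult_ind(1)[OF a] h(1)] additive_comp[OF h(1) additive_smult[OF n(1) a]] _ u])
              (use a p(2) in \<open>auto simp: X.smult_ind(2) h(2) N.smult_assoc1\<close>)
          then show ?thesis using a u by simp
        qed
        show "?h u \<in> grade N d" if u: "u \<in> grade X.T d" for d u
        proof -
          have "h u \<in> grade N d"
          proof (rule X.grade_image[OF h(1) GN.grade_subgroup _ u])
            fix a m i j assume *: "i + j = d" "a \<in> grade C i" "m \<in> grade M j"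
            then have "a \<in> carrier C" "m \<in> carrier M" using gradeC X.gradeM by auto
            then show "h (X.t a m) \<in> grade N d" using n(6)[OF *(2), of "\<psi> m" j] p(5)[OF *(3)] *(1) by (simp add: h(2))
          qed
          then show ?thesis using X.GT.grade_carrier[OF u] by simp
        qed
      qed (auto simp: additive_closed[OF h(1)] additive_add[OF h(1)])
      moreover have "\<psi> = ?\<theta> M N ?h"
        using p(1,2) by (intro extensionalityI[of _ "carrier M"]) (auto simp: h(2))
      ultimately show "\<exists>\<phi>\<in>ghom C X.T N. \<psi> = ?\<theta> M N \<phi>" by blast
    qed
  qed
  have lin: "?\<theta> M N (\<lambda>u\<in>carrier (ind C B M). \<phi> u \<oplus>\<^bsub>N\<^esub> \<psi> u) = (\<lambda>m\<in>carrier M. ?\<theta> M N \<phi> m \<oplus>\<^bsub>res B N\<^esub> ?\<theta> M N \<psi> m)"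
    "?\<theta> M N (\<lambda>u\<in>carrier (ind C B M). const C c \<odot>\<^bsub>N\<^esub> \<phi> u) = (\<lambda>m\<in>carrier M. const B c \<odot>\<^bsub>res B N\<^esub> ?\<theta> M N \<phi> m)"
    if M: "M \<in> gmod B" for M and N :: "('a, 'n) graded" and \<phi> \<psi> c
  proof -
    interpret X: frob_ind C B D I x y e k M by (rule frob_ind[OF M])
    show "?\<theta> M N (\<lambda>u\<in>carrier (ind C B M). \<phi> u \<oplus>\<^bsub>N\<^esub> \<psi> u) = (\<lambda>m\<in>carrier M. ?\<theta> M N \<phi> m \<oplus>\<^bsub>res B N\<^esub> ?\<theta> M N \<psi> m)"
      "?\<theta> M N (\<lambda>u\<in>carrier (ind C B M). const C c \<odot>\<^bsub>N\<^esub> \<phi> u) = (\<lambda>m\<in>carrier M. const B c \<odot>\<^bsub>res B N\<^esub> ?\<theta> M N \<phi> m)"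
      by (auto intro!: restrict_ext simp: const_eq const_B)
  qed
  have nat: "?\<theta> M' N' (compose (carrier (ind C B M')) g (compose (carrier (ind C B M')) \<phi> (ind_mor C B M' M f))) =
      compose (carrier M') (res_mor N N' g) (compose (carrier M') (?\<theta> M N \<phi>) f)"
    if M: "M \<in> gmod B" and M': "M' \<in> gmod B" and f: "f \<in> ghom B M' M" for M M' f and N N' :: "('a, 'n) graded" and g \<phi>
  proof -
    interpret X: frob_ind C B D I x y e k M by (rule frob_ind[OF M])
    interpret Y: frob_ind C B D I x y e k M' by (rule frob_ind[OF M'])
    show ?thesis
      using ghomD(2)[OF f] by (auto simp: fun_eq_iff compose_def restrict_def res_mor_def ind_mor_t(2)[OF M' M f])
  qed
  show "\<exists>\<theta> :: ('a, 'm) graded \<Rightarrow> ('a, 'n) graded \<Rightarrow> (('a \<times> 'm \<Rightarrow>\<^sub>0 int) set \<Rightarrow> 'n) \<Rightarrow> 'm \<Rightarrow> 'n.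
       (\<forall>M\<in>gmod B. \<forall>N\<in>gmod C.
           bij_betw (\<theta> M N) (ghom C (ind C B M) N) (ghom B M (res B N)) \<and>
           (\<forall>\<phi>\<in>ghom C (ind C B M) N. \<forall>\<psi>\<in>ghom C (ind C B M) N.
              \<theta> M N (\<lambda>x\<in>carrier (ind C B M). \<phi> x \<oplus>\<^bsub>N\<^esub> \<psi> x) =
              (\<lambda>x\<in>carrier M. \<theta> M N \<phi> x \<oplus>\<^bsub>res B N\<^esub> \<theta> M N \<psi> x)) \<and>
           (\<forall>c. \<forall>\<phi>\<in>ghom C (ind C B M) N.
               \<theta> M N (\<lambda>x\<in>carrier (ind C B M). const C c \<odot>\<^bsub>N\<^esub> \<phi> x) =
               (\<lambda>x\<in>carrier M. const B c \<odot>\<^bsub>res B N\<^esub> \<theta> M N \<phi> x))) \<and>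
       (\<forall>M\<in>gmod B. \<forall>M'\<in>gmod B. \<forall>N\<in>gmod C. \<forall>N'\<in>gmod C.
           \<forall>f\<in>ghom B M' M. \<forall>g\<in>ghom C N N'. \<forall>\<phi>\<in>ghom C (ind C B M) N.
              \<theta> M' N' (compose (carrier (ind C B M')) g (compose (carrier (ind C B M')) \<phi> (ind_mor C B M' M f))) =
              compose (carrier M') (res_mor N N' g) (compose (carrier M') (\<theta> M N \<phi>) f))"
    by (rule exI[of _ ?\<theta>]; intro conjI ballI allI; (rule bij lin nat; assumption))
qed

end

section \<open>Shifts of graded modules\<close>

lemma shift_simps [simp]: "carrier (shift j N) = carrier N" "add (shift j N) = add N" "\<zero>\<^bsub>shift j N\<^esub> = \<zero>\<^bsub>N\<^esub>"
  "a \<odot>\<^bsub>shift j N\<^esub> n = a \<odot>\<^bsub>N\<^esub> n" "grade (shift j N) d = grade N (d - j)"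
  by (simp_all add: shift_def)

lemma finsum_shift: "finsum (shift j N) f A = finsum N f A"
  by (rule finsum_carrier_add_zero) simp_all

lemma abelian_shift: "abelian_group N \<Longrightarrow> abelian_group (shift j N)"
proof -
  assume "abelian_group N"
  then interpret abelian_group N .
  show ?thesis by (rule abelian_groupI) (auto simp: a_assoc intro: a_comm bexI[OF _ a_inv_closed] l_neg)
qed

lemma module_shift:
  assumes "Module.module A N" shows "Module.module A (shift j N)"
proof -
  interpret N: module A N by fact
  show ?thesis
    by (rule moduleI[OF N.R.is_cring abelian_shift[OF N.abelian_group_axioms]])
      (auto simp: N.smult_l_distr N.smult_r_distr N.smult_assoc1)
qed

text \<open>Decompositions before and after the shift correspond by translating the finite index
  set.\<close>

lemma graded_decomp_shift:
  assumes N: "abelian_group N" and g: "graded_decomp N" shows "graded_decomp (shift j N)"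
proof -
  note d = graded_decompD[OF N g]
  interpret GN: graded_group N by (rule d(1))
  interpret S: abelian_group "shift j N" using abelian_shift[OF N] .
  interpret GS: graded_group "shift j N"
  proof (intro graded_group.intro graded_group_axioms.intro abelian_shift[OF N])
    fix d show "additive_subgroup (grade (shift j N) d) (shift j N)"
      using GN.grade_subgroup[of "d - j"] by (auto simp: additive_subgroup_def subgroup_def m_inv_def)
  qed
  show ?thesis
  proof (rule GS.graded_decompI)
    fix X assume "X \<in> carrier (shift j N)"
    then have "X \<in> carrier N" by simp
    from d(2)[OF this] obtain S z where S: "finite S" "\<And>d. z d \<in> grade N d" "X = (\<Oplus>\<^bsub>N\<^esub>d\<in>S. z d)"
      unfolding decomposable_def by blast
    have zc: "z d \<in> carrier N" for d using GN.grade_carrier[OF S(2)] .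
    have "(\<Oplus>\<^bsub>N\<^esub>d\<in>(\<lambda>d. d + j) ` S. z (d - j)) = (\<Oplus>\<^bsub>N\<^esub>d\<in>S. z (d + j - j))"
      using zc by (intro GN.finsum_reindex) (auto simp: inj_on_def)
    then have "X = (\<Oplus>\<^bsub>shift j N\<^esub>d\<in>(\<lambda>d. d + j) ` S. z (d - j))" unfolding finsum_shift S(3) by simp
    then show "decomposable (shift j N) X" unfolding decomposable_def
      using S(1,2) by (intro exI[of _ "(\<lambda>d. d + j) ` S"] exI[of _ "\<lambda>d. z (d - j)"]) simp
  next
    show "graded_indep (shift j N)" unfolding graded_indep_def
    proof (intro allI impI ballI)
      fix S z d assume S: "finite S" "\<forall>d. z d \<in> grade (shift j N) d" "(\<Oplus>\<^bsub>shift j N\<^esub>d\<in>S. z d) = \<zero>\<^bsub>shift j N\<^esub>" "d \<in> S"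
      have gr: "z (d' + j) \<in> grade N d'" for d' using spec[OF S(2), of "d' + j"] by simp
      have zc: "z d' \<in> carrier N" for d' using GS.grade_carrier[OF spec[OF S(2)]] by simp
      have "(\<Oplus>\<^bsub>N\<^esub>d\<in>(\<lambda>d. d - j) ` S. z (d + j)) = (\<Oplus>\<^bsub>N\<^esub>d\<in>S. z (d - j + j))"
        using zc by (intro GN.finsum_reindex) (auto simp: inj_on_def)
      also have "\<dots> = \<zero>\<^bsub>N\<^esub>" using S(3) unfolding finsum_shift by simp
      finally have s0: "(\<Oplus>\<^bsub>N\<^esub>d\<in>(\<lambda>d. d - j) ` S. z (d + j)) = \<zero>\<^bsub>N\<^esub>" .
      have "z (d - j + j) = \<zero>\<^bsub>N\<^esub>"
        by (rule graded_indepD[OF d(3) finite_imageI[OF S(1)] gr s0 imageI[OF S(4)]])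
      then show "z d = \<zero>\<^bsub>shift j N\<^esub>" by simp
    qed
  qed
qed

lemma shift_gmod:
  assumes N: "N \<in> gmod A" shows "shift j N \<in> gmod A"
proof -
  note n = gmodD[OF N]
  have "a \<odot>\<^bsub>shift j N\<^esub> m \<in> grade (shift j N) (p + q)" if "a \<in> grade A p" "m \<in> grade (shift j N) q" for a m p q
    using n(6)[OF that(1), of m "q - j"] that(2) by (simp add: algebra_simps)
  moreover have "fin_dim A (shift j N)" using n(2) unfolding fin_dim_def finsum_shift by simp
  ultimately show ?thesis
    using module_shift[OF n(1)] graded_decomp_shift[OF n(5,3)] by (simp add: gmod_def)
qed

lemma ghom_shift: "f \<in> ghom A N N' \<Longrightarrow> f \<in> ghom A (shift j N) (shift j N')"
  by (auto simp: ghom_def)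

section \<open>Restriction as a left adjoint of shifted induction\<close>

context frobenius_pair
begin

lemma shift_ind_functor:
  "gfunctor B C (\<lambda>N :: ('a, 'n) graded. shift j (ind C B N)) (ind_mor C B)"
  using ind_functor[where 'm = 'n] unfolding gfunctor_def
  by (auto intro: shift_gmod ghom_shift)

text \<open>In terms of dual bases this is the element of the tensor product that corresponds to the
  \<open>B\<close>-linear map sending \<open>a\<close> to \<phi> of \<open>a\<close> times
  \<open>m\<close>; compare \<open>eps_coext\<close>.\<close>

definition coext :: "('a, 'm) graded \<Rightarrow> ('a, 'n) graded \<Rightarrow> ('m \<Rightarrow> 'n) \<Rightarrow> 'm \<Rightarrow> ('a \<times> 'n \<Rightarrow>\<^sub>0 int) set" where
  "coext M N \<phi> = (\<lambda>m\<in>carrier M. \<Oplus>\<^bsub>ind C B N\<^esub>i\<in>I. tensor_product.t C B N (y i) (\<phi> (x i \<odot>\<^bsub>M\<^esub> m)))"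

context
  fixes M :: "('a, 'm) graded" and N :: "('a, 'n) graded"
  assumes M: "M \<in> gmod C" and N: "N \<in> gmod B"
begin

interpretation X: frob_ind C B D I x y e k N by (rule frob_ind[OF N])
interpretation M: module C M by (rule gmodD(1)[OF M])
interpretation GM: graded_group M by (rule gmodD(4)[OF M])

context
  fixes \<phi> assumes \<phi>: "\<phi> \<in> ghom B (res B M) N"
begin

lemma ph: "m \<in> carrier M \<Longrightarrow> \<phi> m \<in> carrier N"
  "m \<in> carrier M \<Longrightarrow> m' \<in> carrier M \<Longrightarrow> \<phi> (m \<oplus>\<^bsub>M\<^esub> m') = \<phi> m \<oplus>\<^bsub>N\<^esub> \<phi> m'"
  "b \<in> carrier B \<Longrightarrow> m \<in> carrier M \<Longrightarrow> \<phi> (b \<odot>\<^bsub>M\<^esub> m) = b \<odot>\<^bsub>N\<^esub> \<phi> m"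
  "m \<in> grade M d \<Longrightarrow> \<phi> m \<in> grade N d"
  using ghomD[OF \<phi>] by auto

lemma coext_apply: "m \<in> carrier M \<Longrightarrow> coext M N \<phi> m = (\<Oplus>\<^bsub>X.T\<^esub>i\<in>I. X.t (y i) (\<phi> (x i \<odot>\<^bsub>M\<^esub> m)))"
  by (simp add: coext_def)

lemma coext_closed: "m \<in> carrier M \<Longrightarrow> coext M N \<phi> m \<in> carrier X.T"
  by (auto simp: coext_apply ph(1) intro!: X.T.finsum_closed)

lemma additive_ph: "additive M N \<phi>"
  using M.abelian_group_axioms X.M.abelian_group_axioms by (intro additiveI) (auto simp: ph)

text \<open>Moving \<open>a\<close> into the first factor and taking the trace leaves the expansion
  of \<open>a\<close> in the family \<open>x\<close>. With \<open>a = x i\<close> this computes all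
  coordinates of \<open>coext\<close>; with \<open>a = 1\<close> it recovers \<phi>.\<close>

lemma eps_coext:
  assumes a: "a \<in> carrier C" and m: "m \<in> carrier M"
  shows "X.eps (a \<odot>\<^bsub>X.T\<^esub> coext M N \<phi> m) = \<phi> (a \<odot>\<^bsub>M\<^esub> m)"
proof -
  have h: "additive X.T N (\<lambda>u. X.eps (a \<odot>\<^bsub>X.T\<^esub> u))"
    by (rule additive_comp[OF X.smult_ind(1)[OF a] X.eps(1)])
  have "X.eps (a \<odot>\<^bsub>X.T\<^esub> coext M N \<phi> m) = (\<Oplus>\<^bsub>N\<^esub>i\<in>I. X.eps (a \<odot>\<^bsub>X.T\<^esub> X.t (y i) (\<phi> (x i \<odot>\<^bsub>M\<^esub> m))))"
    unfolding coext_apply[OF m] using m finite_I by (intro additive_finsum[OF h]) (auto simp: ph(1))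
  also have "\<dots> = (\<Oplus>\<^bsub>N\<^esub>i\<in>I. \<phi> ((D (a \<otimes>\<^bsub>C\<^esub> y i) \<otimes>\<^bsub>C\<^esub> x i) \<odot>\<^bsub>M\<^esub> m))"
  proof (rule X.M.finsum_cong'[OF HOL.refl])
    fix i assume i: "i \<in> I"
    show "X.eps (a \<odot>\<^bsub>X.T\<^esub> X.t (y i) (\<phi> (x i \<odot>\<^bsub>M\<^esub> m))) = \<phi> ((D (a \<otimes>\<^bsub>C\<^esub> y i) \<otimes>\<^bsub>C\<^esub> x i) \<odot>\<^bsub>M\<^esub> m)"
      using i a m by (simp add: X.smult_ind(2) X.eps(2) ph(1) M.smult_assoc1 ph(3) D_closed)
  qed (use a m in \<open>auto intro!: ph(1)\<close>)
  also have "\<dots> = \<phi> (\<Oplus>\<^bsub>M\<^esub>i\<in>I. (D (a \<otimes>\<^bsub>C\<^esub> y i) \<otimes>\<^bsub>C\<^esub> x i) \<odot>\<^bsub>M\<^esub> m)"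
    using a m finite_I by (intro additive_finsum[OF additive_ph, symmetric]) auto
  also have "(\<Oplus>\<^bsub>M\<^esub>i\<in>I. (D (a \<otimes>\<^bsub>C\<^esub> y i) \<otimes>\<^bsub>C\<^esub> x i) \<odot>\<^bsub>M\<^esub> m) = (\<Oplus>\<^bsub>C\<^esub>i\<in>I. D (a \<otimes>\<^bsub>C\<^esub> y i) \<otimes>\<^bsub>C\<^esub> x i) \<odot>\<^bsub>M\<^esub> m"
    using a m finite_I by (intro additive_finsum[OF additive_smult_left[OF gmodD(1)[OF M]], symmetric]) auto
  also have "(\<Oplus>\<^bsub>C\<^esub>i\<in>I. D (a \<otimes>\<^bsub>C\<^esub> y i) \<otimes>\<^bsub>C\<^esub> x i) = a" using expand_x[OF a] by simp
  finally show ?thesis .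
qed

text \<open>Linearity over \<open>C\<close> is not visible in the defining sum;
  \<open>ind_eqI\<close> reduces it to coordinates, where \<open>eps_coext\<close> turns it into
  associativity of the action on \<open>M\<close>.\<close>

lemma coext_ghom: "coext M N \<phi> \<in> ghom C M (shift (- k) X.T)"
proof (rule ghomI)
  show "coext M N \<phi> \<in> extensional (carrier M)" by (simp add: coext_def)
  show "coext M N \<phi> m \<in> carrier (shift (- k) X.T)" if "m \<in> carrier M" for m
    using coext_closed[OF that] by simp
  show "coext M N \<phi> (u \<oplus>\<^bsub>M\<^esub> v) = coext M N \<phi> u \<oplus>\<^bsub>shift (- k) X.T\<^esub> coext M N \<phi> v"
    if uv: "u \<in> carrier M" "v \<in> carrier M" for u v
  proof -
    have "coext M N \<phi> (u \<oplus>\<^bsub>M\<^esub> v) = coext M N \<phi> u \<oplus>\<^bsub>X.T\<^esub> coext M N \<phi> v"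
    proof (rule X.ind_eqI)
      fix i assume i: "i \<in> I"
      have "X.eps (x i \<odot>\<^bsub>X.T\<^esub> (coext M N \<phi> u \<oplus>\<^bsub>X.T\<^esub> coext M N \<phi> v)) =
          X.eps (x i \<odot>\<^bsub>X.T\<^esub> coext M N \<phi> u) \<oplus>\<^bsub>N\<^esub> X.eps (x i \<odot>\<^bsub>X.T\<^esub> coext M N \<phi> v)"
        using uv i by (intro additive_add[OF additive_comp[OF X.smult_ind(1) X.eps(1)]]) (auto intro: coext_closed)
      then show "X.eps (x i \<odot>\<^bsub>X.T\<^esub> coext M N \<phi> (u \<oplus>\<^bsub>M\<^esub> v)) = X.eps (x i \<odot>\<^bsub>X.T\<^esub> (coext M N \<phi> u \<oplus>\<^bsub>X.T\<^esub> coext M N \<phi> v))"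
        using i uv by (simp add: eps_coext M.smult_r_distr ph(2))
    qed (use uv in \<open>auto intro!: coext_closed X.T.a_closed\<close>)
    then show ?thesis by simp
  qed
  show "coext M N \<phi> (a \<odot>\<^bsub>M\<^esub> m) = a \<odot>\<^bsub>shift (- k) X.T\<^esub> coext M N \<phi> m"
    if a: "a \<in> carrier C" and m: "m \<in> carrier M" for a m
  proof -
    have "coext M N \<phi> (a \<odot>\<^bsub>M\<^esub> m) = a \<odot>\<^bsub>X.T\<^esub> coext M N \<phi> m"
    proof (rule X.ind_eqI)
      fix i assume i: "i \<in> I"
      have "x i \<odot>\<^bsub>X.T\<^esub> (a \<odot>\<^bsub>X.T\<^esub> coext M N \<phi> m) = (x i \<otimes>\<^bsub>C\<^esub> a) \<odot>\<^bsub>X.T\<^esub> coext M N \<phi> m"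
        using i a m by (simp add: X.TM.smult_assoc1 coext_closed)
      then show "X.eps (x i \<odot>\<^bsub>X.T\<^esub> coext M N \<phi> (a \<odot>\<^bsub>M\<^esub> m)) = X.eps (x i \<odot>\<^bsub>X.T\<^esub> (a \<odot>\<^bsub>X.T\<^esub> coext M N \<phi> m))"
        using i a m by (simp add: eps_coext M.smult_assoc1)
    qed (use a m in \<open>auto intro!: coext_closed X.TM.smult_closed\<close>)
    then show ?thesis by simp
  qed
  show "coext M N \<phi> m \<in> grade (shift (- k) X.T) d" if m: "m \<in> grade M d" for d m
  proof -
    \<comment> \<open>The degrees \<open>k - e i\<close> of \<open>x i\<close> and
      \<open>e i\<close> of \<open>y i\<close> sum to \<open>k\<close> for every \<open>i\<close>,
      and the shift by \<open>- k\<close> absorbs this.\<close>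
    have "X.t (y i) (\<phi> (x i \<odot>\<^bsub>M\<^esub> m)) \<in> grade X.T (d + k)" if i: "i \<in> I" for i
      using X.grade_t[OF y_grade[OF i] ph(4)[OF gmodD(6)[OF M x_grade[OF i] m]]] by (simp add: algebra_simps)
    then have "(\<Oplus>\<^bsub>X.T\<^esub>i\<in>I. X.t (y i) (\<phi> (x i \<odot>\<^bsub>M\<^esub> m))) \<in> grade X.T (d + k)" by (rule X.GT.grade_finsum)
    then show ?thesis using GM.grade_carrier[OF m] by (simp add: coext_apply)
  qed
qed

end

text \<open>Composition with \<open>eps\<close> inverts \<open>coext\<close>: as \<psi> is
  \<open>C\<close>-linear, rebuilding it gives exactly the expansion \<open>expand_ind\<close> of
  its values.\<close>

lemma eps_ghom:
  assumes \<psi>: "\<psi> \<in> ghom C M (shift (- k) X.T)"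
  shows "(\<lambda>m\<in>carrier M. X.eps (\<psi> m)) \<in> ghom B (res B M) N"
    and "coext M N (\<lambda>m\<in>carrier M. X.eps (\<psi> m)) = \<psi>"
proof -
  note p = ghomD[OF \<psi>]
  have pc: "\<psi> m \<in> carrier X.T" if "m \<in> carrier M" for m using p(2)[OF that] by simp
  have pm: "\<psi> (a \<odot>\<^bsub>M\<^esub> m) = a \<odot>\<^bsub>X.T\<^esub> \<psi> m" if "a \<in> carrier C" "m \<in> carrier M" for a m
    using p(4)[OF that] by simp
  have pa: "\<psi> (u \<oplus>\<^bsub>M\<^esub> v) = \<psi> u \<oplus>\<^bsub>X.T\<^esub> \<psi> v" if "u \<in> carrier M" "v \<in> carrier M" for u v
    using p(3)[OF that] by simp
  have eb: "X.eps (b \<odot>\<^bsub>X.T\<^esub> u) = b \<odot>\<^bsub>N\<^esub> X.eps u" if b: "b \<in> carrier B" and u: "u \<in> carrier X.T" for b u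
    by (rule X.additive_eqI[OF additive_comp[OF X.smult_ind(1)[OF BC[OF b]] X.eps(1)]
        additive_comp[OF X.eps(1) additive_smult[OF gmodD(1)[OF N] b]] _ u])
      (use b BC in \<open>auto simp: X.smult_ind(2) X.eps(2) D_mult X.smult_assoc_C D_closed\<close>)
  show g: "(\<lambda>m\<in>carrier M. X.eps (\<psi> m)) \<in> ghom B (res B M) N"
  proof (rule ghomI)
    show "(\<lambda>m\<in>carrier M. X.eps (\<psi> m)) u \<in> grade N d" if "u \<in> grade (res B M) d" for d u
    proof -
      have u: "u \<in> grade M d" using that by simp
      have "\<psi> u \<in> grade X.T (d + k)" using p(5)[OF u] by simp
      then show ?thesis using X.eps_grade GM.grade_carrier[OF u] by fastforce
    qed
  qed (auto simp: pc pm pa eb BC additive_add[OF X.eps(1)])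
  show "coext M N (\<lambda>m\<in>carrier M. X.eps (\<psi> m)) = \<psi>"
  proof (rule extensionalityI[of _ "carrier M"])
    fix m assume m: "m \<in> carrier M"
    have "coext M N (\<lambda>m\<in>carrier M. X.eps (\<psi> m)) m = (\<Oplus>\<^bsub>X.T\<^esub>i\<in>I. X.t (y i) (X.eps (x i \<odot>\<^bsub>X.T\<^esub> \<psi> m)))"
      unfolding coext_apply[OF g m] using m pc by (intro X.T.finsum_cong') (auto simp: pm)
    also have "\<dots> = \<psi> m" using X.expand_ind[OF pc[OF m]] by simp
    finally show "coext M N (\<lambda>m\<in>carrier M. X.eps (\<psi> m)) m = \<psi> m" .
  qed (use p(1) in \<open>auto simp: coext_def\<close>)
qed

lemma coext_bij: "bij_betw (coext M N) (ghom B (res B M) N) (ghom C M (shift (- k) X.T))"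
proof (rule bij_betwI[where g = "\<lambda>\<psi>. \<lambda>m\<in>carrier M. X.eps (\<psi> m)"])
  fix \<phi> assume \<phi>: "\<phi> \<in> ghom B (res B M) N"
  have "X.eps (coext M N \<phi> m) = \<phi> m" if m: "m \<in> carrier M" for m
    using eps_coext[OF \<phi> C.one_closed m] coext_closed[OF \<phi> m] m by simp
  then show "(\<lambda>m\<in>carrier M. X.eps (coext M N \<phi> m)) = \<phi>"
    using ghomD(1)[OF \<phi>] by (intro extensionalityI[of _ "carrier M"]) auto
qed (use coext_ghom eps_ghom in auto)

lemma coext_add:
  assumes \<phi>: "\<phi> \<in> ghom B (res B M) N" and \<psi>: "\<psi> \<in> ghom B (res B M) N"
  shows "coext M N (\<lambda>u\<in>carrier (res B M). \<phi> u \<oplus>\<^bsub>N\<^esub> \<psi> u) =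
    (\<lambda>m\<in>carrier M. coext M N \<phi> m \<oplus>\<^bsub>shift (- k) X.T\<^esub> coext M N \<psi> m)"
proof -
  have "(\<Oplus>\<^bsub>X.T\<^esub>i\<in>I. X.t (y i) ((\<lambda>u\<in>carrier (res B M). \<phi> u \<oplus>\<^bsub>N\<^esub> \<psi> u) (x i \<odot>\<^bsub>M\<^esub> m))) =
      coext M N \<phi> m \<oplus>\<^bsub>X.T\<^esub> coext M N \<psi> m" if m: "m \<in> carrier M" for m
  proof -
    have "(\<Oplus>\<^bsub>X.T\<^esub>i\<in>I. X.t (y i) ((\<lambda>u\<in>carrier (res B M). \<phi> u \<oplus>\<^bsub>N\<^esub> \<psi> u) (x i \<odot>\<^bsub>M\<^esub> m))) =
      (\<Oplus>\<^bsub>X.T\<^esub>i\<in>I. X.t (y i) (\<phi> (x i \<odot>\<^bsub>M\<^esub> m)) \<oplus>\<^bsub>X.T\<^esub> X.t (y i) (\<psi> (x i \<odot>\<^bsub>M\<^esub> m)))"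
      using m by (intro X.T.finsum_cong') (auto simp: X.t_add_right ph(1)[OF \<phi>] ph(1)[OF \<psi>])
    also have "\<dots> = coext M N \<phi> m \<oplus>\<^bsub>X.T\<^esub> coext M N \<psi> m"
      unfolding coext_apply[OF \<phi> m] coext_apply[OF \<psi> m]
      using m by (intro X.T.finsum_addf) (auto simp: ph(1)[OF \<phi>] ph(1)[OF \<psi>])
    finally show ?thesis .
  qed
  then show ?thesis unfolding coext_def[of M N "\<lambda>u\<in>carrier (res B M). \<phi> u \<oplus>\<^bsub>N\<^esub> \<psi> u"]
    by (intro restrict_ext) simp
qed

lemma coext_scale:
  assumes \<phi>: "\<phi> \<in> ghom B (res B M) N"
  shows "coext M N (\<lambda>u\<in>carrier (res B M). const B c \<odot>\<^bsub>N\<^esub> \<phi> u) =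
    (\<lambda>m\<in>carrier M. const C c \<odot>\<^bsub>shift (- k) X.T\<^esub> coext M N \<phi> m)"
proof -
  have "(\<Oplus>\<^bsub>X.T\<^esub>i\<in>I. X.t (y i) ((\<lambda>u\<in>carrier (res B M). const B c \<odot>\<^bsub>N\<^esub> \<phi> u) (x i \<odot>\<^bsub>M\<^esub> m))) =
      const C c \<odot>\<^bsub>X.T\<^esub> coext M N \<phi> m" if m: "m \<in> carrier M" for m
  proof -
    have "const C c \<odot>\<^bsub>X.T\<^esub> coext M N \<phi> m = (\<Oplus>\<^bsub>X.T\<^esub>i\<in>I. const C c \<odot>\<^bsub>X.T\<^esub> X.t (y i) (\<phi> (x i \<odot>\<^bsub>M\<^esub> m)))"
      unfolding coext_apply[OF \<phi> m] using m finite_I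
      by (intro additive_finsum[OF X.smult_ind(1)]) (auto simp: ph(1)[OF \<phi>])
    also have "\<dots> = (\<Oplus>\<^bsub>X.T\<^esub>i\<in>I. X.t (y i) ((\<lambda>u\<in>carrier (res B M). const B c \<odot>\<^bsub>N\<^esub> \<phi> u) (x i \<odot>\<^bsub>M\<^esub> m)))"
    proof (rule X.T.finsum_cong'[OF HOL.refl])
      fix i assume i: "i \<in> I"
      have p: "\<phi> (x i \<odot>\<^bsub>M\<^esub> m) \<in> carrier N" using i m by (simp add: ph(1)[OF \<phi>])
      have "const C c \<odot>\<^bsub>X.T\<^esub> X.t (y i) (\<phi> (x i \<odot>\<^bsub>M\<^esub> m)) = X.t (y i \<otimes>\<^bsub>C\<^esub> const C c) (\<phi> (x i \<odot>\<^bsub>M\<^esub> m))"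
        using i p by (simp add: X.smult_ind(2) C.m_comm)
      also have "\<dots> = X.t (y i) (const C c \<odot>\<^bsub>N\<^esub> \<phi> (x i \<odot>\<^bsub>M\<^esub> m))" using i p by (intro X.t_smult const_B) simp_all
      finally show "const C c \<odot>\<^bsub>X.T\<^esub> X.t (y i) (\<phi> (x i \<odot>\<^bsub>M\<^esub> m)) =
        X.t (y i) ((\<lambda>u\<in>carrier (res B M). const B c \<odot>\<^bsub>N\<^esub> \<phi> u) (x i \<odot>\<^bsub>M\<^esub> m))"
        using i m by (simp add: const_eq)
    qed (use m in \<open>auto simp: ph(1)[OF \<phi>] const_eq const_B\<close>)
    finally show ?thesis ..
  qed
  then show ?thesis unfolding coext_def[of M N "\<lambda>u\<in>carrier (res B M). const B c \<odot>\<^bsub>N\<^esub> \<phi> u"]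
    by (intro restrict_ext) simp
qed

end

lemma coext_natural:
  fixes M M' :: "('a, 'm) graded" and N N' :: "('a, 'n) graded"
  assumes M: "M \<in> gmod C" "M' \<in> gmod C" and N: "N \<in> gmod B" "N' \<in> gmod B"
    and f: "f \<in> ghom C M' M" and g: "g \<in> ghom B N N'" and \<phi>: "\<phi> \<in> ghom B (res B M) N"
  shows "coext M' N' (compose (carrier (res B M')) g (compose (carrier (res B M')) \<phi> (res_mor M' M f))) =
    compose (carrier M') (ind_mor C B N N' g) (compose (carrier M') (coext M N \<phi>) f)"
proof (rule extensionalityI[of _ "carrier M'"])
  interpret X: frob_ind C B D I x y e k N by (rule frob_ind[OF N(1)])
  interpret Y: frob_ind C B D I x y e k N' by (rule frob_ind[OF N(2)])
  interpret M: module C M by (rule gmodD(1)[OF M(1)])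
  interpret M': module C M' by (rule gmodD(1)[OF M(2)])
  note p = ph[OF M(1) N(1) \<phi>] and f = ghomD[OF f] and i = ind_mor_t[OF N g]
  fix m assume m: "m \<in> carrier M'"
  have fm: "f m \<in> carrier M" using f(2)[OF m] .
  have "ind_mor C B N N' g (coext M N \<phi> (f m)) = (\<Oplus>\<^bsub>Y.T\<^esub>j\<in>I. ind_mor C B N N' g (X.t (y j) (\<phi> (x j \<odot>\<^bsub>M\<^esub> f m))))"
    unfolding coext_apply[OF M(1) N(1) \<phi> fm] using fm finite_I by (intro additive_finsum[OF i(1)]) (auto simp: p(1))
  also have "\<dots> = (\<Oplus>\<^bsub>Y.T\<^esub>j\<in>I. Y.t (y j) (g (\<phi> (f (x j \<odot>\<^bsub>M'\<^esub> m)))))"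
    using m fm ghomD(2)[OF g] f(2) p(1) by (intro Y.T.finsum_cong') (auto simp: i(2) f(4))
  also have "\<dots> = coext M' N' (compose (carrier (res B M')) g (compose (carrier (res B M')) \<phi> (res_mor M' M f))) m"
    using m f(2) p(1) ghomD(2)[OF g] by (simp add: coext_def) (intro Y.T.finsum_cong', auto simp: compose_eq res_mor_def)
  finally show "coext M' N' (compose (carrier (res B M')) g (compose (carrier (res B M')) \<phi> (res_mor M' M f))) m =
    compose (carrier M') (ind_mor C B N N' g) (compose (carrier M') (coext M N \<phi>) f) m"
    using m by (simp add: compose_eq)
qed (simp_all add: coext_def)

lemma res_ind_adjoint:
  "gadjoint C B (res B :: ('a, 'm) graded \<Rightarrow> _) res_mor
     (\<lambda>N :: ('a, 'n) graded. shift (- k) (ind C B N)) (ind_mor C B)"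
  unfolding gadjoint_def
  by (intro conjI res_functor shift_ind_functor exI[of _ coext] ballI allI;
      (rule coext_bij coext_add coext_scale coext_natural; assumption))

end

section \<open>Freeness from dual bases\<close>

context frobenius_pair
begin

lemma free_basis_y:
  assumes orth: "\<And>i j. i \<in> I \<Longrightarrow> j \<in> I \<Longrightarrow> D (y i \<otimes>\<^bsub>C\<^esub> x j) = (if i = j then \<one>\<^bsub>C\<^esub> else \<zero>\<^bsub>C\<^esub>)"
  shows "free_basis B (res B (regular C)) I y"
proof -
  interpret B: cring B by (rule cring_B)
  let ?R = "regular C"
  have R: "carrier ?R = carrier C" "add ?R = add C" "\<zero>\<^bsub>?R\<^esub> = \<zero>\<^bsub>C\<^esub>" "a \<odot>\<^bsub>?R\<^esub> b = a \<otimes>\<^bsub>C\<^esub> b" for a b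
    by (simp_all add: regular_def)
  have fs: "finsum (res B ?R) f A = finsum C f A" for f and A :: "'i set"
    by (rule finsum_carrier_add_zero) (simp_all add: R)
  have ab: "abelian_group ?R"
    by (rule abelian_groupI) (auto simp: R C.a_assoc intro: C.a_comm bexI[OF _ C.a_inv_closed] C.l_neg)
  have "Module.module C ?R"
    by (rule moduleI[OF cring_C ab]) (auto simp: R C.l_distr C.r_distr C.m_assoc)
  note module = module_res[OF this]
  show ?thesis
    unfolding free_basis_def
  proof (intro conjI ballI module)
    show "y ` I \<subseteq> carrier (res B ?R)" by (auto simp: R)
    fix m assume "m \<in> carrier (res B ?R)"
    then have m: "m \<in> carrier C" by (simp add: R)
    let ?Q = "\<lambda>c. c \<in> I \<rightarrow>\<^sub>E carrier B \<and> finite {i \<in> I. c i \<noteq> \<zero>\<^bsub>B\<^esub>} \<and>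
        m = (\<Oplus>\<^bsub>res B ?R\<^esub>i\<in>{i \<in> I. c i \<noteq> \<zero>\<^bsub>B\<^esub>}. c i \<odot>\<^bsub>res B ?R\<^esub> y i)"
    have sum: "(\<Oplus>\<^bsub>res B ?R\<^esub>i\<in>{i \<in> I. c i \<noteq> \<zero>\<^bsub>B\<^esub>}. c i \<odot>\<^bsub>res B ?R\<^esub> y i) = (\<Oplus>\<^bsub>C\<^esub>i\<in>I. c i \<otimes>\<^bsub>C\<^esub> y i)"
      if "c \<in> I \<rightarrow>\<^sub>E carrier B" for c
      unfolding fs using that finite_I BC
      by (intro C.add.finprod_mono_neutral_cong_left) (auto simp: R B_ops PiE_iff)
    show "\<exists>!c. ?Q c"
    proof (rule ex1I)
      let ?c = "\<lambda>i\<in>I. D (m \<otimes>\<^bsub>C\<^esub> x i)"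
      have mem: "?c \<in> I \<rightarrow>\<^sub>E carrier B" using m by (auto simp: D_closed)
      have fin: "finite {i \<in> I. ?c i \<noteq> \<zero>\<^bsub>B\<^esub>}" using finite_I by (rule rev_finite_subset) blast
      have eq: "m = (\<Oplus>\<^bsub>C\<^esub>i\<in>I. ?c i \<otimes>\<^bsub>C\<^esub> y i)"
        using m by (subst expand_y[OF m]) (intro C.finsum_cong', auto)
      show "?Q ?c" by (intro conjI mem fin trans[OF eq sum[OF mem, symmetric]])
    next
      fix c assume c: "?Q c"
      then have cI: "c \<in> I \<rightarrow>\<^sub>E carrier B" by blast
      have cc: "c i \<in> carrier B" "c i \<in> carrier C" if "i \<in> I" for i using cI that BC by (auto simp: PiE_iff)
      have mc: "m = (\<Oplus>\<^bsub>C\<^esub>i\<in>I. c i \<otimes>\<^bsub>C\<^esub> y i)" using c sum[OF cI] by simp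
      show "c = (\<lambda>i\<in>I. D (m \<otimes>\<^bsub>C\<^esub> x i))"
      proof (rule extensionalityI[of _ I])
        fix j assume j: "j \<in> I"
        have h: "additive C C (\<lambda>a. D (a \<otimes>\<^bsub>C\<^esub> x j))"
          using j C.abelian_group_axioms by (intro additiveI) (auto simp: C.l_distr D_add)
        have "D (m \<otimes>\<^bsub>C\<^esub> x j) = (\<Oplus>\<^bsub>C\<^esub>i\<in>I. D (c i \<otimes>\<^bsub>C\<^esub> y i \<otimes>\<^bsub>C\<^esub> x j))"
          unfolding mc using finite_I cc by (intro additive_finsum[OF h]) auto
        also have "\<dots> = (\<Oplus>\<^bsub>C\<^esub>i\<in>I. if j = i then c i else \<zero>\<^bsub>C\<^esub>)"
          using j cc by (intro C.finsum_cong') (auto simp: C.m_assoc D_mult orth)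
        also have "\<dots> = c j" using j finite_I cc by (intro C.finsum_singleton) auto
        finally show "c j = (\<lambda>i\<in>I. D (m \<otimes>\<^bsub>C\<^esub> x i)) j" using j by simp
      qed (use cI in \<open>auto simp: PiE_iff\<close>)
    qed
  qed
qed

end

section \<open>The coinvariant algebra\<close>

context parabolic
begin

abbreviation "Sy \<equiv> sym_alg sc"
abbreviation "Iw \<equiv> coinv_ideal sc cr \<Phi>"
abbreviation "Co \<equiv> coinv_alg sc cr \<Phi>"
abbreviation "CoJ \<equiv> coinv_inv sc cr \<Phi> J"
abbreviation "pr \<equiv> coinv_proj sc cr \<Phi>"

lemma Sy_simps [simp]: "carrier Sy = R" "monoid.mult Sy = (*)" "add Sy = (+)" "\<one>\<^bsub>Sy\<^esub> = 1" "\<zero>\<^bsub>Sy\<^esub> = 0"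
  by (simp_all add: sym_alg_def)

lemma cring_Sy: "cring Sy"
proof (rule cringI)
  show "abelian_group Sy"
    by (rule abelian_groupI)
      (auto simp: add.assoc add.commute intro: poly_funs.add poly_uminus bexI[of _ "- x" for x])
  show "comm_monoid Sy"
    by (rule comm_monoidI) (auto simp: mult.assoc mult.commute intro: poly_funs.mult)
qed (simp add: distrib_right)

text \<open>This translates between the grading of the symmetric algebra and \<open>homog\<close>,
  whose degree is half as large; odd and negative degrees contain only zero.\<close>

lemma grade_Sy: "f \<in> grade Sy d \<longleftrightarrow> f = 0 \<or> even d \<and> homog (d div 2) f"
proof (cases "d \<ge> 0 \<and> even d")
  case True
  then have "f \<in> grade Sy d \<longleftrightarrow> homog (d div 2) f" by (simp add: sym_alg_def homog_def)
  then show ?thesis using True by auto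
next
  case False
  then have "f \<in> grade Sy d \<longleftrightarrow> f = 0" by (auto simp: sym_alg_def)
  moreover have "even d \<and> homog (d div 2) f \<Longrightarrow> f = 0" using False homog_neg[of "d div 2" f] by force
  ultimately show ?thesis by blast
qed

lemma grade_Sy_poly: "f \<in> grade Sy d \<Longrightarrow> f \<in> R"
  using grade_Sy homog_poly by auto

interpretation Sy: cring Sy by (rule cring_Sy)

definition inv_gens :: "('h \<Rightarrow> complex) set" where
  "inv_gens = (\<Union>d\<in>{0<..}. {f \<in> grade Sy d. \<forall>w\<in>G \<Phi>. act w f = f})"

text \<open>Invariance under the whole Weyl group includes invariance under \<open>G J\<close>, so
  \<open>D\<close> is linear over the generators of the ideal.\<close>

lemma inv_gens_RJ: "inv_gens \<subseteq> RJ"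
  using grade_Sy_poly GJ by (auto simp: inv_gens_def RJ_def)

lemma Iw_gens: "Iw = genideal Sy inv_gens"
  by (simp add: coinv_ideal_def inv_gens_def)

lemma ideal_Iw: "ideal Iw Sy"
  unfolding Iw_gens using inv_gens_RJ RJ_poly by (intro Sy.genideal_ideal) auto

lemma Iw_add: "f \<in> Iw \<Longrightarrow> g \<in> Iw \<Longrightarrow> f + g \<in> Iw"
  using additive_subgroup.a_closed[OF ideal.axioms(1)[OF ideal_Iw]] by simp

lemma Iw_0: "0 \<in> Iw"
  using additive_subgroup.zero_closed[OF ideal.axioms(1)[OF ideal_Iw]] by simp

lemma Iw_mult: "f \<in> Iw \<Longrightarrow> g \<in> R \<Longrightarrow> g * f \<in> Iw"
  using ideal.I_l_closed[OF ideal_Iw] by simp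

lemma Iw_uminus: "f \<in> Iw \<Longrightarrow> - f \<in> Iw"
  using Iw_mult[of f "- 1"] poly_uminus[OF poly_one] by simp

lemma Iw_diff: "f \<in> Iw \<Longrightarrow> g \<in> Iw \<Longrightarrow> f - g \<in> Iw"
  using Iw_add[of f "- g"] Iw_uminus by simp

lemma Iw_sum: "(\<And>i. i \<in> A \<Longrightarrow> f i \<in> Iw) \<Longrightarrow> (\<Sum>i\<in>A. f i) \<in> Iw"
  by (induction A rule: infinite_finite_induct) (simp_all add: Iw_add Iw_0)

text \<open>The predicate cuts out an ideal that contains the generators.\<close>

lemma Iw_induct [consumes 1, case_names gen zero add mult]:
  assumes "f \<in> Iw" and "\<And>f. f \<in> inv_gens \<Longrightarrow> Q f" and "Q 0"
    and "\<And>f g. f \<in> R \<Longrightarrow> g \<in> R \<Longrightarrow> Q f \<Longrightarrow> Q g \<Longrightarrow> Q (f + g)"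
    and "\<And>f g. f \<in> R \<Longrightarrow> g \<in> R \<Longrightarrow> Q f \<Longrightarrow> Q (g * f)"
  shows "Q f"
proof -
  let ?K = "{f \<in> R. Q f}"
  have "ideal ?K Sy"
  proof (rule idealI[OF Sy.ring_axioms])
    have "Q (- f)" if "f \<in> R" "Q f" for f
      using assms(5)[of f "- 1"] that poly_uminus[OF poly_one] by simp
    then have "additive_subgroup ?K Sy"
      using assms(3,4) Sy.minus_equality
      by (intro Sy.additive_subgroupI) (auto simp: poly_funs.add poly_uminus Sy.minus_equality[of "- f" f for f])
    then show "subgroup ?K (add_monoid Sy)" by (rule additive_subgroup.a_subgroup)
  qed (use assms(5) in \<open>auto simp: poly_funs.mult mult.commute\<close>)
  moreover have "inv_gens \<subseteq> ?K" using assms(2) inv_gens_RJ RJ_poly by auto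
  ultimately have "Iw \<subseteq> ?K" unfolding Iw_gens by (rule Sy.genideal_minimal)
  then show ?thesis using assms(1) by blast
qed

lemma D_Iw: "f \<in> Iw \<Longrightarrow> D f \<in> Iw"
proof -
  assume f: "f \<in> Iw"
  \<comment> \<open>The claim covers all multiples, so that it is stable under multiplication by
    \<open>R\<close>, over which \<open>D\<close> is not linear.\<close>
  have "\<forall>g\<in>R. D (g * f) \<in> Iw"
    using f
  proof (induction rule: Iw_induct)
    case (gen f)
    have "f \<in> Iw" unfolding Iw_gens using Sy.genideal_self[of inv_gens] inv_gens_RJ RJ_poly gen by auto
    have "D (g * f) \<in> Iw" if g: "g \<in> R" for g
    proof -
      have "D (g * f) = D g * f"
        using Demazure_RJ_mult[OF w0_mem _ g, of f] gen inv_gens_RJ by (auto simp: mult.commute)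
      then show ?thesis using Iw_mult[OF \<open>f \<in> Iw\<close>] g w0_GS by (simp add: \<Delta>_poly)
    qed
    then show ?case by blast
  next
    case zero
    then show ?case using w0_GS by (simp add: \<Delta>_0 Iw_0)
  next
    case (add f g)
    then show ?case using w0_GS by (simp add: distrib_left \<Delta>_add poly_funs.mult Iw_add)
  next
    case (mult f g)
    then show ?case by (simp add: mult.assoc[symmetric] poly_funs.mult)
  qed
  from bspec[OF this poly_one] show "D f \<in> Iw" by simp
qed

lemma act_Iw: "w \<in> G J \<Longrightarrow> f \<in> Iw \<Longrightarrow> act w f \<in> Iw"
proof -
  assume w: "w \<in> G J" and f: "f \<in> Iw"
  show "act w f \<in> Iw"
    using f
  proof (induction rule: Iw_induct)
    case (gen f)
    have "f \<in> Iw" unfolding Iw_gens using Sy.genideal_self[of inv_gens] inv_gens_RJ RJ_poly gen by auto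
    then show ?case using RJ_act[OF _ w, of f] inv_gens_RJ gen by auto
  next
    case zero
    show ?case by (simp add: act_zero Iw_0)
  next
    case (add f g)
    then show ?case by (simp add: act_add Iw_add)
  next
    case (mult f g)
    then show ?case using act_poly[OF GJ[OF w]] by (simp add: act_mult Iw_mult)
  qed
qed

section \<open>Classes, invariant classes and the induced trace\<close>

lemma pr_eq: "pr f = {g. g - f \<in> Iw}"
proof -
  have "pr f = {i + f | i. i \<in> Iw}" by (auto simp: coinv_proj_def a_r_coset_def')
  then show ?thesis by (auto intro: exI[of _ "g - f" for g])
qed

lemma pr_eq_iff: "pr f = pr g \<longleftrightarrow> f - g \<in> Iw"
proof
  assume "pr f = pr g"
  moreover have "f \<in> pr f" by (simp add: pr_eq Iw_0)
  ultimately show "f - g \<in> Iw" by (simp add: pr_eq)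
next
  assume fg: "f - g \<in> Iw"
  have "h - f \<in> Iw \<longleftrightarrow> h - g \<in> Iw" for h
    using Iw_add[of "h - f" "f - g"] Iw_diff[of "h - g" "f - g"] fg by auto
  then show "pr f = pr g" by (simp add: pr_eq)
qed

lemma Co_simps: "carrier Co = pr ` R" "grade Co d = pr ` grade Sy d" "\<zero>\<^bsub>Co\<^esub> = pr 0" "\<one>\<^bsub>Co\<^esub> = pr 1"
  "f \<in> R \<Longrightarrow> g \<in> R \<Longrightarrow> pr f \<oplus>\<^bsub>Co\<^esub> pr g = pr (f + g)"
  "f \<in> R \<Longrightarrow> g \<in> R \<Longrightarrow> pr f \<otimes>\<^bsub>Co\<^esub> pr g = pr (f * g)"
proof -
  interpret ideal Iw Sy by (rule ideal_Iw)
  note h = rcos_ring_hom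
  show "carrier Co = pr ` R"
    by (auto simp: coinv_alg_def quot_alg_def FactRing_def A_RCOSETS_def' coinv_proj_def)
  show "grade Co d = pr ` grade Sy d" by (auto simp: coinv_alg_def quot_alg_def coinv_proj_def)
  show "\<one>\<^bsub>Co\<^esub> = pr 1" using ring_hom_one[OF h] by (simp add: coinv_alg_def quot_alg_def coinv_proj_def)
  show "pr f \<oplus>\<^bsub>Co\<^esub> pr g = pr (f + g)" if "f \<in> R" "g \<in> R"
    using ring_hom_add[OF h, of f g] that by (simp add: coinv_alg_def quot_alg_def coinv_proj_def)
  show "pr f \<otimes>\<^bsub>Co\<^esub> pr g = pr (f * g)" if "f \<in> R" "g \<in> R"
    using ring_hom_mult[OF h, of f g] that by (simp add: coinv_alg_def quot_alg_def coinv_proj_def)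
  have "pr 0 = Iw" by (simp add: pr_eq)
  then show "\<zero>\<^bsub>Co\<^esub> = pr 0" by (simp add: coinv_alg_def quot_alg_def FactRing_def)
qed

lemma cring_Co: "cring Co"
proof -
  have Q: "cring (Sy Quot Iw)" using ideal.quotient_is_cring[OF ideal_Iw cring_Sy] .
  interpret Q: cring "Sy Quot Iw" by (rule Q)
  have e: "carrier Co = carrier (Sy Quot Iw)" "monoid.mult Co = monoid.mult (Sy Quot Iw)" "add Co = add (Sy Quot Iw)"
    "\<one>\<^bsub>Co\<^esub> = \<one>\<^bsub>Sy Quot Iw\<^esub>" "\<zero>\<^bsub>Co\<^esub> = \<zero>\<^bsub>Sy Quot Iw\<^esub>"
    by (simp_all add: coinv_alg_def quot_alg_def)
  show ?thesis
  proof (rule cringI)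
    have l_inv: "\<exists>Y\<in>carrier (Sy Quot Iw). Y \<oplus>\<^bsub>Sy Quot Iw\<^esub> X = \<zero>\<^bsub>Sy Quot Iw\<^esub>" if "X \<in> carrier (Sy Quot Iw)" for X
      using Q.a_inv_closed[OF that] Q.l_neg[OF that] by blast
    show "abelian_group Co"
      by (rule abelian_groupI; unfold e) (fact Q.a_closed Q.zero_closed Q.a_assoc Q.a_comm Q.l_zero l_inv)+
    show "comm_monoid Co"
      by (rule comm_monoidI; unfold e) (fact Q.m_closed Q.one_closed Q.m_assoc Q.l_one Q.m_comm)+
  qed (unfold e, rule Q.l_distr)
qed

interpretation Co: cring Co by (rule cring_Co)

lemma const_Co: "const Co c = pr (cst c)"
proof -
  have "const Sy c = cst c" by (auto simp: const_def sym_alg_def fscale_def cst_def one_fun_def)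
  then have "const Co c = pr (cst c) \<otimes>\<^bsub>Co\<^esub> \<one>\<^bsub>Co\<^esub>"
    by (simp add: const_def coinv_alg_def quot_alg_def coinv_proj_def)
  then show ?thesis by (simp add: Co_simps)
qed

lemma act_pr: "w \<in> G J \<Longrightarrow> f \<in> R \<Longrightarrow> act w ` pr f = pr (act w f)"
proof -
  assume w: "w \<in> G J" and f: "f \<in> R"
  have i: "act (inv_into UNIV w) g \<in> Iw" if "g \<in> Iw" for g using act_Iw[OF inv_GJ[OF w] that] .
  show "act w ` pr f = pr (act w f)"
  proof (intro equalityI subsetI)
    fix g assume "g \<in> act w ` pr f"
    then show "g \<in> pr (act w f)" using act_Iw[OF w] by (auto simp: pr_eq simp flip: act_diff)
  next
    fix g assume "g \<in> pr (act w f)"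
    then have "act (inv_into UNIV w) (g - act w f) \<in> Iw" using i by (simp add: pr_eq)
    then have "act (inv_into UNIV w) g \<in> pr f" by (simp add: pr_eq act_diff act_inv_G[OF GJ[OF w]])
    then show "g \<in> act w ` pr f" using act_inv_G(2)[OF GJ[OF w], of g] by (metis image_eqI)
  qed
qed

lemma CoJ_simps: "CoJ = Co\<lparr>carrier := carrier Co \<inter> {X. \<forall>w\<in>G J. act w ` X = X},
    grade := (\<lambda>d. grade Co d \<inter> {X. \<forall>w\<in>G J. act w ` X = X})\<rparr>"
  by (simp add: coinv_inv_def Let_def)

lemma CoJ_ops: "monoid.mult CoJ = monoid.mult Co" "add CoJ = add Co" "\<one>\<^bsub>CoJ\<^esub> = \<one>\<^bsub>Co\<^esub>" "\<zero>\<^bsub>CoJ\<^esub> = \<zero>\<^bsub>Co\<^esub>"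
  "const CoJ c = const Co c" "grade CoJ d = grade Co d \<inter> {X. \<forall>w\<in>G J. act w ` X = X}"
  by (simp_all add: CoJ_simps const_def)

lemma pr_RJ_fixed: "f \<in> RJ \<Longrightarrow> w \<in> G J \<Longrightarrow> act w ` pr f = pr f"
  by (simp add: act_pr RJ_poly RJ_act)

text \<open>By averaging, every \<open>W\<^sub>J\<close>-invariant class has a \<open>W\<^sub>J\<close>-invariant representative.\<close>

lemma carrier_CoJ: "carrier CoJ = pr ` RJ"
proof (intro equalityI subsetI)
  fix X assume "X \<in> pr ` RJ"
  then obtain f where f: "f \<in> RJ" "X = pr f" by blast
  then have "\<forall>w\<in>G J. act w ` X = X" using pr_RJ_fixed by blast
  then show "X \<in> carrier CoJ" using f RJ_poly by (simp add: CoJ_simps Co_simps(1))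
next
  fix X assume "X \<in> carrier CoJ"
  then obtain f where f: "f \<in> R" "X = pr f" and inv: "\<And>w. w \<in> G J \<Longrightarrow> act w ` X = X"
    by (auto simp: CoJ_simps Co_simps(1))
  let ?n = "of_nat (card (G J)) :: complex"
  have "card (G J) \<noteq> 0" using finite_GJ G_id[of J] by (metis card_0_eq empty_iff)
  then have n: "?n \<noteq> 0" by simp
  define g where "g = cst (1 / ?n) * (\<Sum>w\<in>G J. act w f)"
  have "g \<in> RJ"
  proof (rule RJI)
    show "g \<in> R" unfolding g_def using f GJ by (intro poly_funs.mult cst_poly poly_sum act_poly)
    fix \<alpha> assume a: "\<alpha> \<in> J"
    have sa: "s \<alpha> \<in> G J" "\<alpha> \<in> \<Phi>" using a by (auto simp: G_refl J_root)
    have "act (s \<alpha>) (\<Sum>w\<in>G J. act w f) = (\<Sum>w\<in>G J. act (s \<alpha> \<circ> w) f)"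
      unfolding act_sum using sa by (intro sum.cong) (simp_all add: act_G_comp GJ)
    also have "\<dots> = (\<Sum>w\<in>G J. act w f)"
      by (rule sum.reindex_bij_witness[of _ "\<lambda>w. s \<alpha> \<circ> w" "\<lambda>w. s \<alpha> \<circ> w"])
        (use sa in \<open>auto simp: refl_refl_comp G_comp\<close>)
    finally show "act (s \<alpha>) g = g" unfolding g_def act_mult cst_invariant by simp
  qed
  \<comment> \<open>The average differs from \<open>f\<close> by a mean of differences, each in the
    ideal because the class of \<open>f\<close> is fixed.\<close>
  moreover have "g - f = cst (1 / ?n) * (\<Sum>w\<in>G J. act w f - f)"
  proof -
    have "cst (1 / ?n) * (\<Sum>w\<in>G J. f) = cst (1 / ?n * ?n) * f"
      by (simp add: fun_eq_iff sum_fun_apply fun_apply cst_apply)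
    then have "cst (1 / ?n) * (\<Sum>w\<in>G J. f) = f" using n by simp
    then show ?thesis by (simp only: g_def sum_subtractf right_diff_distrib)
  qed
  moreover have "cst (1 / ?n) * (\<Sum>w\<in>G J. act w f - f) \<in> Iw"
  proof (intro Iw_mult Iw_sum cst_poly)
    fix w assume w: "w \<in> G J"
    have "pr (act w f) = pr f" using inv[OF w] act_pr[OF w f(1)] f(2) by simp
    then show "act w f - f \<in> Iw" by (simp add: pr_eq_iff)
  qed
  ultimately show "X \<in> pr ` RJ" using f(2) pr_eq_iff[of g f] by auto
qed

text \<open>The trace on classes, computed from an arbitrary polynomial representative;
  \<open>D_Iw\<close> makes the choice immaterial.\<close>

definition DC :: "('h \<Rightarrow> complex) set \<Rightarrow> ('h \<Rightarrow> complex) set" where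
  "DC X = pr (D (SOME f. f \<in> R \<and> X = pr f))"

lemma DC_pr: "f \<in> R \<Longrightarrow> DC (pr f) = pr (D f)"
proof -
  assume f: "f \<in> R"
  define g where "g = (SOME g. g \<in> R \<and> pr f = pr g)"
  have g: "g \<in> R \<and> pr f = pr g" unfolding g_def by (rule someI[of _ f]) (use f in simp)
  then have "D (g - f) \<in> Iw" using D_Iw[of "g - f"] pr_eq_iff[of g f] by simp
  then show ?thesis
    using Demazure_diff[OF w0_GS, of g f] f g unfolding DC_def g_def[symmetric] by (simp add: pr_eq_iff)
qed

lemma finsum_Co: "finite A \<Longrightarrow> (\<And>i. i \<in> A \<Longrightarrow> f i \<in> R) \<Longrightarrow> (\<Oplus>\<^bsub>Co\<^esub>i\<in>A. pr (f i)) = pr (\<Sum>i\<in>A. f i)"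
proof (induction A rule: finite_induct)
  case (insert a A)
  have "(\<lambda>i. pr (f i)) \<in> A \<rightarrow> carrier Co" "pr (f a) \<in> carrier Co" using insert.prems by (auto simp: Co_simps(1))
  then have "(\<Oplus>\<^bsub>Co\<^esub>i\<in>insert a A. pr (f i)) = pr (f a) \<oplus>\<^bsub>Co\<^esub> (\<Oplus>\<^bsub>Co\<^esub>i\<in>A. pr (f i))"
    using insert.hyps by (simp add: Co.finsum_insert)
  also have "\<dots> = pr (f a + (\<Sum>i\<in>A. f i))"
    using insert by (simp add: Co_simps(5) poly_sum)
  also have "f a + (\<Sum>i\<in>A. f i) = (\<Sum>i\<in>insert a A. f i)" by (rule sum.insert[OF insert.hyps, symmetric])
  finally show ?case .
qed (simp add: Co_simps(3))

lemma cring_CoJ: "cring CoJ"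
proof -
  have sub: "\<And>X. X \<in> carrier CoJ \<Longrightarrow> X \<in> carrier Co" by (simp add: CoJ_simps)
  have add: "X \<oplus>\<^bsub>Co\<^esub> Y \<in> carrier CoJ" and mult: "X \<otimes>\<^bsub>Co\<^esub> Y \<in> carrier CoJ"
    if "X \<in> carrier CoJ" "Y \<in> carrier CoJ" for X Y
    using that by (auto simp: carrier_CoJ Co_simps RJ_poly RJ_add RJ_mult)
  have one: "\<one>\<^bsub>Co\<^esub> \<in> carrier CoJ" "\<zero>\<^bsub>Co\<^esub> \<in> carrier CoJ" by (auto simp: carrier_CoJ Co_simps(3,4))
  have neg: "\<exists>Y\<in>carrier CoJ. Y \<oplus>\<^bsub>Co\<^esub> X = \<zero>\<^bsub>Co\<^esub>" if X: "X \<in> carrier CoJ" for X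
  proof -
    obtain f where f: "f \<in> RJ" "X = pr f" using X by (auto simp: carrier_CoJ)
    then have "- f \<in> RJ" using RJ_diff[OF RJ_0, of f] by simp
    then show ?thesis using f by (intro bexI[of _ "pr (- f)"]) (auto simp: carrier_CoJ Co_simps RJ_poly)
  qed
  show ?thesis
  proof (rule cringI)
    show "abelian_group CoJ"
      by (rule abelian_groupI; unfold CoJ_ops)
        (erule (1) add | rule one | (rule Co.a_comm; erule sub) | erule neg | simp add: Co.a_assoc sub)+
    show "comm_monoid CoJ"
      by (rule comm_monoidI; unfold CoJ_ops)
        (erule (1) mult | rule one | (rule Co.m_comm; erule sub) | simp add: Co.m_assoc sub)+
  qed (unfold CoJ_ops, simp add: sub Co.l_distr)
qed

lemma grade_D:
  assumes "f \<in> grade Sy d" shows "D f \<in> grade Sy (d - 2 * int N)"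
proof -
  have "D f \<in> grade Sy (d - 2 * int N)" if "even d" "homog (d div 2) f"
    using homog_D[OF that(2)] that(1) by (auto simp: grade_Sy)
  then show ?thesis using assms w0_GS by (auto simp: grade_Sy \<Delta>_0)
qed

text \<open>All degrees are doubled polynomial degrees: \<open>b w\<close> has degree
  \<open>N - len w\<close>, \<open>dualb w\<close> has degree \<open>len w\<close>, and
  \<open>D\<close> lowers degrees by \<open>N\<close>. Both expansions and the trace pass to classes
  because the coefficients come from \<open>D\<close>, which preserves the ideal.\<close>

lemma frobenius_coinvariants:
  "frobenius_pair Co CoJ DC (G J) (\<lambda>w. pr (dualb w)) (\<lambda>w. pr (b w)) (\<lambda>w. 2 * (int N - int (len w))) (2 * int N)"
proof (rule frobenius_pair.intro)
  fix p q X Y assume "X \<in> grade Co p" "Y \<in> grade Co q"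
  then obtain f g where f: "f \<in> grade Sy p" "X = pr f" and g: "g \<in> grade Sy q" "Y = pr g" by (auto simp: Co_simps(2))
  have "f * g \<in> grade Sy (p + q)"
    using f g homog_mult[of "p div 2" f "q div 2" g] by (auto simp: grade_Sy div_add)
  then show "X \<otimes>\<^bsub>Co\<^esub> Y \<in> grade Co (p + q)"
    using f g grade_Sy_poly by (auto simp: Co_simps)
next
  fix X d assume "X \<in> grade Co d"
  then obtain f where f: "f \<in> grade Sy d" "X = pr f" by (auto simp: Co_simps(2))
  have "pr (D f) \<in> grade Co (d - 2 * int N)" using grade_D[OF f(1)] by (auto simp: Co_simps(2))
  then show "DC X \<in> grade CoJ (d - 2 * int N)"
    using f grade_Sy_poly[OF f(1)] D_RJ pr_RJ_fixed by (auto simp: CoJ_ops(6) DC_pr)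
next
  fix w assume w: "w \<in> G J"
  show "pr (dualb w) \<in> grade Co (2 * int N - 2 * (int N - int (len w)))"
    using homog_dualb[OF w] by (auto simp: Co_simps(2) grade_Sy)
  show "pr (b w) \<in> grade Co (2 * (int N - int (len w)))"
    using homog_b[OF w] by (auto simp: Co_simps(2) grade_Sy)
next
  fix X assume "X \<in> carrier Co"
  then obtain f where f: "f \<in> R" "X = pr f" by (auto simp: Co_simps(1))
  have e1: "DC (X \<otimes>\<^bsub>Co\<^esub> pr u) \<otimes>\<^bsub>Co\<^esub> pr v = pr (D (f * u) * v)" if "u \<in> R" "v \<in> R" for u v
    using f that w0_GS by (simp add: Co_simps(6) DC_pr poly_funs.mult \<Delta>_poly)
  have r: "D (f * u) * v \<in> R" if "u \<in> R" "v \<in> R" for u v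
    using f(1) that w0_GS by (simp add: poly_funs.mult \<Delta>_poly)
  have "(\<Oplus>\<^bsub>Co\<^esub>w\<in>G J. DC (X \<otimes>\<^bsub>Co\<^esub> pr (dualb w)) \<otimes>\<^bsub>Co\<^esub> pr (b w)) = (\<Oplus>\<^bsub>Co\<^esub>w\<in>G J. pr (D (f * dualb w) * b w))"
    using e1 r dualb_poly b_poly by (intro Co.finsum_cong') (auto simp: Co_simps(1))
  also have "\<dots> = pr (\<Sum>w\<in>G J. D (f * dualb w) * b w)"
    using r dualb_poly b_poly finite_GJ by (intro finsum_Co) auto
  finally show "X = (\<Oplus>\<^bsub>Co\<^esub>w\<in>G J. DC (X \<otimes>\<^bsub>Co\<^esub> pr (dualb w)) \<otimes>\<^bsub>Co\<^esub> pr (b w))"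
    using expand_b[OF f(1)] f(2) by simp
  have "(\<Oplus>\<^bsub>Co\<^esub>w\<in>G J. DC (X \<otimes>\<^bsub>Co\<^esub> pr (b w)) \<otimes>\<^bsub>Co\<^esub> pr (dualb w)) = (\<Oplus>\<^bsub>Co\<^esub>w\<in>G J. pr (D (f * b w) * dualb w))"
    using e1 r dualb_poly b_poly by (intro Co.finsum_cong') (auto simp: Co_simps(1))
  also have "\<dots> = pr (\<Sum>w\<in>G J. D (f * b w) * dualb w)"
    using r dualb_poly b_poly finite_GJ by (intro finsum_Co) auto
  finally show "X = (\<Oplus>\<^bsub>Co\<^esub>w\<in>G J. DC (X \<otimes>\<^bsub>Co\<^esub> pr (b w)) \<otimes>\<^bsub>Co\<^esub> pr (dualb w))"
    using expand_dualb[OF f(1)] f(2) by simp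
  show "DC X \<in> carrier CoJ" using f D_RJ by (simp add: carrier_CoJ DC_pr)
  {
    fix Y assume "Y \<in> carrier Co"
    then obtain g where g: "g \<in> R" "Y = pr g" by (auto simp: Co_simps(1))
    show "DC (X \<oplus>\<^bsub>Co\<^esub> Y) = DC X \<oplus>\<^bsub>Co\<^esub> DC Y"
      using f g w0_GS by (simp add: Co_simps(5) DC_pr poly_funs.add \<Delta>_add \<Delta>_poly)
  next
    fix Y assume "Y \<in> carrier CoJ"
    then obtain g where g: "g \<in> RJ" "Y = pr g" by (auto simp: carrier_CoJ)
    show "DC (Y \<otimes>\<^bsub>Co\<^esub> X) = Y \<otimes>\<^bsub>Co\<^esub> DC X"
      using f g w0_GS RJ_poly[OF g(1)] Demazure_RJ_mult[OF w0_mem g(1) f(1)]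
      by (simp add: Co_simps(6) DC_pr poly_funs.mult \<Delta>_poly)
  }
next
  show "\<one>\<^bsub>Co\<^esub> \<in> grade Co 0" using homog_cst[of 1] by (auto simp: Co_simps(2,4) grade_Sy)
  show "grade Co d \<subseteq> carrier Co" for d using grade_Sy_poly by (auto simp: Co_simps(1,2))
  then show "grade CoJ d \<subseteq> carrier CoJ" for d by (auto simp: CoJ_simps)
  show "const Co c \<in> carrier CoJ" for c by (simp add: const_Co carrier_CoJ)
  show "const Co (c + c') = const Co c \<oplus>\<^bsub>Co\<^esub> const Co c'" for c c'
    by (simp add: const_Co Co_simps(5) cst_add)
  show "const Co 0 = \<zero>\<^bsub>Co\<^esub>" by (simp add: const_Co Co_simps(3))
  show "carrier CoJ \<subseteq> carrier Co" by (simp add: CoJ_simps)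
  show "grade CoJ d \<subseteq> grade Co d" for d by (simp add: CoJ_ops(6))
qed (simp_all add: cring_Co cring_CoJ CoJ_ops(1-5) finite_GJ)

lemma free_basis_coinvariants: "free_basis CoJ (res CoJ (regular Co)) (G J) (\<lambda>w. pr (b w))"
proof (rule frobenius_pair.free_basis_y[OF frobenius_coinvariants])
  fix v w assume "v \<in> G J" "w \<in> G J"
  then show "DC (pr (b v) \<otimes>\<^bsub>Co\<^esub> pr (dualb w)) = (if v = w then \<one>\<^bsub>Co\<^esub> else \<zero>\<^bsub>Co\<^esub>)"
    using b_poly dualb_poly by (simp add: Co_simps(3,4,6) DC_pr poly_funs.mult D_b_dualb)
qed

end

theorem proposition3p11:
  fixes sc :: "complex \<Rightarrow> 'h::ab_group_add \<Rightarrow> 'h"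
    and cr :: "('h \<Rightarrow> complex) \<Rightarrow> 'h"
    and \<Phi> simples J :: "('h \<Rightarrow> complex) set"
    and C CJ :: "(complex, ('h \<Rightarrow> complex) set) graded"
  assumes "root_system sc \<Phi> cr"
    and "simple_roots \<Phi> simples"
    and "J \<subseteq> simples"
    and C: "C = coinv_alg sc cr \<Phi>"
    and CJ: "CJ = coinv_inv sc cr \<Phi> J"
  shows "free_basis CJ (res CJ (regular C)) (refl_group sc cr J)
           (\<lambda>w. coinv_proj sc cr \<Phi> (demazure_elt sc cr simples w (mu cr \<Phi> simples J)))
       \<and> gadjoint CJ C
           (ind C CJ :: (('h \<Rightarrow> complex) set, 'm) graded \<Rightarrow> _) (ind_mor C CJ)
           (res CJ :: (('h \<Rightarrow> complex) set, 'n) graded \<Rightarrow> _) res_mor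
       \<and> gadjoint C CJ
           (res CJ :: (('h \<Rightarrow> complex) set, 'm) graded \<Rightarrow> _) res_mor
           (\<lambda>N :: (('h \<Rightarrow> complex) set, 'n) graded.
              shift (- 2 * int (weyl_length sc cr simples (longest sc cr simples J))) (ind C CJ N))
           (ind_mor C CJ)"
proof -
  interpret parabolic sc \<Phi> cr simples J
    using assms(1-3) by (intro parabolic.intro root_basis.intro root_basis_axioms.intro parabolic_axioms.intro)
  note F = frobenius_coinvariants[folded C CJ]
  show ?thesis
    using free_basis_coinvariants[folded C CJ] frobenius_pair.ind_res_adjoint[OF F]
      frobenius_pair.res_ind_adjoint[OF F] by simp
qed

end
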